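(* Let $T>0$, $D=[0,\pi]$, $H\in(\tfrac12,1)$, $\sigma\in\mathbb R$, let $f$ be a polynomial of degree three with constant real coefficients and positive leading coefficient, and let $u_0\in C(D)$ be deterministic. Let $u$ be the unique solution of the mild equation $$u(x,t)=\int_DG(x,y,t)u_0(y)\,dy+\int_0^t\int_DG_{yy}(x,y,t-s)f(u(y,s))\,dyds+\sigma\int_0^t\int_DG(x,y,t-s)\,W_H(dy,ds),$$ $(x,t)\in D\times[0,T]$. Then $u$ is almost surely continuous in space-time for any $(x,t)\in D\times[0,T]$.
   Context: **Green's function.** $G(x,y,t)=\sum_{k=0}^\infty e^{-k^4t}a_k(x)a_k(y)$ for $x,y\in D$, $t>0$, where $a_0=\frac1{\sqrt\pi}$, $a_k(x)=\sqrt{\tfrac2\pi}\cos(kx)$ for $k\ge1$ (Green's function of $\partial_t+\partial_x^4$ with homogeneous Neumann conditions; the first term of the mild equation is read as $u_0(x)$ at $t=0$). **Noise.** On a complete probability space $(\Omega,\mathcal F,\mathbb P)$, $\{W_H(U\times[0,t]): U\in\mathcal B(D),\,t\in[0,T]\}$ is a centered Gaussian random field with covariance $E\big(W_H(U\times[0,t])W_H(V\times[0,s])\big)=m(U\cap V)\,\frac{t^{2H}+s^{2H}-|t-s|^{2H}}{2}$, $m$ being Lebesgue measure. $\{\mathcal F_t\}_{t\in[0,T]}$ is the filtration generated by $W_H$, augmented to satisfy the usual conditions. Let $\mathcal H$ be the Hilbert space closure of the step functions on $D\times[0,T]$ under $\langle \mathbf 1_{U\times[0,t]},\mathbf 1_{V\times[0,s]}\rangle_{\mathcal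 H}=E\big(W_H(U\times[0,t])W_H(V\times[0,s])\big)$. The map $\mathbf 1_{U\times[0,t]}\mapsto W_H(U\times[0,t])$ extends to an isometry $\hat W_H$ from $\mathcal H$ onto a closed subspace of $L^2(\Omega)$, and one writes $\int_0^T\int_D\phi(y,s)\,W_H(dy,ds):=\hat W_H(\phi)$; integrals over $[0,t]$ are obtained by inserting $\mathbf 1_{[0,t]}(s)$ in the integrand. **Solution.** It is known that the mild equation (holding almost surely for any $x\in D$, $t\in[0,T]$) has a unique (global) $\mathcal F_t$-adapted solution $u$ with $u\in C([0,T];L^p(D))$ almost surely, for some suitable $p\ge4$; this is the $u$ of the statement. *)

theory Defs
  imports "HOL-Probability.Probability" "HOL-Computational_Algebra.Polynomial"
begin

abbreviation D :: "real set" where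
  "D \<equiv> {0..pi}"

subsection \<open>Green's function\<close>

definition mode :: "nat \<Rightarrow> real \<Rightarrow> real" where
  "mode k x = (if k = 0 then 1 / sqrt pi else sqrt (2 / pi) * cos (real k * x))"

text \<open>Only meaningful for \<open>t > 0\<close>; for \<open>t = 0\<close> the series diverges in general. The space-time integrals
  below evaluate it at time \<open>t - s\<close> with \<open>s \<le> t\<close>, so this affects only the null set \<open>s = t\<close>.\<close>

definition green :: "real \<Rightarrow> real \<Rightarrow> real \<Rightarrow> real" where
  "green x y t = (\<Sum>k. exp (- (real k ^ 4 * t)) * mode k x * mode k y)"

definition green_yy :: "real \<Rightarrow> real \<Rightarrow> real \<Rightarrow> real" where
  "green_yy x y t = deriv (deriv (\<lambda>z. green x z t)) y"

subsection \<open>Noise\<close>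

definition noise_cov :: "real \<Rightarrow> real set \<Rightarrow> real \<Rightarrow> real set \<Rightarrow> real \<Rightarrow> real" where
  "noise_cov H U t V s = measure lborel (U \<inter> V) *
     ((t powr (2 * H) + s powr (2 * H) - \<bar>t - s\<bar> powr (2 * H)) / 2)"

text \<open>A list of triples \<open>(c, U, t)\<close> stands for the step function given by the sum of the
  \<open>c \<cdot> 1\<^bsub>U \<times> [0,t]\<^esub>\<close>. Working with such formal combinations, the inner product and the
  noise are extended from indicators by (bi)linearity without any choice of representation.\<close>

type_synonym step = "(real \<times> real set \<times> real) list"

definition is_step :: "real \<Rightarrow> step \<Rightarrow> bool" where
  "is_step T \<phi> \<longleftrightarrow> (\<forall>(c, U, t) \<in> set \<phi>. U \<in> sets borel \<and> U \<subseteq> D \<and> t \<in> {0..T})"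

definition step_fun :: "step \<Rightarrow> real \<times> real \<Rightarrow> real" where
  "step_fun \<phi> z = (\<Sum>(c, U, t) \<leftarrow> \<phi>. c * indicator (U \<times> {0..t}) z)"

definition step_diff :: "step \<Rightarrow> step \<Rightarrow> step" where
  "step_diff \<phi> \<psi> = \<phi> @ map (\<lambda>(c, U, t). (- c, U, t)) \<psi>"

definition step_noise :: "(real set \<Rightarrow> real \<Rightarrow> 'a \<Rightarrow> real) \<Rightarrow> step \<Rightarrow> 'a \<Rightarrow> real" where
  "step_noise W \<phi> \<omega> = (\<Sum>(c, U, t) \<leftarrow> \<phi>. c * W U t \<omega>)"

definition step_inner :: "real \<Rightarrow> step \<Rightarrow> step \<Rightarrow> real" where
  "step_inner H \<phi> \<psi> = (\<Sum>(c, U, t) \<leftarrow> \<phi>. \<Sum>(d, V, s) \<leftarrow> \<psi>. c * d * noise_cov H U t V s)"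

definition step_norm :: "real \<Rightarrow> step \<Rightarrow> real" where
  "step_norm H \<phi> = sqrt (step_inner H \<phi> \<phi>)"

definition centered_gaussian :: "'a measure \<Rightarrow> ('a \<Rightarrow> real) \<Rightarrow> bool" where
  "centered_gaussian M X \<longleftrightarrow> X \<in> borel_measurable M \<and>
     ((AE \<omega> in M. X \<omega> = 0) \<or> (\<exists>s>0. distributed M lborel X (normal_density 0 s)))"

text \<open>\<open>W U t\<close> is the value of the noise on \<open>U \<times> [0,t]\<close>. A field is Gaussian when all its finite
  linear combinations are (possibly degenerate) Gaussian random variables.\<close>

definition fractional_noise ::
  "'a measure \<Rightarrow> real \<Rightarrow> real \<Rightarrow> (real set \<Rightarrow> real \<Rightarrow> 'a \<Rightarrow> real) \<Rightarrow> bool" where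
  "fractional_noise M H T W \<longleftrightarrow>
     (\<forall>\<phi>. is_step T \<phi> \<longrightarrow> centered_gaussian M (step_noise W \<phi>)) \<and>
     (\<forall>U \<in> sets borel. \<forall>V \<in> sets borel. \<forall>t \<in> {0..T}. \<forall>s \<in> {0..T}. U \<subseteq> D \<longrightarrow> V \<subseteq> D \<longrightarrow>
        (\<integral>\<omega>. W U t \<omega> * W V s \<omega> \<partial>M) = noise_cov H U t V s)"

definition noise_gen ::
  "'a measure \<Rightarrow> (real set \<Rightarrow> real \<Rightarrow> 'a \<Rightarrow> real) \<Rightarrow> real \<Rightarrow> 'a measure" where
  "noise_gen M W t = sigma (space M)
     (null_sets M \<union> {W U r -` B \<inter> space M | U r B.
        U \<in> sets borel \<and> U \<subseteq> D \<and> r \<in> {0..t} \<and> B \<in> sets borel})"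

text \<open>Usual augmentation on the time interval \<open>[0,T]\<close>. Adding the index \<open>T\<close> changes nothing for
  \<open>t < T\<close> and gives the final \<open>\<sigma>\<close>-algebra for \<open>t = T\<close>.\<close>

definition noise_filtration ::
  "'a measure \<Rightarrow> real \<Rightarrow> (real set \<Rightarrow> real \<Rightarrow> 'a \<Rightarrow> real) \<Rightarrow> real \<Rightarrow> 'a measure" where
  "noise_filtration M T W t =
     sigma (space M) (\<Inter>s \<in> insert T {t<..T}. sets (noise_gen M W s))"

subsection \<open>Wiener integral\<close>

text \<open>The space \<open>\<H>\<close> is the completion of the step functions under \<open>step_inner H\<close>, so its
  elements are given by Cauchy sequences of step functions. A function \<open>\<phi>\<close> on \<open>D \<times> [0,T]\<close> is
  identified with the element given by a Cauchy sequence that also converges to \<open>\<phi>\<close> in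
  \<open>L\<^sup>1(D \<times> [0,T])\<close>. For \<open>H > 1/2\<close> this element is unique: pairing with a fixed indicator
  \<open>1\<^bsub>V \<times> [0,s]\<^esub>\<close> is integration against a bounded function, hence continuous in \<open>L\<^sup>1\<close>, so a
  Cauchy sequence that tends to \<open>0\<close> in \<open>L\<^sup>1\<close> has a limit orthogonal to all step functions.\<close>

definition represents :: "real \<Rightarrow> real \<Rightarrow> (nat \<Rightarrow> step) \<Rightarrow> (real \<times> real \<Rightarrow> real) \<Rightarrow> bool" where
  "represents H T S \<phi> \<longleftrightarrow>
     (\<forall>n. is_step T (S n)) \<and>
     (\<forall>e>0. \<exists>N. \<forall>m\<ge>N. \<forall>n\<ge>N. step_norm H (step_diff (S m) (S n)) < e) \<and>
     set_integrable lborel (D \<times> {0..T}) \<phi> \<and>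
     (\<lambda>n. LINT z:D \<times> {0..T}|lborel. \<bar>step_fun (S n) z - \<phi> z\<bar>) \<longlonglongrightarrow> 0"

text \<open>\<open>X\<close> is a version of the isometric extension of the noise, evaluated at \<open>\<phi>\<close>.\<close>

definition has_wiener_integral ::
  "'a measure \<Rightarrow> real \<Rightarrow> real \<Rightarrow> (real set \<Rightarrow> real \<Rightarrow> 'a \<Rightarrow> real) \<Rightarrow>
   (real \<times> real \<Rightarrow> real) \<Rightarrow> ('a \<Rightarrow> real) \<Rightarrow> bool" where
  "has_wiener_integral M H T W \<phi> X \<longleftrightarrow>
     X \<in> borel_measurable M \<and> integrable M (\<lambda>\<omega>. (X \<omega>)\<^sup>2) \<and>
     (\<exists>S. represents H T S \<phi> \<and> (\<lambda>n. \<integral>\<omega>. (step_noise W (S n) \<omega> - X \<omega>)\<^sup>2 \<partial>M) \<longlonglongrightarrow> 0)"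

subsection \<open>Mild solution\<close>

definition initial_term :: "(real \<Rightarrow> real) \<Rightarrow> real \<Rightarrow> real \<Rightarrow> real" where
  "initial_term u0 x t = (if t = 0 then u0 x else (LINT y:D|lborel. green x y t * u0 y))"

definition drift_term :: "real poly \<Rightarrow> (real \<Rightarrow> real \<Rightarrow> real) \<Rightarrow> real \<Rightarrow> real \<Rightarrow> real" where
  "drift_term f v x t =
     (LINT s:{0..t}|lborel. (LINT y:D|lborel. green_yy x y (t - s) * poly f (v y s)))"

text \<open>The stochastic term of the equation exists, for each point \<open>(x,t)\<close>, only up to a null set.\<close>

definition mild_equation ::
  "'a measure \<Rightarrow> real \<Rightarrow> real \<Rightarrow> (real set \<Rightarrow> real \<Rightarrow> 'a \<Rightarrow> real) \<Rightarrow> real \<Rightarrow> real poly \<Rightarrow>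
   (real \<Rightarrow> real) \<Rightarrow> (real \<Rightarrow> real \<Rightarrow> 'a \<Rightarrow> real) \<Rightarrow> bool" where
  "mild_equation M H T W \<sigma> f u0 u \<longleftrightarrow>
     (\<forall>x \<in> D. \<forall>t \<in> {0..T}.
        \<exists>Z. has_wiener_integral M H T W (\<lambda>(y, s). indicator {0..t} s * green x y (t - s)) Z \<and>
            (AE \<omega> in M. u x t \<omega> =
               initial_term u0 x t + drift_term f (\<lambda>y s. u y s \<omega>) x t + \<sigma> * Z \<omega>))"

definition in_Lp :: "real \<Rightarrow> (real \<Rightarrow> real) \<Rightarrow> bool" where
  "in_Lp p g \<longleftrightarrow> set_borel_measurable lborel D g \<and> set_integrable lborel D (\<lambda>y. \<bar>g y\<bar> powr p)"

definition Lp_norm :: "real \<Rightarrow> (real \<Rightarrow> real) \<Rightarrow> real" where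
  "Lp_norm p g = (LINT y:D|lborel. \<bar>g y\<bar> powr p) powr (1 / p)"

definition Lp_continuous :: "real \<Rightarrow> real \<Rightarrow> (real \<Rightarrow> real \<Rightarrow> real) \<Rightarrow> bool" where
  "Lp_continuous p T v \<longleftrightarrow>
     (\<forall>t \<in> {0..T}. in_Lp p (\<lambda>y. v y t)) \<and>
     (\<forall>t \<in> {0..T}. ((\<lambda>s. Lp_norm p (\<lambda>y. v y s - v y t)) \<longlongrightarrow> 0) (at t within {0..T}))"

text \<open>The measurability in \<open>(x,\<omega>)\<close> for each \<open>t\<close> expresses that \<open>u(\<cdot>,t)\<close> is a random element of
  \<open>L\<^sup>p(D)\<close>.\<close>

definition mild_solution ::
  "'a measure \<Rightarrow> real \<Rightarrow> real \<Rightarrow> (real set \<Rightarrow> real \<Rightarrow> 'a \<Rightarrow> real) \<Rightarrow> real \<Rightarrow> real poly \<Rightarrow>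
   (real \<Rightarrow> real) \<Rightarrow> real \<Rightarrow> (real \<Rightarrow> real \<Rightarrow> 'a \<Rightarrow> real) \<Rightarrow> bool" where
  "mild_solution M H T W \<sigma> f u0 p u \<longleftrightarrow>
     (\<forall>t \<in> {0..T}. (\<lambda>(x, \<omega>). u x t \<omega>) \<in> borel_measurable (restrict_space borel D \<Otimes>\<^sub>M M)) \<and>
     (\<forall>x \<in> D. \<forall>t \<in> {0..T}. u x t \<in> borel_measurable (noise_filtration M T W t)) \<and>
     (AE \<omega> in M. Lp_continuous p T (\<lambda>x t. u x t \<omega>)) \<and>
     mild_equation M H T W \<sigma> f u0 u"

text \<open>The equation determines \<open>u(x,t)\<close> only up to a null set depending on \<open>(x,t)\<close>, and the path space
  \<open>C([0,T]; L\<^sup>p(D))\<close> determines \<open>u(\<cdot>,t)\<close> only up to a Lebesgue null set of points. Almost sure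
  continuity in space-time is therefore a statement about a version of \<open>u\<close>, the two having to agree
  in both of these senses; in the second one, outside a single event of probability zero and for all
  times at once.\<close>

definition version_of ::
  "'a measure \<Rightarrow> real \<Rightarrow> (real \<Rightarrow> real \<Rightarrow> 'a \<Rightarrow> real) \<Rightarrow> (real \<Rightarrow> real \<Rightarrow> 'a \<Rightarrow> real) \<Rightarrow> bool" where
  "version_of M T u v \<longleftrightarrow>
     (\<forall>x \<in> D. \<forall>t \<in> {0..T}. AE \<omega> in M. v x t \<omega> = u x t \<omega>) \<and>
     (AE \<omega> in M. \<forall>t \<in> {0..T}. AE y in lborel. y \<in> D \<longrightarrow> v y t \<omega> = u y t \<omega>)"

definition as_continuous :: "'a measure \<Rightarrow> real \<Rightarrow> (real \<Rightarrow> real \<Rightarrow> 'a \<Rightarrow> real) \<Rightarrow> bool" where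
  "as_continuous M T v \<longleftrightarrow>
     (AE \<omega> in M. continuous_on (D \<times> {0..T}) (\<lambda>(x, t). v x t \<omega>))"

end

theory Submission
  imports Defs
begin

text \<open>
  All three terms of the mild equation are expanded in cosine modes. In the drift term the second derivative costs a
  factor \<open>k\<^sup>2\<close> in the \<open>k\<close>-th mode while integration in time gains \<open>k\<close> to the power \<open>-4\<close>; the path
  \<open>f(u(\<cdot>,s))\<close> is continuous in \<open>L\<^sup>1\<close> because \<open>p \<ge> 4 > 3\<close>, so the series converges uniformly. For the initial term the
  Green function is bounded in \<open>L\<^sup>1\<close> uniformly in time, by two summations by parts in its theta kernel, which reduces
  the claim to cosine polynomials by density. The modes of the noise are fractional Brownian motions up to scaling;
  Kolmogorov's criterion with eighth moments makes them Hoelder continuous with exponent \<open>3/8\<close>, so the \<open>k\<close>-th mode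
  of the stochastic convolution is of order \<open>k\<close> to the power \<open>-3/2\<close>, up to a random constant. Finally, two paths
  that agree almost surely at each point are matched at dyadic times by Fubini and at all times by continuity.
\<close>

section \<open>Cosine modes and the Green function\<close>

text \<open>The mild equation gives the stochastic term only up to a null set that depends on the
  point, through some approximating sequence of step functions. Exchanging the mode series with the
  Wiener integral therefore rests on closability of the noise as an operator from L1 to L2. For H >
  1/2 this holds because covariances with a fixed indicator are integrals against a bounded kernel.
  The exponents are tied together. Regularity gamma of a noise mode gives its convolution the decay
  k^(-4 gamma), and one random constant for all modes, obtained from q-th moments, costs k^(2/q).
  With q = 8 and gamma = 3/8 the summable k^(-5/4) remains, and Kolmogorov's criterion asks for 3 <
  8 H - 1, which is H > 1/2. Near t = 0 the initial term is delicate: a fourth-order operator has no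
  maximum principle, so the uniform L1 bound has to come from a pointwise estimate of the
  kernel.\<close>

lemma abs_mode_le: "\<bar>mode k x\<bar> \<le> 1"
proof -
  have "sqrt (2/pi) \<le> 1" "1 / sqrt pi \<le> 1"
    using pi_ge_two by (auto simp: divide_le_eq)
  moreover have "\<bar>sqrt (2/pi) * cos (real k * x)\<bar> \<le> sqrt (2/pi) * 1"
    unfolding abs_mult by (intro mult_mono) auto
  ultimately show ?thesis unfolding mode_def by (smt (verit) divide_nonneg_pos pi_gt_zero real_sqrt_gt_zero)
qed

lemma abs_mode_mult_le: "\<bar>c * mode k x\<bar> \<le> \<bar>c\<bar>"
  using mult_left_mono[OF abs_mode_le[of k x], of "\<bar>c\<bar>"] by (simp add: abs_mult)

lemma continuous_on_mode [continuous_intros]: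
  fixes g :: "'a::t2_space \<Rightarrow> real"
  assumes "continuous_on A g"
  shows "continuous_on A (\<lambda>x. mode k (g x))"
proof (cases "k = 0")
  case True
  thus ?thesis by (simp add: mode_def)
next
  case False
  hence "mode k (g x) = sqrt (2 / pi) * cos (real k * g x)" for x by (simp add: mode_def)
  moreover have "continuous_on A (\<lambda>x. sqrt (2 / pi) * cos (real k * g x))"
    using assms by (intro continuous_intros)
  ultimately show ?thesis by simp
qed

lemma borel_measurable_mode [measurable]: "mode k \<in> borel_measurable borel"
  by (intro borel_measurable_continuous_onI continuous_intros)

lemma mode_lipschitz: "\<bar>mode k x - mode k y\<bar> \<le> real k * \<bar>x - y\<bar>"
proof (cases "k = 0")
  case False
  have 1: "sqrt (2/pi) \<le> 1"
    using pi_ge_two by (auto simp: divide_le_eq)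
  have "\<bar>sin ((real k * x + real k * y) / 2) * sin ((real k * y - real k * x) / 2)\<bar> \<le> 1 * \<bar>(real k * y - real k * x) / 2\<bar>"
    unfolding abs_mult by (intro mult_mono abs_sin_x_le_abs_x) auto
  hence 2: "\<bar>cos (real k * x) - cos (real k * y)\<bar> \<le> \<bar>real k * y - real k * x\<bar>"
    by (simp add: cos_diff_cos abs_mult)
  have "\<bar>mode k x - mode k y\<bar> = sqrt (2/pi) * \<bar>cos (real k * x) - cos (real k * y)\<bar>"
    using False by (simp add: mode_def abs_mult flip: right_diff_distrib)
  also have "\<dots> \<le> 1 * \<bar>real k * y - real k * x\<bar>"
    by (intro mult_mono 1 2) auto
  also have "\<dots> = real k * \<bar>x - y\<bar>"
    by (simp add: abs_mult abs_minus_commute flip: right_diff_distrib)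
  finally show ?thesis .
qed (simp add: mode_def)

text \<open>With v = k^4 t, the estimate exp v >= v^2/2 gives exp(-v) <= 2/(k^8 t^2), so a factor
  k^6 still leaves the summable k^(-2).\<close>

lemma summable_power_exp:
  assumes "t > 0" "j \<le> 6"
  shows "summable (\<lambda>k. real k ^ j * exp (- (real k ^ 4 * t)))"
proof -
  have "summable (\<lambda>k. 2 / t^2 * inverse (real k ^ 2))"
    by (intro summable_mult inverse_power_summable) simp
  moreover have "norm (real k ^ j * exp (- (real k ^ 4 * t))) \<le> 2 / t^2 * inverse (real k ^ 2)" if "k \<ge> 1" for k
  proof -
    have k: "real k \<ge> 1" using that by simp
    define v where "v = real k ^ 4 * t"
    have v: "v > 0" using k assms by (simp add: v_def)
    have "v\<^sup>2 / 2 \<le> exp v"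
      using exp_lower_Taylor_quadratic[of v] v by linarith
    hence "inverse (exp v) \<le> inverse (v\<^sup>2 / 2)"
      using v by (intro le_imp_inverse_le) auto
    moreover have "v\<^sup>2 = real k ^ 8 * t\<^sup>2"
      by (simp add: v_def power_mult_distrib flip: power_mult)
    ultimately have "exp (- (real k ^ 4 * t)) \<le> 2 / (real k ^ 8 * t\<^sup>2)"
      unfolding v_def[symmetric] by (simp add: exp_minus inverse_eq_divide)
    moreover have "real k ^ j \<le> real k ^ 6" using k assms by (intro power_increasing) auto
    ultimately have "real k ^ j * exp (- (real k ^ 4 * t)) \<le> real k ^ 6 * (2 / (real k ^ 8 * t\<^sup>2))"
      by (intro mult_mono) auto
    also have "\<dots> = (real k ^ 6 * 2) / (real k ^ 6 * (real k ^ 2 * t\<^sup>2))"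
      by (simp flip: power_add mult.assoc)
    also have "\<dots> = 2 / t\<^sup>2 * inverse (real k ^ 2)"
      using k by (subst mult_divide_mult_cancel_left) (auto simp: inverse_eq_divide mult.commute)
    finally show ?thesis by (simp add: abs_mult)
  qed
  ultimately show ?thesis
    by (rule summable_comparison_test'[where N = 1])
qed

section \<open>Absolutely convergent series of modes\<close>

lemma summable_mode:
  assumes "summable (\<lambda>k. \<bar>c k\<bar>)"
  shows "summable (\<lambda>k. \<bar>c k * mode k y\<bar>)" "summable (\<lambda>k. c k * mode k y)"
proof -
  show "summable (\<lambda>k. \<bar>c k * mode k y\<bar>)"
    by (rule summable_comparison_test'[OF assms, of 0]) (use abs_mode_mult_le in auto)
  thus "summable (\<lambda>k. c k * mode k y)" by (rule summable_rabs_cancel)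
qed

lemma continuous_on_mode_series:
  assumes "summable (\<lambda>k. \<bar>c k\<bar>)"
  shows "continuous_on A (\<lambda>y. \<Sum>k. c k * mode k y)"
proof (rule uniform_limit_theorem)
  show "uniform_limit A (\<lambda>n y. \<Sum>k<n. c k * mode k y) (\<lambda>y. \<Sum>k. c k * mode k y) sequentially"
    by (rule Weierstrass_m_test[OF _ assms]) (use abs_mode_mult_le in auto)
qed (auto intro!: always_eventually continuous_intros)

lemma mode_times_integrable:
  assumes g: "set_integrable lborel A g"
  shows "set_integrable lborel A (\<lambda>y. mode k y * g y)"
  unfolding set_integrable_def
proof (rule Bochner_Integration.integrable_bound)
  show "integrable lborel (\<lambda>y. indicator A y *\<^sub>R g y)" using g by (simp add: set_integrable_def)
  hence "(\<lambda>y. mode k y * (indicator A y *\<^sub>R g y)) \<in> borel_measurable lborel" by measurable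
  thus "(\<lambda>y. indicator A y *\<^sub>R (mode k y * g y)) \<in> borel_measurable lborel" by (simp add: mult_ac)
  show "AE x in lborel. norm (indicator A x *\<^sub>R (mode k x * g x)) \<le> norm (indicator A x *\<^sub>R g x)"
    using abs_mode_mult_le by (auto simp: indicator_def mult.commute)
qed

text \<open>The L1 norm of the k-th term is at most |c k| times the L1 norm of g; summability of
  these norms justifies the exchange of sum and integral.\<close>

lemma mode_series_integral:
  assumes "summable (\<lambda>k. \<bar>c k\<bar>)" and g: "set_integrable lborel A g"
  shows "(LINT y:A|lborel. (\<Sum>k. c k * mode k y) * g y) = (\<Sum>k. c k * (LINT y:A|lborel. mode k y * g y))"
    and "summable (\<lambda>k. \<bar>c k * (LINT y:A|lborel. mode k y * g y)\<bar>)"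
    and "\<bar>LINT y:A|lborel. mode k y * g y\<bar> \<le> (LINT y:A|lborel. \<bar>g y\<bar>)"
proof -
  have int: "set_integrable lborel A (\<lambda>y. mode k y * g y)" for k
    by (rule mode_times_integrable[OF g])
  have g': "set_integrable lborel A (\<lambda>y. \<bar>g y\<bar>)" using g by (rule set_integrable_abs)
  have le: "(LINT y:A|lborel. \<bar>mode k y * g y\<bar>) \<le> (LINT y:A|lborel. \<bar>g y\<bar>)" for k
    by (intro set_integral_mono set_integrable_abs int g) (use abs_mode_mult_le in \<open>auto simp: mult.commute\<close>)
  have nn: "0 \<le> (LINT y:A|lborel. \<bar>mode k y * g y\<bar>)" for k
    unfolding set_lebesgue_integral_def by (intro Bochner_Integration.integral_nonneg) auto
  have "\<bar>LINT y:A|lborel. mode k y * g y\<bar> \<le> (LINT y:A|lborel. \<bar>mode k y * g y\<bar>)" for k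
    using set_integral_norm_bound[OF int[of k]] by simp
  with le show *: "\<bar>LINT y:A|lborel. mode k y * g y\<bar> \<le> (LINT y:A|lborel. \<bar>g y\<bar>)" for k
    by (meson order_trans)
  have s: "summable (\<lambda>k. \<bar>c k\<bar> * (LINT y:A|lborel. \<bar>g y\<bar>))"
    using assms(1) by (rule summable_mult2)
  show "summable (\<lambda>k. \<bar>c k * (LINT y:A|lborel. mode k y * g y)\<bar>)"
    by (rule summable_comparison_test'[OF s, of 0]) (auto simp: abs_mult intro!: mult_left_mono *)
  have "(LINT y:A|lborel. (\<Sum>k. c k * mode k y) * g y) = (LINT y|lborel. (\<Sum>k. indicator A y * (c k * mode k y * g y)))"
    unfolding set_lebesgue_integral_def
    by (intro Bochner_Integration.integral_cong refl)
       (simp add: suminf_mult suminf_mult2 summable_mode(2)[OF assms(1)] summable_mult2)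
  also have "\<dots> = (\<Sum>k. LINT y|lborel. indicator A y * (c k * mode k y * g y))"
  proof (rule integral_suminf)
    show "integrable lborel (\<lambda>y. indicator A y * (c k * mode k y * g y))" for k
      using int[of k, unfolded set_integrable_def, THEN integrable_mult_right, of "c k"] by (simp add: mult_ac)
    show "AE y in lborel. summable (\<lambda>k. norm (indicator A y * (c k * mode k y * g y)))"
    proof (intro always_eventually allI)
      fix y
      have "summable (\<lambda>k. \<bar>c k * mode k y\<bar> * \<bar>indicator A y * g y\<bar>)"
        by (intro summable_mult2 summable_mode assms)
      thus "summable (\<lambda>k. norm (indicator A y * (c k * mode k y * g y)))"
        by (simp add: abs_mult mult_ac)
    qed
    have "(LINT y|lborel. norm (indicator A y * (c k * mode k y * g y))) = \<bar>c k\<bar> * (LINT y:A|lborel. \<bar>mode k y * g y\<bar>)" for k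
      unfolding set_lebesgue_integral_def by (subst integral_mult_right_zero[symmetric]) (simp add: abs_mult mult_ac)
    moreover have "norm (\<bar>c k\<bar> * (LINT y:A|lborel. \<bar>mode k y * g y\<bar>)) \<le> \<bar>c k\<bar> * (LINT y:A|lborel. \<bar>g y\<bar>)" for k
      using mult_left_mono[OF le, of "\<bar>c k\<bar>" k] nn[of k] by (subst real_norm_def, subst abs_of_nonneg) (auto simp del: abs_mult)
    ultimately show "summable (\<lambda>k. LINT y|lborel. norm (indicator A y * (c k * mode k y * g y)))"
      by (intro summable_comparison_test'[OF s, of 0]) simp_all
  qed
  also have "\<dots> = (\<Sum>k. c k * (LINT y:A|lborel. mode k y * g y))"
    unfolding set_lebesgue_integral_def by (subst integral_mult_right_zero[symmetric]) (simp add: mult_ac)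
  finally show "(LINT y:A|lborel. (\<Sum>k. c k * mode k y) * g y) = (\<Sum>k. c k * (LINT y:A|lborel. mode k y * g y))" .
qed

section \<open>Termwise differentiation of the Green function\<close>

lemma summable_green:
  assumes "t > 0"
  shows "summable (\<lambda>k. \<bar>exp (- (real k ^ 4 * t)) * mode k x\<bar>)"
  using summable_power_exp[OF assms, of 0] by (intro summable_mode) simp

text \<open>Two termwise differentiations, justified for t > 0 by the majorants k exp(-k^4 t) and
  k^2 exp(-k^4 t), which are uniform in y.\<close>

lemma green_yy_eq:
  assumes t: "t > 0"
  shows "green_yy x y t = (\<Sum>k. - (real k ^ 2 * exp (- (real k ^ 4 * t)) * mode k x) * mode k y)"
proof -
  define c where "c k = exp (- (real k ^ 4 * t)) * mode k x" for k
  have c: "\<bar>c k\<bar> \<le> exp (- (real k ^ 4 * t))" for k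
    using abs_mode_mult_le[of "exp (- (real k ^ 4 * t))" k x] by (simp add: c_def)
  \<comment> \<open>The factor k makes this formula vanish for k = 0, so it is also the derivative
    of the constant mode.\<close>
  define m' where "m' k y = - (sqrt (2/pi) * real k * sin (real k * y))" for k :: nat and y
  have m1: "(mode k has_field_derivative m' k y) (at y)" for k y
    unfolding mode_def [abs_def] m'_def by (cases "k = 0") (auto intro!: derivative_eq_intros)
  have m2: "(m' k has_field_derivative - (real k ^ 2) * mode k y) (at y)" for k y
    unfolding mode_def m'_def [abs_def]
    by (cases "k = 0") (auto intro!: derivative_eq_intros simp: power2_eq_square)
  have s: "sqrt (2/pi) \<le> 1" using pi_ge_two by (auto simp: divide_le_eq)
  have m'_le: "\<bar>m' k y\<bar> \<le> real k" for k y
  proof -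
    have "\<bar>m' k y\<bar> \<le> 1 * real k * 1"
      unfolding m'_def abs_minus abs_mult by (intro mult_mono) (use s in auto)
    thus ?thesis by simp
  qed
  have "(\<lambda>z. green x z t) = (\<lambda>z. \<Sum>k. c k * mode k z)"
    by (simp add: green_def c_def)
  have d1: "((\<lambda>z. \<Sum>k. c k * mode k z) has_field_derivative (\<Sum>k. c k * m' k y)) (at y)" for y
  proof (rule has_field_derivative_series'(2)[where S = UNIV and ?x0.0 = 0 and f = "\<lambda>k z. c k * mode k z" and f' = "\<lambda>k z. c k * m' k z"])
    show "((\<lambda>z. c k * mode k z) has_field_derivative c k * m' k y) (at y within UNIV)" for k y
      using DERIV_cmult[OF m1] by simp
    show "uniformly_convergent_on UNIV (\<lambda>n z. \<Sum>k<n. c k * m' k z)"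
    proof (rule Weierstrass_m_test'[OF _ summable_power_exp[OF t, of 1]])
      show "norm (c k * m' k z) \<le> real k ^ 1 * exp (- (real k ^ 4 * t))" for k z
        using mult_mono[OF c m'_le, of k k z] by (simp add: abs_mult mult.commute)
    qed simp
    show "summable (\<lambda>k. c k * mode k 0)"
      using summable_green[OF t, of x] by (intro summable_mode) (simp add: c_def)
  qed auto
  have d2: "((\<lambda>z. \<Sum>k. c k * m' k z) has_field_derivative (\<Sum>k. c k * (- (real k ^ 2) * mode k y))) (at y)" for y
  proof (rule has_field_derivative_series'(2)[where S = UNIV and ?x0.0 = 0 and f = "\<lambda>k z. c k * m' k z"
        and f' = "\<lambda>k z. c k * (- (real k ^ 2) * mode k z)"])
    show "((\<lambda>z. c k * m' k z) has_field_derivative c k * (- (real k ^ 2) * mode k y)) (at y within UNIV)" for k y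
      using DERIV_cmult[OF m2] by simp
    show "uniformly_convergent_on UNIV (\<lambda>n z. \<Sum>k<n. c k * (- (real k ^ 2) * mode k z))"
    proof (rule Weierstrass_m_test'[OF _ summable_power_exp[OF t, of 2]])
      show "norm (c k * (- (real k ^ 2) * mode k z)) \<le> real k ^ 2 * exp (- (real k ^ 4 * t))" for k z
      proof -
        have "norm (c k * (- (real k ^ 2) * mode k z)) = \<bar>c k\<bar> * (real k ^ 2 * \<bar>mode k z\<bar>)"
          by (simp add: abs_mult)
        also have "\<dots> \<le> exp (- (real k ^ 4 * t)) * (real k ^ 2 * 1)"
          by (intro mult_mono mult_left_mono c abs_mode_le) auto
        finally show ?thesis by (simp add: mult.commute)
      qed
    qed simp
  qed (auto simp: m'_def)
  have deriv1: "deriv (\<lambda>z. \<Sum>k. c k * mode k z) = (\<lambda>y. \<Sum>k. c k * m' k y)"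
    by (intro ext DERIV_imp_deriv d1)
  have "green_yy x y t = (\<Sum>k. c k * (- (real k ^ 2) * mode k y))"
    unfolding green_yy_def \<open>(\<lambda>z. green x z t) = _\<close> deriv1 by (rule DERIV_imp_deriv[OF d2])
  also have "\<dots> = (\<Sum>k. - (real k ^ 2 * exp (- (real k ^ 4 * t)) * mode k x) * mode k y)"
    by (intro suminf_cong) (simp add: c_def)
  finally show ?thesis .
qed

section \<open>The theta kernel\<close>

text \<open>A Riemann sum of 1/(1 + x^2) with mesh h, taken at right endpoints. That function
  decreases on the half line, so each term is at most the increment of arctan over its cell, and the
  sum telescopes to a bound that does not involve h.\<close>

lemma bump_sum_le:
  fixes h :: real
  assumes h: "h > 0"
  shows "(\<Sum>k<n. h / (1 + (h * Suc k)\<^sup>2)) \<le> pi / 2"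
proof -
  have step: "h / (1 + (h * Suc k)\<^sup>2) \<le> arctan (h * Suc k) - arctan (h * k)" for k :: nat
  proof -
    have lt: "h * k < h * Suc k" using h by simp
    obtain z where z: "h * k < z" "z < h * Suc k"
        "arctan (h * Suc k) - arctan (h * k) = (h * Suc k - h * k) * inverse (1 + z\<^sup>2)"
      using MVT2[OF lt, of arctan "\<lambda>z. inverse (1 + z\<^sup>2)"] DERIV_arctan by blast
    have "0 \<le> z" using z(1) h by (smt (verit) mult_nonneg_nonneg of_nat_0_le_iff)
    hence "z\<^sup>2 \<le> (h * Suc k)\<^sup>2" using z(2) by (intro power_mono) auto
    hence "inverse (1 + (h * Suc k)\<^sup>2) \<le> inverse (1 + z\<^sup>2)"
      by (intro le_imp_inverse_le) (auto intro: add_pos_nonneg)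
    hence "h * inverse (1 + (h * Suc k)\<^sup>2) \<le> h * inverse (1 + z\<^sup>2)"
      using h by (intro mult_left_mono) auto
    moreover have "h * Suc k - h * k = h" by (simp add: algebra_simps)
    ultimately show ?thesis using z(3) by (simp add: divide_inverse)
  qed
  have "(\<Sum>k<n. h / (1 + (h * Suc k)\<^sup>2)) \<le> (\<Sum>k<n. arctan (h * Suc k) - arctan (h * k))"
    by (intro sum_mono step)
  also have "\<dots> = arctan (h * n) - arctan (h * 0)"
    using sum_lessThan_telescope[of "\<lambda>k. arctan (h * real k)" n] by simp
  also have "\<dots> \<le> pi / 2" using arctan_ubound[of "h * n"] by simp
  finally show ?thesis .
qed

lemma bump_series:
  fixes h :: real
  assumes h: "h > 0"
  shows "summable (\<lambda>k. h / (1 + (h * Suc k)\<^sup>2))" "(\<Sum>k. h / (1 + (h * Suc k)\<^sup>2)) \<le> pi / 2"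
    "summable (\<lambda>k. h / (1 + (h * real k)\<^sup>2))" "(\<Sum>k. h / (1 + (h * real k)\<^sup>2)) \<le> h + pi / 2"
proof -
  show s: "summable (\<lambda>k. h / (1 + (h * Suc k)\<^sup>2))"
    by (rule summableI_nonneg_bounded[where x = "pi / 2"])
       (use bump_sum_le[OF h] h in \<open>auto intro!: divide_nonneg_pos add_pos_nonneg\<close>)
  show le: "(\<Sum>k. h / (1 + (h * Suc k)\<^sup>2)) \<le> pi / 2"
    by (rule suminf_le_const[OF s bump_sum_le[OF h]])
  have s': "summable (\<lambda>k. (\<lambda>k. h / (1 + (h * real k)\<^sup>2)) (Suc k))" using s by simp
  thus s'': "summable (\<lambda>k. h / (1 + (h * real k)\<^sup>2))" by (subst (asm) summable_Suc_iff)
  show "(\<Sum>k. h / (1 + (h * real k)\<^sup>2)) \<le> h + pi / 2"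
    using suminf_split_head[OF s''] le by simp
qed

text \<open>Two applications of the mean value theorem turn the second difference of g(x) =
  exp(-x^4) into h^2 g''(z) with z >= w. The decay 1/(1 + w^2) is kept because, along the grid w = h
  k, it makes the second differences summable with total of order h.\<close>

lemma second_difference_exp_power4:
  fixes w h :: real
  assumes "0 \<le> w" "h > 0"
  shows "\<bar>exp (- ((w + 2 * h) ^ 4)) - 2 * exp (- ((w + h) ^ 4)) + exp (- (w ^ 4))\<bar> \<le> 64 * h\<^sup>2 / (1 + w\<^sup>2)"
proof -
  define g where "g x = exp (- (x ^ 4))" for x :: real
  define g' where "g' x = - 4 * x ^ 3 * exp (- (x ^ 4))" for x :: real
  define g'' where "g'' x = (16 * x ^ 6 - 12 * x ^ 2) * exp (- (x ^ 4))" for x :: real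
  have g: "(g has_field_derivative g' x) (at x)" for x
    unfolding g_def [abs_def] g'_def by (auto intro!: derivative_eq_intros)
  have g': "(g' has_field_derivative g'' x) (at x)" for x
    unfolding g'_def [abs_def] g''_def
    by (auto intro!: derivative_eq_intros simp: algebra_simps power_numeral_reduce)
  have "w < w + h" using assms by simp
  then obtain y where y: "w < y" "y < w + h"
    "(g (w + h + h) - g (w + h)) - (g (w + h) - g w) = (w + h - w) * (g' (y + h) - g' y)"
    using MVT2[of w "w + h" "\<lambda>x. g (x + h) - g x" "\<lambda>x. g' (x + h) - g' x"]
    by (force intro: DERIV_diff g DERIV_shift[THEN iffD1])
  obtain z where z: "y < z" "z < y + h" "g' (y + h) - g' y = (y + h - y) * g'' z"
    using MVT2[of y "y + h" g' g''] g' assms by force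
  have wz: "w \<le> z" using y z by simp
  \<comment> \<open>All powers are absorbed by exp(z^4) >= 1 + z^4 + z^8/2, where z^2 and z^6 are
    first bounded by their neighbours among 1, z^4 and z^8. The constant 64 leaves room.\<close>
  have "\<bar>g'' z\<bar> * (1 + z\<^sup>2) \<le> 64"
  proof -
    have e: "1 + z ^ 4 + (z ^ 4)\<^sup>2 / 2 \<le> exp (z ^ 4)" by (rule exp_lower_Taylor_quadratic) simp
    have "2 * z\<^sup>2 \<le> 1 + z ^ 4" using zero_le_power2[of "z\<^sup>2 - 1"]
      by (simp add: power2_eq_square algebra_simps power_numeral_reduce)
    moreover have "2 * z ^ 6 \<le> z ^ 4 + z ^ 8" using zero_le_power2[of "z ^ 2 * (z\<^sup>2 - 1)"]
      by (simp add: power2_eq_square algebra_simps power_numeral_reduce)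
    moreover have "(16 * z ^ 6 + 12 * z\<^sup>2) * (1 + z\<^sup>2) = 16 * z ^ 6 + 16 * z ^ 8 + 12 * z\<^sup>2 + 12 * z ^ 4"
      by (simp add: algebra_simps flip: power_add)
    moreover have "0 \<le> z ^ 4" "(z ^ 4)\<^sup>2 = z ^ 8" "0 \<le> z ^ 8" by (simp_all flip: power_mult)
    ultimately have "(16 * z ^ 6 + 12 * z\<^sup>2) * (1 + z\<^sup>2) \<le> 64 * (1 + z ^ 4 + (z ^ 4)\<^sup>2 / 2)"
      by argo
    also have "\<dots> \<le> 64 * exp (z ^ 4)" using e by simp
    finally have "(16 * z ^ 6 + 12 * z\<^sup>2) * (1 + z\<^sup>2) * exp (- (z ^ 4)) \<le> 64"
      by (simp add: exp_minus field_simps)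
    moreover have "\<bar>g'' z\<bar> \<le> (16 * z ^ 6 + 12 * z\<^sup>2) * exp (- (z ^ 4))"
      unfolding g''_def abs_mult by (intro mult_mono) (auto simp: abs_le_iff)
    hence "\<bar>g'' z\<bar> * (1 + z\<^sup>2) \<le> (16 * z ^ 6 + 12 * z\<^sup>2) * exp (- (z ^ 4)) * (1 + z\<^sup>2)"
      by (intro mult_right_mono) auto
    ultimately show ?thesis by (simp add: mult_ac)
  qed
  hence "\<bar>g'' z\<bar> \<le> 64 / (1 + z\<^sup>2)" by (subst pos_le_divide_eq) (auto intro: add_pos_nonneg)
  also have "\<dots> \<le> 64 / (1 + w\<^sup>2)"
    using wz assms by (intro divide_left_mono) (auto intro!: power_mono add_pos_nonneg mult_pos_pos)
  finally have "h\<^sup>2 * \<bar>g'' z\<bar> \<le> h\<^sup>2 * (64 / (1 + w\<^sup>2))" by (intro mult_left_mono) auto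
  moreover have "g (w + 2 * h) - 2 * g (w + h) + g w = h\<^sup>2 * g'' z"
    using y(3) z(3) by (simp add: power2_eq_square add.assoc)
  ultimately show ?thesis by (simp add: g_def abs_mult mult_ac)
qed

text \<open>With w = |z|/2 the right side is 4 (sin w)^2, and sin w >= w - w^3/6 >= w/3 for 0 <= w
  <= 2. It converts a bound on (2 - 2 cos z) times the kernel into one on z^2 times the
  kernel.\<close>

lemma cos_quadratic_bound:
  fixes z :: real
  assumes "\<bar>z\<bar> \<le> pi"
  shows "z\<^sup>2 / 9 \<le> 2 - 2 * cos z"
proof -
  define w where "w = \<bar>z\<bar> / 2"
  have w: "0 \<le> w" "w \<le> 2" using assms pi_less_4 by (auto simp: w_def)
  obtain t where t: "sin w = (\<Sum>m<3. sin_coeff m * w ^ m) + (sin (t + 1/2 * real 3 * pi) / fact 3) * w ^ 3"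
    using Maclaurin_sin_expansion by blast
  have "- 1 * w ^ 3 \<le> sin (t + 1/2 * real 3 * pi) * w ^ 3"
    using w by (intro mult_right_mono) auto
  with t have "sin w \<ge> w - w ^ 3 / 6" by (simp add: eval_nat_numeral sin_coeff_def)
  moreover have "w * w\<^sup>2 \<le> w * 2\<^sup>2" using w by (intro mult_left_mono power_mono) auto
  ultimately have "w / 3 \<le> sin w" by (simp add: power_numeral_reduce)
  hence "(w / 3)\<^sup>2 \<le> (sin w)\<^sup>2" using w by (intro power_mono) auto
  moreover have "cos z = 1 - 2 * (sin w)\<^sup>2"
    using cos_double_sin[of w] by (simp add: w_def)
  ultimately show ?thesis by (simp add: w_def power_divide)
qed

text \<open>Up to the factor 1/(2 pi), the kernel of the same equation on the circle of length 2 pi: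
  the sum over all integers k of exp(-k^4 t) cos(k z), with k and -k combined.\<close>

definition theta :: "real \<Rightarrow> real \<Rightarrow> real" where
  "theta t z = 1 + 2 * (\<Sum>k. exp (- (real (Suc k) ^ 4 * t)) * cos (real (Suc k) * z))"

lemma summable_cos_series:
  fixes c g :: "nat \<Rightarrow> real"
  assumes "summable (\<lambda>k. \<bar>c k\<bar>)"
  shows "summable (\<lambda>k. \<bar>c k * cos (g k)\<bar>)" "summable (\<lambda>k. c k * cos (g k))"
    "\<bar>\<Sum>k. c k * cos (g k)\<bar> \<le> (\<Sum>k. \<bar>c k\<bar>)"
proof -
  have *: "\<bar>c k * cos (g k)\<bar> \<le> \<bar>c k\<bar>" for k
    using mult_left_mono[OF abs_cos_le_one[of "g k"], of "\<bar>c k\<bar>"] by (simp add: abs_mult)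
  show s: "summable (\<lambda>k. \<bar>c k * cos (g k)\<bar>)"
    by (rule summable_comparison_test'[OF assms, of 0]) (use * in auto)
  thus "summable (\<lambda>k. c k * cos (g k))" by (rule summable_rabs_cancel)
  show "\<bar>\<Sum>k. c k * cos (g k)\<bar> \<le> (\<Sum>k. \<bar>c k\<bar>)"
    using summable_rabs[OF s] suminf_le[OF * s assms] by linarith
qed

text \<open>The first bound is used for \<open>\<bar>z\<bar> \<le> h\<close> and the second, obtained from two summations by parts,
  away from the origin.\<close>

lemma theta_bound:
  fixes R :: real
  assumes R: "R > 0"
  obtains C where "C \<ge> 0"
    "\<And>h z. 0 < h \<Longrightarrow> h \<le> R \<Longrightarrow> \<bar>z\<bar> \<le> pi \<Longrightarrow> \<bar>theta (h ^ 4) z\<bar> \<le> C * (h / (h\<^sup>2 + z\<^sup>2))"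
proof -
  \<comment> \<open>\<open>C2\<close> collects the boundary term 2 (1 - l 1) <= 2 R^3 h and twice
    the bound 64 h (R + pi/2) on the sum of second differences. In \<open>C\<close>, the part R + 2
    pi belongs to the bound near the origin, and 9 comes from
    \<open>cos_quadratic_bound\<close>.\<close>
  define C2 where "C2 = 2 * R ^ 3 + 128 * (R + pi / 2)"
  define C where "C = (R + 2 * pi) + 9 * C2"
  have C2: "C2 \<ge> 0" using R by (simp add: C2_def)
  have C: "C \<ge> 0" using R C2 by (simp add: C_def)
  show ?thesis
  proof (rule that[OF C])
    fix h z :: real
    assume h: "0 < h" "h \<le> R" and z: "\<bar>z\<bar> \<le> pi"
    \<comment> \<open>In the variable h = t^(1/4) the coefficients exp(-k^4 t) are samples of
      exp(-x^4) on a grid of mesh h, so h times a sum over k behaves like a Riemann sum.\<close>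
    define l where "l k = exp (- ((h * real k) ^ 4))" for k :: nat
    have l_pos: "l k > 0" for k by (simp add: l_def)
    have th: "theta (h ^ 4) z = 1 + 2 * (\<Sum>k. l (Suc k) * cos (real (Suc k) * z))"
      by (simp add: theta_def l_def power_mult_distrib mult.commute)
    have l_le: "h * l k \<le> 2 * (h / (1 + (h * real k)\<^sup>2))" for k
    proof -
      define w where "w = h * real k"
      have "2 * w\<^sup>2 \<le> 1 + w ^ 4" using zero_le_power2[of "w\<^sup>2 - 1"]
        by (simp add: power2_eq_square algebra_simps power_numeral_reduce)
      moreover have "0 \<le> w ^ 4" by simp
      ultimately have "1 + w\<^sup>2 \<le> 2 * (1 + w ^ 4)" by argo
      also have "\<dots> \<le> 2 * exp (w ^ 4)" using exp_ge_add_one_self[of "w ^ 4"] by argo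
      finally have "inverse (exp (w ^ 4)) \<le> inverse ((1 + w\<^sup>2) / 2)"
        by (intro le_imp_inverse_le) (auto intro: add_pos_nonneg)
      hence "exp (- (w ^ 4)) \<le> 2 / (1 + w\<^sup>2)" by (simp add: exp_minus)
      from mult_left_mono[OF this, of h] h show ?thesis by (simp add: l_def w_def mult.commute)
    qed
    note bs = bump_series[OF h(1)]
    have sl1: "summable (\<lambda>k. \<bar>l (Suc k)\<bar>)"
    proof (rule summable_comparison_test'[OF summable_mult[OF bs(1), of "2 / h"], of 0])
      show "norm \<bar>l (Suc k)\<bar> \<le> 2 / h * (h / (1 + (h * Suc k)\<^sup>2))" for k
        using divide_right_mono[OF l_le[of "Suc k"], of h] h l_pos[of "Suc k"] by simp
    qed
    hence sl0: "summable (\<lambda>k. \<bar>l k\<bar>)" by (subst (asm) summable_Suc_iff)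
    have sl2: "summable (\<lambda>k. \<bar>l (Suc (Suc k))\<bar>)" using sl1
      by (subst summable_Suc_iff[of "\<lambda>k. \<bar>l (Suc k)\<bar>"])
    define A where "A = (\<Sum>k. l (Suc k) * cos (real (Suc k) * z))"
    \<comment> \<open>The bound without cancellation: exp(-w^4) <= 2/(1 + w^2), so h |A| is at most
      twice a Riemann sum bounded by pi/2.\<close>
    have "h * \<bar>A\<bar> \<le> h * (\<Sum>k. \<bar>l (Suc k)\<bar>)"
      unfolding A_def using h by (intro mult_left_mono summable_cos_series sl1) auto
    also have "\<dots> = (\<Sum>k. h * l (Suc k))" using l_pos sl1 by (subst suminf_mult) (auto simp: less_imp_le)
    also have "\<dots> \<le> (\<Sum>k. 2 * (h / (1 + (h * Suc k)\<^sup>2)))"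
      using sl1 l_pos by (intro suminf_le l_le summable_mult bs) (auto simp: less_imp_le)
    also have "\<dots> \<le> pi" using bs(2) by (subst suminf_mult[OF bs(1)]) simp
    finally have A: "h * \<bar>A\<bar> \<le> pi" .
    have "\<bar>theta (h ^ 4) z\<bar> \<le> 1 + 2 * \<bar>A\<bar>" unfolding th A_def[symmetric] by linarith
    hence "h * \<bar>theta (h ^ 4) z\<bar> \<le> h * (1 + 2 * \<bar>A\<bar>)" using h by (intro mult_left_mono) auto
    also have "\<dots> \<le> R + 2 * pi" using A h by (simp add: algebra_simps)
    finally have 1: "h * \<bar>theta (h ^ 4) z\<bar> \<le> R + 2 * pi" .

    define A' where "A' = (\<Sum>k. l (Suc k) * cos (real (Suc (Suc k)) * z))"
    define B where "B = (\<Sum>k. l (Suc (Suc k)) * cos (real (Suc k) * z))"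
    \<comment> \<open>The second difference of the coefficients centred at k + 1. \<open>A'\<close>
      has the cosine index raised by one, \<open>B\<close> the coefficient index.\<close>
    define c where "c k = l (Suc (Suc k)) - 2 * l (Suc k) + l k" for k
    have c_le: "\<bar>c k\<bar> \<le> 64 * h * (h / (1 + (h * real k)\<^sup>2))" for k
      using second_difference_exp_power4[of "h * real k" h] h
      by (simp add: c_def l_def algebra_simps power2_eq_square)
    have sc: "summable (\<lambda>k. \<bar>c k\<bar>)"
      by (rule summable_comparison_test'[OF summable_mult[OF bs(3), of "64 * h"], of 0]) (use c_le in auto)
    note S = summable_cos_series(2)
    have e1: "(\<Sum>k. l k * cos (real (Suc k) * z)) = cos z + A'"
      using suminf_split_head[OF S[OF sl0, of "\<lambda>k. real (Suc k) * z"]] by (simp add: A'_def l_def)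
    have e2: "(\<Sum>k. l (Suc k) * cos (real k * z)) = l 1 + B"
      using suminf_split_head[OF S[OF sl1, of "\<lambda>k. real k * z"]] by (simp add: B_def)
    have cA: "(\<Sum>k. c k * cos (real (Suc k) * z)) = B - 2 * A + (cos z + A')"
    proof -
      have "(\<lambda>k. l (Suc (Suc k)) * cos (real (Suc k) * z) - 2 * (l (Suc k) * cos (real (Suc k) * z))
              + l k * cos (real (Suc k) * z)) sums (B - 2 * A + (cos z + A'))"
        unfolding A_def B_def e1[symmetric]
        by (intro sums_add sums_diff sums_mult summable_sums S sl0 sl1 sl2)
      thus ?thesis by (simp add: c_def sums_iff algebra_simps)
    qed
    have "2 * cos z * A = A' + (l 1 + B)"
    proof -
      have "2 * cos z * A = (\<Sum>k. l (Suc k) * cos (real (Suc (Suc k)) * z) + l (Suc k) * cos (real k * z))"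
        unfolding A_def
      proof (subst suminf_mult[symmetric, OF S[OF sl1]], rule suminf_cong)
        fix k
        have "cos z * cos (real (Suc k) * z) = (cos (real k * z) + cos (real (Suc (Suc k)) * z)) / 2"
          by (subst mult.commute, subst cos_times_cos) (simp add: algebra_simps)
        thus "2 * cos z * (l (Suc k) * cos (real (Suc k) * z))
            = l (Suc k) * cos (real (Suc (Suc k)) * z) + l (Suc k) * cos (real k * z)"
          by (simp add: algebra_simps)
      qed
      also have "\<dots> = A' + (\<Sum>k. l (Suc k) * cos (real k * z))"
        unfolding A'_def by (intro suminf_add[symmetric] S sl1)
      finally show ?thesis by (simp add: e2)
    qed
    \<comment> \<open>Multiplication by 2 - 2 cos z is minus a second difference in the frequency
      index, moved here onto the coefficients. The boundary term 2 (1 - l 1) remains, as l 0 =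
      1.\<close>
    hence eq: "(2 - 2 * cos z) * theta (h ^ 4) z = 2 * (1 - l 1) - 2 * (\<Sum>k. c k * cos (real (Suc k) * z))"
    proof -
      have "(2 - 2 * cos z) * (1 + 2 * A) = 2 - 2 * cos z + 4 * A - 2 * (2 * cos z * A)"
        by (simp add: algebra_simps)
      thus ?thesis unfolding cA th A_def[symmetric] \<open>2 * cos z * A = _\<close> by simp
    qed
    have "\<bar>\<Sum>k. c k * cos (real (Suc k) * z)\<bar> \<le> (\<Sum>k. \<bar>c k\<bar>)"
      by (rule summable_cos_series(3)[OF sc])
    also have "\<dots> \<le> (\<Sum>k. 64 * h * (h / (1 + (h * real k)\<^sup>2)))"
      by (intro suminf_le c_le sc summable_mult bs)
    also have "\<dots> = 64 * h * (\<Sum>k. h / (1 + (h * real k)\<^sup>2))" by (rule suminf_mult[OF bs(3)])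
    also have "\<dots> \<le> 64 * h * (R + pi / 2)" using bs(4) h by (intro mult_left_mono) auto
    finally have c_sum: "\<bar>\<Sum>k. c k * cos (real (Suc k) * z)\<bar> \<le> 64 * h * (R + pi / 2)" .
    \<comment> \<open>The boundary term is even of order h^4; h <= R reduces it to the order h of
      the claim.\<close>
    have "1 - l 1 \<le> h ^ 4" using exp_ge_add_one_self[of "- (h ^ 4)"] by (simp add: l_def)
    also have "\<dots> = h ^ 3 * h" by (simp add: power_numeral_reduce)
    also have "\<dots> \<le> R ^ 3 * h" using h by (intro mult_right_mono power_mono) auto
    finally have l1: "1 - l 1 \<le> R ^ 3 * h" .
    have l1': "0 \<le> 1 - l 1" by (simp add: l_def)
    have "\<bar>(2 - 2 * cos z) * theta (h ^ 4) z\<bar> \<le> C2 * h"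
    proof -
      have *: "\<bar>2 * X - 2 * Y\<bar> \<le> 2 * P + 2 * Q" if "X \<le> P" "0 \<le> X" "\<bar>Y\<bar> \<le> Q" for X Y P Q :: real
        using that by linarith
      have "C2 * h = 2 * (R ^ 3 * h) + 2 * (64 * h * (R + pi / 2))"
        by (simp add: C2_def algebra_simps)
      thus ?thesis unfolding eq using *[OF l1 l1' c_sum] by simp
    qed
    hence this_le: "(2 - 2 * cos z) * \<bar>theta (h ^ 4) z\<bar> \<le> C2 * h"
    proof -
      have "0 \<le> 2 - 2 * cos z" by simp
      from abs_of_nonneg[OF this] \<open>\<bar>_ * theta _ _\<bar> \<le> _\<close> show ?thesis by (simp only: abs_mult)
    qed
    have "z\<^sup>2 / 9 * \<bar>theta (h ^ 4) z\<bar> \<le> (2 - 2 * cos z) * \<bar>theta (h ^ 4) z\<bar>"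
      by (intro mult_right_mono cos_quadratic_bound z) auto
    also note this_le
    finally have 2: "z\<^sup>2 * \<bar>theta (h ^ 4) z\<bar> \<le> 9 * C2 * h" by simp
    \<comment> \<open>Multiplying the first bound by h and adding the second produces the weight h^2
      + z^2.\<close>
    have "h * (h * \<bar>theta (h ^ 4) z\<bar>) \<le> h * (R + 2 * pi)" using 1 h by (intro mult_left_mono) auto
    with 2 have "(h\<^sup>2 + z\<^sup>2) * \<bar>theta (h ^ 4) z\<bar> \<le> C * h"
      by (simp add: C_def algebra_simps power2_eq_square)
    thus "\<bar>theta (h ^ 4) z\<bar> \<le> C * (h / (h\<^sup>2 + z\<^sup>2))"
      using h by (simp add: pos_le_divide_eq add_pos_nonneg mult.commute)
  qed
qed

section \<open>The initial term\<close>

text \<open>An antiderivative is s arctan((s y + c)/h), whose values range over an interval of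
  length pi, whatever h and c are. The sign s lets one statement serve both x - y and x + y.\<close>

lemma integral_bump_le:
  fixes h c s :: real
  assumes h: "h > 0" and s: "s = 1 \<or> s = -1"
  shows "set_integrable lborel D (\<lambda>y. h / (h\<^sup>2 + (s * y + c)\<^sup>2))"
    and "(LINT y:D|lborel. h / (h\<^sup>2 + (s * y + c)\<^sup>2)) \<le> pi"
proof -
  have pos: "h\<^sup>2 + (s * y + c)\<^sup>2 > 0" for y using h by (simp add: add_pos_nonneg)
  have cont: "continuous_on A (\<lambda>y. h / (h\<^sup>2 + (s * y + c)\<^sup>2))" for A
    by (intro continuous_intros ballI less_imp_neq[THEN not_sym] pos)
  thus "set_integrable lborel D (\<lambda>y. h / (h\<^sup>2 + (s * y + c)\<^sup>2))"
    by (rule borel_integrable_atLeastAtMost')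
  define F where "F y = s * arctan ((s * y + c) / h)" for y
  have "(F has_real_derivative h / (h\<^sup>2 + (s * y + c)\<^sup>2)) (at y)" for y
  proof -
    have "inverse (1 + ((s * y + c) / h)\<^sup>2) = h\<^sup>2 / (h\<^sup>2 + (s * y + c)\<^sup>2)"
      using h pos[of y] less_imp_neq[OF h] by (auto simp: power_divide add_divide_eq_iff inverse_eq_divide)
    moreover have "s * s = 1" using s by auto
    moreover have "(F has_real_derivative s * (inverse (1 + ((s * y + c) / h)\<^sup>2) * (s / h))) (at y)"
      unfolding F_def [abs_def] using h by (auto intro!: derivative_eq_intros)
    ultimately show ?thesis using h by (simp add: power2_eq_square mult_ac)
  qed
  hence "(F has_vector_derivative h / (h\<^sup>2 + (s * y + c)\<^sup>2)) (at y within D)" for y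
    by (simp add: has_real_derivative_iff_has_vector_derivative has_vector_derivative_at_within)
  from integral_FTC_Icc[OF _ this cont]
  have "(LINT y:D|lborel. h / (h\<^sup>2 + (s * y + c)\<^sup>2)) = F pi - F 0"
    by (simp add: set_lebesgue_integral_def)
  also have "\<dots> \<le> pi"
    using s arctan_bounded[of "(s * pi + c) / h"] arctan_bounded[of "(s * 0 + c) / h"]
    by (auto simp: F_def)
  finally show "(LINT y:D|lborel. h / (h\<^sup>2 + (s * y + c)\<^sup>2)) \<le> pi" .
qed

lemma theta_minus_2pi: "theta t (z - 2 * pi) = theta t z"
proof -
  have "cos (real (Suc k) * (z - 2 * pi)) = cos (real (Suc k) * z)" for k
  proof -
    have "real (Suc k) * (z - 2 * pi) = real (Suc k) * z - 2 * real (Suc k) * pi"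
      by (simp only: right_diff_distrib mult_ac)
    thus ?thesis by (simp only: cos_diff cos_2npi sin_2npi mult_1_right mult_zero_right add_0_right)
  qed
  thus ?thesis by (simp only: theta_def)
qed

text \<open>Method of images: by the product formula for cosines, the Neumann kernel on [0, pi] is
  the periodic kernel at x - y plus the one at the reflected argument x + y. The constant modes
  match because 1/pi = (1 + 1)/(2 pi).\<close>

lemma green_eq_theta:
  assumes t: "t > 0"
  shows "green x y t = (theta t (x - y) + theta t (x + y)) / (2 * pi)"
proof -
  define l where "l k = exp (- (real k ^ 4 * t))" for k
  have l: "summable (\<lambda>k. \<bar>l k\<bar>)" using summable_power_exp[OF t, of 0] by (simp add: l_def)
  hence l': "summable (\<lambda>k. \<bar>l (Suc k)\<bar>)" by (subst summable_Suc_iff)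
  note s = summable_cos_series(2)[OF l']
  have "(\<Sum>k. l (Suc k) * cos (real (Suc k) * (x - y))) + (\<Sum>k. l (Suc k) * cos (real (Suc k) * (x + y)))
      = (\<Sum>k. l (Suc k) * cos (real (Suc k) * (x - y)) + l (Suc k) * cos (real (Suc k) * (x + y)))"
    by (intro suminf_add s)
  also have "\<dots> = (\<Sum>k. pi * (l (Suc k) * mode (Suc k) x * mode (Suc k) y))"
  proof (rule suminf_cong)
    fix k
    have "mode (Suc k) x * mode (Suc k) y = 2 / pi * (cos (real (Suc k) * x) * cos (real (Suc k) * y))"
      by (simp add: mode_def mult_ac real_sqrt_divide)
    hence eq: "mode (Suc k) x * mode (Suc k) y = (cos (real (Suc k) * x - real (Suc k) * y) + cos (real (Suc k) * x + real (Suc k) * y)) / pi"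
      by (simp only: cos_times_cos) (simp add: add_divide_distrib)
    show "l (Suc k) * cos (real (Suc k) * (x - y)) + l (Suc k) * cos (real (Suc k) * (x + y))
        = pi * (l (Suc k) * mode (Suc k) x * mode (Suc k) y)"
      unfolding mult.assoc eq right_diff_distrib distrib_left by (simp add: distrib_left add_divide_distrib)
  qed
  also have "\<dots> = pi * (\<Sum>k. l (Suc k) * mode (Suc k) x * mode (Suc k) y)"
    using summable_mode(2)[OF summable_mode(1)[OF l], of x y]
    by (intro suminf_mult) (subst summable_Suc_iff)
  finally have "theta t (x - y) + theta t (x + y) = 2 + 2 * pi * (\<Sum>k. l (Suc k) * mode (Suc k) x * mode (Suc k) y)"
    by (simp add: theta_def l_def)
  moreover have "green x y t = 1 / pi + (\<Sum>k. l (Suc k) * mode (Suc k) x * mode (Suc k) y)"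
    using suminf_split_head[OF summable_mode(2)[OF summable_mode(1)[OF l], of x y]]
    by (simp add: green_def l_def mode_def)
  ultimately show ?thesis by (simp add: add_divide_distrib)
qed

lemma continuous_on_green:
  assumes "t > 0"
  shows "continuous_on A (\<lambda>y. green x y t)"
  unfolding green_def using summable_green[OF assms, of x] by (intro continuous_on_mode_series)

text \<open>The kernel changes sign, so conservation of mass does not control its L1 norm. The bound
  on \<open>theta\<close> dominates it by three bumps of mass at most pi each, one for x - y and two
  for x + y, hence 3 C/2 after division by 2 pi. The constant is uniform in t <= T since h = t^(1/4)
  stays below the fourth root of T.\<close>

lemma green_L1_bound:
  assumes T: "T > 0"
  obtains C where "C \<ge> 0" "\<And>x t. x \<in> D \<Longrightarrow> 0 < t \<Longrightarrow> t \<le> T \<Longrightarrow> (LINT y:D|lborel. \<bar>green x y t\<bar>) \<le> C"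
proof -
  define R where "R = root 4 T"
  have R: "R > 0" using T by (simp add: R_def)
  obtain C where C: "C \<ge> 0"
    "\<And>h z. 0 < h \<Longrightarrow> h \<le> R \<Longrightarrow> \<bar>z\<bar> \<le> pi \<Longrightarrow> \<bar>theta (h ^ 4) z\<bar> \<le> C * (h / (h\<^sup>2 + z\<^sup>2))"
    by (rule theta_bound[OF R]) blast
  show ?thesis
  proof (rule that[of "3 * C / 2"])
    show "3 * C / 2 \<ge> 0" using C by simp
    fix x t :: real assume x: "x \<in> D" and t: "0 < t" "t \<le> T"
    define h where "h = root 4 t"
    have h: "h > 0" "h \<le> R" "h ^ 4 = t" using t by (simp_all add: h_def R_def)
    define b where "b s c y = h / (h\<^sup>2 + (s * y + c)\<^sup>2)" for s c y :: real
    have b: "b s c y \<ge> 0" for s c y using h by (simp add: b_def)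
    have le: "\<bar>green x y t\<bar> \<le> C / (2 * pi) * (b (-1) x y + b 1 x y + b 1 (x - 2 * pi) y)" if y: "y \<in> D" for y
    proof -
      have 1: "\<bar>theta t (x - y)\<bar> \<le> C * b (-1) x y"
        using C(2)[OF h(1,2), of "x - y"] x y by (simp add: h b_def abs_le_iff)
      have 2: "\<bar>theta t (x + y)\<bar> \<le> C * b 1 x y + C * b 1 (x - 2 * pi) y"
      proof (cases "x + y \<le> pi")
        case True
        hence "\<bar>theta t (x + y)\<bar> \<le> C * b 1 x y"
          using C(2)[OF h(1,2), of "x + y"] x y by (simp add: h b_def add.commute)
        thus ?thesis using mult_nonneg_nonneg[OF C(1) b[of 1 "x - 2 * pi" y]] by linarith
      next
        case False
        hence "\<bar>theta t (x + y)\<bar> \<le> C * b 1 (x - 2 * pi) y"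
          using C(2)[OF h(1,2), of "x + y - 2 * pi"] x y
          unfolding theta_minus_2pi by (simp add: h b_def algebra_simps)
        thus ?thesis using mult_nonneg_nonneg[OF C(1) b[of 1 x y]] by linarith
      qed
      have "\<bar>green x y t\<bar> = \<bar>theta t (x - y) + theta t (x + y)\<bar> / (2 * pi)"
        by (simp add: green_eq_theta[OF t(1)])
      also have "\<dots> \<le> (C * (b (-1) x y + b 1 x y + b 1 (x - 2 * pi) y)) / (2 * pi)"
        using 1 2 by (intro divide_right_mono) (auto simp: distrib_left)
      finally show ?thesis by simp
    qed
    have int: "set_integrable lborel D (b (-1) x)" "set_integrable lborel D (b 1 x)"
        "set_integrable lborel D (b 1 (x - 2 * pi))"
      unfolding b_def using integral_bump_le(1)[OF h(1)] by blast+
    have "(LINT y:D|lborel. \<bar>green x y t\<bar>)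
        \<le> (LINT y:D|lborel. C / (2 * pi) * (b (-1) x y + b 1 x y + b 1 (x - 2 * pi) y))"
      by (intro set_integral_mono borel_integrable_atLeastAtMost' continuous_on_rabs continuous_on_green t
          set_integrable_mult_right set_integral_add int le)
    also have "\<dots> = C / (2 * pi) * ((LINT y:D|lborel. b (-1) x y) + (LINT y:D|lborel. b 1 x y)
        + (LINT y:D|lborel. b 1 (x - 2 * pi) y))"
      by (simp add: set_integral_add int)
    also have "\<dots> \<le> C / (2 * pi) * (pi + pi + pi)"
      using C unfolding b_def by (intro mult_left_mono add_mono integral_bump_le h) auto
    finally show "(LINT y:D|lborel. \<bar>green x y t\<bar>) \<le> 3 * C / 2" by simp
  qed
qed

section \<open>Modes and cosine polynomials as initial data\<close>

lemma integral_cos_multiple: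
  fixes a :: int
  shows "(LINT y:D|lborel. cos (a * (y::real))) = (if a = 0 then pi else 0)"
proof (cases "a = 0")
  case False
  have "((\<lambda>y. sin (a * y) / a) has_real_derivative cos (a * y)) (at y)" for y :: real
    using False by (auto intro!: derivative_eq_intros)
  hence "((\<lambda>y. sin (a * y) / a) has_vector_derivative cos (a * y)) (at y within D)" for y :: real
    by (simp add: has_real_derivative_iff_has_vector_derivative has_vector_derivative_at_within)
  from integral_FTC_Icc[OF _ this] have "(LINT y:D|lborel. cos (a * y)) = sin (a * pi) / a - sin (a * 0) / a"
    by (simp add: set_lebesgue_integral_def continuous_intros)
  thus ?thesis using False by (simp add: mult.commute)
qed (simp add: set_lebesgue_integral_def)

text \<open>The product formula leaves two cosine integrals. For k = l = 0 both contribute pi, for k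
  = l > 0 only one does, which explains the two normalising factors.\<close>

lemma mode_orthonormal:
  "(LINT y:D|lborel. mode k y * mode l y) = (if k = l then 1 else 0)"
proof -
  define a where "a k = (if k = 0 then 1 / sqrt pi else sqrt (2 / pi))" for k :: nat
  have m: "mode k y = a k * cos (real k * y)" for k y by (simp add: mode_def a_def)
  have c: "set_integrable lborel D (\<lambda>y. cos (i * y))" for i :: int
    by (intro borel_integrable_atLeastAtMost' continuous_intros)
  have "(LINT y:D|lborel. mode k y * mode l y)
      = (LINT y:D|lborel. a k * a l / 2 * (cos (of_int (int k - int l) * y) + cos (of_int (int k + int l) * y)))"
  proof -
    have "mode k y * mode l y = a k * a l / 2 * (cos (of_int (int k - int l) * y) + cos (of_int (int k + int l) * y))" for y
    proof -
      have "cos (real k * y) * cos (real l * y) = (cos (of_int (int k - int l) * y) + cos (of_int (int k + int l) * y)) / 2"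
        by (simp add: cos_times_cos left_diff_distrib distrib_right)
      thus ?thesis by (simp add: m mult_ac)
    qed
    thus ?thesis by (simp only:)
  qed
  also have "\<dots> = a k * a l / 2 * ((LINT y:D|lborel. cos (of_int (int k - int l) * y)) + (LINT y:D|lborel. cos (of_int (int k + int l) * y)))"
    by (simp only: set_integral_mult_right set_integral_add c)
  also have "\<dots> = (if k = l then 1 else 0)"
    unfolding integral_cos_multiple by (auto simp: a_def)
  finally show ?thesis .
qed

lemma initial_term_eq:
  assumes t: "t > 0" and q: "set_integrable lborel D q"
  shows "initial_term q x t = (\<Sum>k. exp (- (real k ^ 4 * t)) * mode k x * (LINT y:D|lborel. mode k y * q y))"
  using t mode_series_integral(1)[OF summable_green[OF t, of x] q] by (simp add: initial_term_def green_def)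

lemma initial_term_mode:
  assumes "t \<ge> 0"
  shows "initial_term (mode k) x t = exp (- (real k ^ 4 * t)) * mode k x"
proof (cases "t = 0")
  case False
  hence t: "t > 0" using assms by simp
  have "set_integrable lborel D (mode k)"
    by (intro borel_integrable_atLeastAtMost' continuous_on_mode continuous_intros)
  from initial_term_eq[OF t this, of x]
  have "initial_term (mode k) x t = (\<Sum>j. if j = k then exp (- (real k ^ 4 * t)) * mode k x else 0)"
    by (simp add: mode_orthonormal if_distrib cong: if_cong)
  also have "\<dots> = exp (- (real k ^ 4 * t)) * mode k x"
    by (rule sums_unique[OF sums_single, symmetric])
  finally show ?thesis .
qed (simp add: initial_term_def)

lemma initial_term_linear:
  assumes "continuous_on D q" "continuous_on D r" "t \<ge> 0"
  shows "initial_term (\<lambda>y. a * q y + b * r y) x t = a * initial_term q x t + b * initial_term r x t"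
proof (cases "t = 0")
  case False
  hence t: "t > 0" using assms by simp
  have int: "set_integrable lborel D (\<lambda>y. green x y t * q y)" if "continuous_on D q" for q
    by (intro borel_integrable_atLeastAtMost' continuous_on_mult continuous_on_green t that)
  have "(LINT y:D|lborel. green x y t * (a * q y + b * r y))
      = (LINT y:D|lborel. a * (green x y t * q y) + b * (green x y t * r y))"
    by (simp add: algebra_simps)
  also have "\<dots> = a * (LINT y:D|lborel. green x y t * q y) + b * (LINT y:D|lborel. green x y t * r y)"
    using int assms by (subst set_integral_add) auto
  finally show ?thesis using t by (simp add: initial_term_def)
qed (simp add: initial_term_def)

definition initial_continuous :: "real \<Rightarrow> (real \<Rightarrow> real) \<Rightarrow> bool" where
  "initial_continuous T q \<longleftrightarrow> continuous_on (D \<times> {0..T}) (\<lambda>(x, t). initial_term q x t)"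

lemma initial_continuous_linear:
  assumes "continuous_on D q" "continuous_on D r" "initial_continuous T q" "initial_continuous T r"
  shows "initial_continuous T (\<lambda>y. a * q y + b * r y)"
proof -
  have "continuous_on (D \<times> {0..T}) (\<lambda>z. a * (case z of (x, t) \<Rightarrow> initial_term q x t) + b * (case z of (x, t) \<Rightarrow> initial_term r x t))"
    using assms unfolding initial_continuous_def by (intro continuous_intros)
  thus ?thesis unfolding initial_continuous_def
    by (rule continuous_on_eq) (auto simp: initial_term_linear[OF assms(1,2)])
qed

text \<open>The extra factor cos(k y) makes the induction close: the product formula trades one
  power of cos y for the frequencies k + 1 and |k - 1|. When the powers are used up, single modes
  remain, and their evolution is explicit.\<close>

lemma initial_continuous_cos_power: "initial_continuous T (\<lambda>y. cos y ^ i * cos (real k * y))"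
proof (induction i arbitrary: k)
  case 0
  have m: "initial_continuous T (mode k)"
  proof -
    have "continuous_on (D \<times> {0..T}) (\<lambda>z. exp (- (real k ^ 4 * snd z)) * mode k (fst z))"
      by (intro continuous_intros)
    thus ?thesis unfolding initial_continuous_def
      by (rule continuous_on_eq) (auto simp: initial_term_mode)
  qed
  \<comment> \<open>The second summand with coefficient 0 fits a single mode to the two-term form of
    \<open>initial_continuous_linear\<close>.\<close>
  obtain c where "cos (real k * y) = c * mode k y + 0 * mode k y" for y
  proof
    show "cos (real k * y) = (if k = 0 then sqrt pi else 1 / sqrt (2 / pi)) * mode k y + 0 * mode k y" for y
      by (simp add: mode_def)
  qed
  hence "(\<lambda>y. cos y ^ 0 * cos (real k * y)) = (\<lambda>y. c * mode k y + 0 * mode k y)" by (simp only: power_0 mult_1)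
  thus ?case using initial_continuous_linear[OF _ _ m m, of c 0] by (simp only: continuous_intros continuous_on_mode[OF continuous_on_id])
next
  case (Suc i)
  \<comment> \<open>This is |k - 1|; for k = 0 both frequencies of the product formula are 1, as
    cosine is even.\<close>
  define j where "j = (if k = 0 then 1 else k - 1)"
  have "cos y ^ Suc i * cos (real k * y)
      = 1/2 * (cos y ^ i * cos (real (Suc k) * y)) + 1/2 * (cos y ^ i * cos (real j * y))" for y
  proof -
    have "cos y * cos (real k * y) = (cos (real (Suc k) * y) + cos (real j * y)) / 2"
      by (subst mult.commute, subst cos_times_cos) (auto simp: algebra_simps of_nat_diff j_def)
    hence "cos y ^ i * (cos y * cos (real k * y)) = cos y ^ i * ((cos (real (Suc k) * y) + cos (real j * y)) / 2)"
      by (simp only:)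
    thus ?thesis by (simp add: distrib_left mult_ac)
  qed
  moreover have "continuous_on D (\<lambda>y. cos y ^ i * cos (real k * y))" for k by (intro continuous_intros)
  ultimately show ?case using initial_continuous_linear[OF _ _ Suc.IH Suc.IH, of "Suc k" j]
    by (simp only:)
qed

lemma initial_continuous_cos_polynomial: "initial_continuous T (\<lambda>y. \<Sum>i\<le>n. a i * cos y ^ i)"
proof (induction n)
  case 0
  have "initial_continuous T (\<lambda>y. a 0 * (cos y ^ 0 * cos (real 0 * y)) + 0 * (cos y ^ 0 * cos (real 0 * y)))"
    by (intro initial_continuous_linear initial_continuous_cos_power continuous_intros)
  thus ?case by simp
next
  case (Suc n)
  have "initial_continuous T (\<lambda>y. 1 * (\<Sum>i\<le>n. a i * cos y ^ i) + a (Suc n) * (cos y ^ Suc n * cos (real 0 * y)))"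
    by (intro initial_continuous_linear initial_continuous_cos_power Suc continuous_intros)
  thus ?case by simp
qed

text \<open>The substitution c = cos y makes u0 a continuous function on [-1, 1]; Weierstrass
  approximation there yields cosine polynomials close to u0 on all of D. The uniform L1 bound
  carries the approximation over to the evolved functions.\<close>

theorem continuous_on_initial_term:
  assumes T: "T > 0" and u0: "continuous_on D u0"
  shows "continuous_on (D \<times> {0..T}) (\<lambda>(x, t). initial_term u0 x t)"
proof -
  obtain C where C: "C \<ge> 0" "\<And>x t. x \<in> D \<Longrightarrow> 0 < t \<Longrightarrow> t \<le> T \<Longrightarrow> (LINT y:D|lborel. \<bar>green x y t\<bar>) \<le> C"
    by (rule green_L1_bound[OF T]) blast
  have cont: "continuous_on {-1..1} (\<lambda>c. u0 (arccos c))"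
    by (rule continuous_on_compose2[OF u0 continuous_on_arccos']) (auto simp: arccos_lbound arccos_ubound)
  have "\<exists>q. continuous_on D q \<and> initial_continuous T q \<and> (\<forall>y\<in>D. \<bar>u0 y - q y\<bar> < 1 / real (Suc n))" for n
  proof -
    obtain g where g: "real_polynomial_function g" "\<And>c. c \<in> {-1..1} \<Longrightarrow> \<bar>u0 (arccos c) - g c\<bar> < 1 / real (Suc n)"
      using Stone_Weierstrass_real_polynomial_function[OF compact_Icc cont, of "1 / real (Suc n)"] by auto
    then obtain a m where am: "g = (\<lambda>x. \<Sum>i\<le>m. a i * x ^ i)" by (auto simp: real_polynomial_function_iff_sum)
    have "\<bar>u0 y - g (cos y)\<bar> < 1 / real (Suc n)" if "y \<in> D" for y
      using g(2)[of "cos y"] that by (simp add: arccos_cos)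
    moreover have "continuous_on D (\<lambda>y. g (cos y))" unfolding am by (intro continuous_intros)
    moreover have "initial_continuous T (\<lambda>y. g (cos y))" unfolding am by (rule initial_continuous_cos_polynomial)
    ultimately show ?thesis by blast
  qed
  then obtain q where q: "\<And>n. continuous_on D (q n)" "\<And>n. initial_continuous T (q n)"
    "\<And>n y. y \<in> D \<Longrightarrow> \<bar>u0 y - q n y\<bar> < 1 / real (Suc n)" by metis
  \<comment> \<open>At t = 0 the error is that of \<open>q n\<close> itself, at t > 0 it is
    multiplied by at most C. The factor C + 1 covers both, so the convergence is uniform down to t =
    0.\<close>
  have diff: "\<bar>initial_term u0 x t - initial_term (q n) x t\<bar> \<le> (C + 1) * (1 / real (Suc n))"
    if x: "x \<in> D" and t: "t \<in> {0..T}" for x t n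
  proof (cases "t = 0")
    case True
    have "1 * (1 / real (Suc n)) \<le> (C + 1) * (1 / real (Suc n))" using C(1) by (intro mult_right_mono) auto
    thus ?thesis using q(3)[OF x, of n] True by (simp add: initial_term_def)
  next
    case False
    hence t: "0 < t" "t \<le> T" using t by auto
    have cg: "continuous_on D (\<lambda>y. green x y t)" by (intro continuous_on_green t)
    have "initial_term u0 x t - initial_term (q n) x t = initial_term (\<lambda>y. 1 * u0 y + (-1) * q n y) x t"
      using t by (subst initial_term_linear[OF u0 q(1)]) auto
    also have "\<dots> = (LINT y:D|lborel. green x y t * (u0 y - q n y))" using t by (simp add: initial_term_def)
    finally have "\<bar>initial_term u0 x t - initial_term (q n) x t\<bar> \<le> (LINT y:D|lborel. \<bar>green x y t * (u0 y - q n y)\<bar>)"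
      using set_integral_norm_bound[of lborel D "\<lambda>y. green x y t * (u0 y - q n y)"]
        borel_integrable_atLeastAtMost'[OF continuous_on_mult[OF cg continuous_on_diff[OF u0 q(1)[of n]]]] by simp
    also have "\<dots> \<le> (LINT y:D|lborel. \<bar>green x y t\<bar> * (1 / real (Suc n)))"
      by (intro set_integral_mono borel_integrable_atLeastAtMost' continuous_intros cg u0 q(1))
         (simp only: abs_mult, intro mult_left_mono less_imp_le q(3) abs_ge_zero)
    also have "\<dots> \<le> C * (1 / real (Suc n))"
      unfolding set_integral_mult_left using C(2)[OF x t] by (intro mult_right_mono) auto
    also have "\<dots> \<le> (C + 1) * (1 / real (Suc n))" by (intro mult_right_mono) auto
    finally show ?thesis .
  qed
  show ?thesis
  proof (rule uniform_limit_theorem)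
    show "\<forall>\<^sub>F n in sequentially. continuous_on (D \<times> {0..T}) (\<lambda>(x, t). initial_term (q n) x t)"
      using q(2) by (simp add: initial_continuous_def)
    show "uniform_limit (D \<times> {0..T}) (\<lambda>n (x, t). initial_term (q n) x t) (\<lambda>(x, t). initial_term u0 x t) sequentially"
    proof (rule uniform_limitI)
      fix e :: real assume e: "e > 0"
      have "(\<lambda>n. (C + 1) * (1 / real (Suc n))) \<longlonglongrightarrow> (C + 1) * 0"
        by (intro tendsto_intros LIMSEQ_inverse_real_of_nat[unfolded inverse_eq_divide])
      hence "\<forall>\<^sub>F n in sequentially. (C + 1) * (1 / real (Suc n)) < e" using e by (intro order_tendstoD) auto
      thus "\<forall>\<^sub>F n in sequentially. \<forall>z\<in>D \<times> {0..T}. dist (case z of (x, t) \<Rightarrow> initial_term (q n) x t) (case z of (x, t) \<Rightarrow> initial_term u0 x t) < e"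
      proof eventually_elim
        case (elim n)
        show ?case
        proof
          fix z assume "z \<in> D \<times> {0..T}"
          then obtain x t where z: "z = (x, t)" "x \<in> D" "t \<in> {0..T}" by auto
          have "\<bar>initial_term u0 x t - initial_term (q n) x t\<bar> < e"
            using diff[OF z(2,3), of n] elim by linarith
          thus "dist (case z of (x, t) \<Rightarrow> initial_term (q n) x t) (case z of (x, t) \<Rightarrow> initial_term u0 x t) < e"
            by (simp add: z(1) dist_real_def abs_minus_commute)
        qed
      qed
    qed
  qed simp
qed

section \<open>Cubic polynomials of an \<open>L\<^sup>p\<close>-continuous path\<close>

lemma power_le_powr:
  fixes r p :: real
  assumes "r \<ge> 1" "real j \<le> p"
  shows "r ^ j \<le> r powr p"
  using powr_mono[of "real j" p r] assms by (simp add: powr_realpow)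

lemma power_le_one_plus_powr:
  fixes b p :: real
  assumes "b \<ge> 0" "real j \<le> p"
  shows "b ^ j \<le> 1 + b powr p"
proof (cases "b \<le> 1")
  case True
  thus ?thesis using assms power_le_one[of b j] by (smt (verit) powr_ge_zero)
next
  case False
  thus ?thesis using power_le_powr[of b j p] assms by simp
qed

text \<open>The exponent \<open>p > 3\<close> leaves room to make the coefficient of \<open>1 + \<bar>b\<bar>\<^sup>p\<close> small.\<close>

lemma cubic_increment_bound:
  fixes f :: "real poly"
  assumes f: "degree f \<le> 3"
  obtains A where "A \<ge> 0" "\<And>a b e p. 0 < e \<Longrightarrow> e \<le> 1 \<Longrightarrow> 4 \<le> p \<Longrightarrow>
    \<bar>poly f a - poly f b\<bar> \<le> A * (e * (1 + \<bar>b\<bar> powr p) + (\<bar>a - b\<bar> / e) powr p)"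
proof -
  define c where "c = coeff f"
  have pf: "poly f x = c 0 + c 1 * x + c 2 * x\<^sup>2 + c 3 * x ^ 3" for x
  proof -
    have "poly f x = (\<Sum>i\<le>3. c i * x ^ i)"
      unfolding poly_altdef c_def using f by (intro sum.mono_neutral_left) (auto simp: coeff_eq_0)
    thus ?thesis by (simp add: eval_nat_numeral)
  qed
  define A where "A = \<bar>c 1\<bar> + 3 * \<bar>c 2\<bar> + 5 * \<bar>c 3\<bar>"
  show ?thesis
  proof (rule that[of "3 * A"])
    show "3 * A \<ge> 0" by (simp add: A_def)
    fix a b e p :: real assume e: "0 < e" "e \<le> 1" and p: "4 \<le> p"
    define d where "d = a - b"
    have a: "a = b + d" by (simp add: d_def)
    \<comment> \<open>Expanded around b, the increment is d times a quadratic polynomial in b and d.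
      Its mixed terms are absorbed into 1 + b^2 + d^2, at the cost of the factors 3 and 5 in
      A.\<close>
    have 1: "\<bar>poly f a - poly f b\<bar> \<le> A * (\<bar>d\<bar> + \<bar>d\<bar> ^ 3 + \<bar>d\<bar> * \<bar>b\<bar>\<^sup>2)"
    proof -
      have eq: "poly f a - poly f b = d * (c 1 + c 2 * (2 * b + d) + c 3 * (3 * b\<^sup>2 + 3 * (b * d) + d\<^sup>2))"
        unfolding pf a by (simp add: algebra_simps power2_eq_square power3_eq_cube)
      have q: "2 * \<bar>b\<bar> \<le> 1 + b\<^sup>2" "\<bar>d\<bar> \<le> 1 + d\<^sup>2" "2 * \<bar>b * d\<bar> \<le> b\<^sup>2 + d\<^sup>2"
        using sum_squares_bound[of 1 "\<bar>b\<bar>"] sum_squares_bound[of 1 "\<bar>d\<bar>"] sum_squares_bound[of "\<bar>b\<bar>" "\<bar>d\<bar>"]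
        by (auto simp: abs_mult)
      have "\<bar>c 1 + c 2 * (2 * b + d) + c 3 * (3 * b\<^sup>2 + 3 * (b * d) + d\<^sup>2)\<bar>
          \<le> \<bar>c 1\<bar> + \<bar>c 2\<bar> * \<bar>2 * b + d\<bar> + \<bar>c 3\<bar> * \<bar>3 * b\<^sup>2 + 3 * (b * d) + d\<^sup>2\<bar>"
        unfolding abs_mult[symmetric] by linarith
      also have "\<dots> \<le> \<bar>c 1\<bar> * (1 + b\<^sup>2 + d\<^sup>2) + \<bar>c 2\<bar> * (3 * (1 + b\<^sup>2 + d\<^sup>2)) + \<bar>c 3\<bar> * (5 * (1 + b\<^sup>2 + d\<^sup>2))"
      proof (intro add_mono mult_left_mono)
        show "\<bar>c 1\<bar> \<le> \<bar>c 1\<bar> * (1 + b\<^sup>2 + d\<^sup>2)" by (simp add: distrib_left add.assoc)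
        have "\<bar>2 * b + d\<bar> \<le> 3 + 3 * B + 3 * E"
          if "2 * \<bar>b\<bar> \<le> 1 + B" "\<bar>d\<bar> \<le> 1 + E" "0 \<le> B" "0 \<le> E" for B E
          using that by linarith
        from this[OF q(1,2)] show "\<bar>2 * b + d\<bar> \<le> 3 * (1 + b\<^sup>2 + d\<^sup>2)" by simp
        have "\<bar>3 * B + 3 * X + E\<bar> \<le> 5 + 5 * B + 5 * E"
          if "2 * \<bar>X\<bar> \<le> B + E" "0 \<le> B" "0 \<le> E" for B E X :: real
          using that by linarith
        from this[OF q(3)] show "\<bar>3 * b\<^sup>2 + 3 * (b * d) + d\<^sup>2\<bar> \<le> 5 * (1 + b\<^sup>2 + d\<^sup>2)" by simp
      qed auto
      also have "\<dots> = A * (1 + b\<^sup>2 + d\<^sup>2)" by (simp add: A_def algebra_simps)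
      finally have "\<bar>poly f a - poly f b\<bar> \<le> \<bar>d\<bar> * (A * (1 + b\<^sup>2 + d\<^sup>2))"
        unfolding eq abs_mult by (intro mult_left_mono) auto
      also have "\<dots> = A * (\<bar>d\<bar> + \<bar>d\<bar> * \<bar>d\<bar>\<^sup>2 + \<bar>d\<bar> * \<bar>b\<bar>\<^sup>2)" by (simp add: algebra_simps)
      also have "\<bar>d\<bar> * \<bar>d\<bar>\<^sup>2 = \<bar>d\<bar> ^ 3" by (simp only: power3_eq_cube power2_eq_square mult.assoc)
      finally show ?thesis .
    qed
    define P where "P = 1 + \<bar>b\<bar> powr p"
    define Q where "Q = (\<bar>d\<bar> / e) powr p"
    have P: "P \<ge> 1" by (simp add: P_def)
    have Q: "Q \<ge> 0" by (simp add: Q_def)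
    have b2: "\<bar>b\<bar>\<^sup>2 \<le> P" "\<bar>b\<bar> ^ 3 \<le> P" unfolding P_def using p by (intro power_le_one_plus_powr; simp)+
    have "\<bar>d\<bar> + \<bar>d\<bar> ^ 3 + \<bar>d\<bar> * \<bar>b\<bar>\<^sup>2 \<le> 3 * (e * P + Q)"
    proof (cases "\<bar>d\<bar> \<le> e")
      case True
      have "\<bar>d\<bar> ^ 3 \<le> e ^ 3" using True by (intro power_mono) auto
      also have "e ^ 3 \<le> e" using e power_decreasing[of 1 3 e] by simp
      finally have "\<bar>d\<bar> ^ 3 \<le> e" .
      moreover have "e * 1 \<le> e * P" using e P by (intro mult_left_mono) auto
      moreover have "\<bar>d\<bar> * \<bar>b\<bar>\<^sup>2 \<le> e * P" using True e b2 by (intro mult_mono) auto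
      ultimately show ?thesis using True Q by argo
    next
      case False
      \<comment> \<open>Beyond the threshold e this ratio is at least 1, so r and r^3 are both
        dominated by r^p, the second term of the bound.\<close>
      define r where "r = \<bar>d\<bar> / e"
      have r: "r \<ge> 1" "\<bar>d\<bar> = e * r" using e False by (simp_all add: r_def)
      have rj: "r \<le> Q" "r ^ 3 \<le> Q"
        using power_le_powr[OF r(1), of 1 p] power_le_powr[OF r(1), of 3 p] p by (simp_all add: Q_def r_def)
      have "\<bar>d\<bar> \<le> r" using mult_right_mono[OF e(2), of r] r by simp
      moreover from this have "\<bar>d\<bar> ^ 3 \<le> r ^ 3" by (intro power_mono) auto
      \<comment> \<open>If |b| <= r the product is at most r^3. Otherwise |d| = e r <= e |b|, and
        the product is at most e |b|^3, which is where the small factor e is gained.\<close>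
      moreover have "\<bar>d\<bar> * \<bar>b\<bar>\<^sup>2 \<le> e * P + Q"
      proof (cases "\<bar>b\<bar> \<le> r")
        case True
        have "\<bar>d\<bar> * \<bar>b\<bar>\<^sup>2 \<le> r * r\<^sup>2" using True \<open>\<bar>d\<bar> \<le> r\<close> by (intro mult_mono power_mono) auto
        also have "\<dots> = r ^ 3" by (simp add: power3_eq_cube power2_eq_square)
        finally show ?thesis using rj e P by (smt (verit) mult_nonneg_nonneg)
      next
        case False
        have "\<bar>d\<bar> * \<bar>b\<bar>\<^sup>2 \<le> (e * \<bar>b\<bar>) * \<bar>b\<bar>\<^sup>2" unfolding r(2) using False e by (intro mult_right_mono mult_left_mono) auto
        also have "\<dots> = e * \<bar>b\<bar> ^ 3" by (simp add: power3_eq_cube power2_eq_square)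
        also have "\<dots> \<le> e * P" using e b2 by (intro mult_left_mono) auto
        finally show ?thesis using Q by linarith
      qed
      moreover have "0 \<le> e * P" using e P by simp
      ultimately show ?thesis using rj Q by argo
    qed
    hence "A * (\<bar>d\<bar> + \<bar>d\<bar> ^ 3 + \<bar>d\<bar> * \<bar>b\<bar>\<^sup>2) \<le> A * (3 * (e * P + Q))"
      by (intro mult_left_mono) (auto simp: A_def)
    with 1 show "\<bar>poly f a - poly f b\<bar> \<le> 3 * A * (e * (1 + \<bar>b\<bar> powr p) + (\<bar>a - b\<bar> / e) powr p)"
      by (simp add: P_def Q_def d_def mult_ac)
  qed
qed

section \<open>Measurability and integrability along the path\<close>

lemma set_borel_measurable_comp:
  fixes g :: "_ \<Rightarrow> real" and h :: "real \<Rightarrow> real"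
  assumes "set_borel_measurable M A g" "h \<in> borel_measurable borel" "A \<in> sets M"
  shows "set_borel_measurable M A (\<lambda>y. h (g y))"
proof -
  define g' where "g' = (\<lambda>y. indicator A y *\<^sub>R g y)"
  have [measurable]: "g' \<in> borel_measurable M" "h \<in> borel_measurable borel" "A \<in> sets M"
    using assms by (auto simp: set_borel_measurable_def g'_def)
  have "(\<lambda>y. indicator A y *\<^sub>R h (g' y)) \<in> borel_measurable M" by measurable
  moreover have "(\<lambda>y. indicator A y *\<^sub>R h (g' y)) = (\<lambda>y. indicator A y *\<^sub>R h (g y))"
    by (rule ext) (simp add: g'_def split: split_indicator)
  ultimately show ?thesis by (simp only: set_borel_measurable_def)
qed

lemma set_integrable_bounded_by:
  fixes f g :: "_ \<Rightarrow> real"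
  assumes "set_borel_measurable M A f" "set_integrable M A g" "\<And>y. y \<in> A \<Longrightarrow> \<bar>f y\<bar> \<le> g y"
  shows "set_integrable M A f"
  using assms unfolding set_integrable_def set_borel_measurable_def
  by (elim Bochner_Integration.integrable_bound) (auto simp: indicator_def intro!: always_eventually order_trans[OF assms(3)])

lemma in_Lp_diff:
  assumes p: "p > 0" and g: "in_Lp p g" and h: "in_Lp p h"
  shows "in_Lp p (\<lambda>y. g y - h y)"
proof -
  have m: "set_borel_measurable lborel D (\<lambda>y. g y - h y)"
    using g h unfolding in_Lp_def set_borel_measurable_def by (auto simp: algebra_simps)
  moreover have "set_integrable lborel D (\<lambda>y. \<bar>g y - h y\<bar> powr p)"
  proof (rule set_integrable_bounded_by)
    show "set_borel_measurable lborel D (\<lambda>y. \<bar>g y - h y\<bar> powr p)"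
      by (rule set_borel_measurable_comp[OF m, of "\<lambda>z. \<bar>z\<bar> powr p"]) auto
    show "set_integrable lborel D (\<lambda>y. 2 powr p * (\<bar>g y\<bar> powr p + \<bar>h y\<bar> powr p))"
      using g h unfolding in_Lp_def by (intro set_integrable_mult_right set_integral_add) auto
    fix y
    have "\<bar>g y - h y\<bar> \<le> 2 * max \<bar>g y\<bar> \<bar>h y\<bar>" by linarith
    hence "\<bar>g y - h y\<bar> powr p \<le> (2 * max \<bar>g y\<bar> \<bar>h y\<bar>) powr p" using p by (intro powr_mono2) auto
    also have "\<dots> = 2 powr p * max \<bar>g y\<bar> \<bar>h y\<bar> powr p" by (rule powr_mult)
    also have "\<dots> \<le> 2 powr p * (\<bar>g y\<bar> powr p + \<bar>h y\<bar> powr p)" by (intro mult_left_mono) (auto simp: max_def)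
    finally show "\<bar>\<bar>g y - h y\<bar> powr p\<bar> \<le> 2 powr p * (\<bar>g y\<bar> powr p + \<bar>h y\<bar> powr p)" by simp
  qed
  ultimately show ?thesis by (simp add: in_Lp_def)
qed

lemma Lp_continuous_moment:
  assumes v: "Lp_continuous p T v" and p: "p > 0" and t: "t \<in> {0..T}"
  shows "((\<lambda>s. LINT y:D|lborel. \<bar>v y s - v y t\<bar> powr p) \<longlongrightarrow> 0) (at t within {0..T})"
proof -
  have "((\<lambda>s. Lp_norm p (\<lambda>y. v y s - v y t) powr p) \<longlongrightarrow> 0) (at t within {0..T})"
    using v t p unfolding Lp_continuous_def by (intro tendsto_zero_powrI[OF _ tendsto_const]) (auto simp: Lp_norm_def)
  moreover have "Lp_norm p g powr p = (LINT y:D|lborel. \<bar>g y\<bar> powr p)" for g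
  proof -
    have "(LINT y:D|lborel. \<bar>g y\<bar> powr p) \<ge> 0"
      unfolding set_lebesgue_integral_def by (intro Bochner_Integration.integral_nonneg) auto
    thus ?thesis using p by (simp add: Lp_norm_def powr_powr)
  qed
  ultimately show ?thesis by simp
qed

lemma Lp_cubic_integrable:
  assumes f: "degree f \<le> 3" and p: "4 \<le> p" and g: "in_Lp p g"
  shows "set_integrable lborel D (\<lambda>y. poly f (g y))"
proof -
  obtain A where A: "A \<ge> 0" "\<And>a b e p. 0 < e \<Longrightarrow> e \<le> 1 \<Longrightarrow> 4 \<le> p \<Longrightarrow>
      \<bar>poly f a - poly f b\<bar> \<le> A * (e * (1 + \<bar>b\<bar> powr p) + (\<bar>a - b\<bar> / e) powr p)"
    by (rule cubic_increment_bound[OF f]) blast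
  show ?thesis
  proof (rule set_integrable_bounded_by)
    show "set_borel_measurable lborel D (\<lambda>y. poly f (g y))"
      using g unfolding in_Lp_def
      by (intro set_borel_measurable_comp[where h = "poly f"] borel_measurable_continuous_onI continuous_intros) auto
    have "set_integrable lborel D (\<lambda>y. \<bar>poly f 0\<bar> + A)"
      by (intro borel_integrable_atLeastAtMost' continuous_intros)
    thus "set_integrable lborel D (\<lambda>y. (\<bar>poly f 0\<bar> + A) + A * \<bar>g y\<bar> powr p)"
      using g unfolding in_Lp_def by (intro set_integral_add(1)[where f = "\<lambda>y. \<bar>poly f 0\<bar> + A"] set_integrable_mult_right) auto
    show "\<bar>poly f (g y)\<bar> \<le> (\<bar>poly f 0\<bar> + A) + A * \<bar>g y\<bar> powr p" for y
      using A(2)[of 1 p "g y" 0] p by (simp add: distrib_left)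
  qed
qed

text \<open>For fixed e the L1 increment of f(v) is at most A e K plus A e^(-p) times the p-th
  moment of v(s) - v(t). The first term is small by the choice of e, uniformly in s; with e fixed,
  the second tends to 0 as s tends to t.\<close>

lemma Lp_continuous_cubic:
  assumes v: "Lp_continuous p T v" and f: "degree f \<le> 3" and p: "4 \<le> p" and t: "t \<in> {0..T}"
  shows "((\<lambda>s. LINT y:D|lborel. \<bar>poly f (v y s) - poly f (v y t)\<bar>) \<longlongrightarrow> 0) (at t within {0..T})"
proof -
  obtain A where A: "A \<ge> 0" "\<And>a b e p. 0 < e \<Longrightarrow> e \<le> 1 \<Longrightarrow> 4 \<le> p \<Longrightarrow>
      \<bar>poly f a - poly f b\<bar> \<le> A * (e * (1 + \<bar>b\<bar> powr p) + (\<bar>a - b\<bar> / e) powr p)"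
    by (rule cubic_increment_bound[OF f]) blast
  have in_Lp: "in_Lp p (\<lambda>y. v y s)" if "s \<in> {0..T}" for s using v that by (simp add: Lp_continuous_def)
  define K where "K = pi + (LINT y:D|lborel. \<bar>v y t\<bar> powr p)"
  define N where "N s = (LINT y:D|lborel. \<bar>v y s - v y t\<bar> powr p)" for s
  have K: "K > 0" unfolding K_def set_lebesgue_integral_def
    by (intro add_pos_nonneg Bochner_Integration.integral_nonneg) auto
  have le: "(LINT y:D|lborel. \<bar>poly f (v y s) - poly f (v y t)\<bar>) \<le> A * e * K + A * (1 / e) powr p * N s"
    if s: "s \<in> {0..T}" and e: "0 < e" "e \<le> 1" for s e
  proof -
    have i1: "set_integrable lborel D (\<lambda>y. \<bar>v y t\<bar> powr p)" using in_Lp[OF t] by (simp add: in_Lp_def)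
    have i2: "set_integrable lborel D (\<lambda>y. \<bar>v y s - v y t\<bar> powr p)"
      using in_Lp_diff[OF _ in_Lp[OF s] in_Lp[OF t]] p by (simp add: in_Lp_def)
    have i0: "set_integrable lborel D (\<lambda>y. 1 :: real)"
      by (intro borel_integrable_atLeastAtMost' continuous_intros)
    have "(LINT y:D|lborel. \<bar>poly f (v y s) - poly f (v y t)\<bar>)
        \<le> (LINT y:D|lborel. A * e * (1 + \<bar>v y t\<bar> powr p) + A * (1 / e) powr p * \<bar>v y s - v y t\<bar> powr p)"
    proof (rule set_integral_mono)
      show "set_integrable lborel D (\<lambda>y. \<bar>poly f (v y s) - poly f (v y t)\<bar>)"
        using in_Lp s t by (intro set_integrable_abs set_integral_diff Lp_cubic_integrable[OF f p]) auto
      show "set_integrable lborel D (\<lambda>y. A * e * (1 + \<bar>v y t\<bar> powr p) + A * (1 / e) powr p * \<bar>v y s - v y t\<bar> powr p)"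
        by (intro set_integral_add set_integrable_mult_right i0 i1 i2)
      fix y
      have "(\<bar>v y s - v y t\<bar> / e) powr p = (1 / e) powr p * \<bar>v y s - v y t\<bar> powr p"
        using e by (simp add: powr_divide)
      thus "\<bar>poly f (v y s) - poly f (v y t)\<bar> \<le> A * e * (1 + \<bar>v y t\<bar> powr p) + A * (1 / e) powr p * \<bar>v y s - v y t\<bar> powr p"
        using A(2)[OF e p, of "v y s" "v y t"] by (simp add: distrib_left mult.assoc)
    qed
    also have "\<dots> = A * e * ((LINT y:D|lborel. 1) + (LINT y:D|lborel. \<bar>v y t\<bar> powr p)) + A * (1 / e) powr p * N s"
      by (simp only: set_integral_add set_integral_mult_right i0 i1 i2 N_def set_integrable_mult_right)
    also have "(LINT y:D|lborel. 1) = pi" by (simp add: set_lebesgue_integral_def)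
    finally show ?thesis by (simp add: K_def)
  qed
  have N: "(N \<longlongrightarrow> 0) (at t within {0..T})"
    unfolding N_def using Lp_continuous_moment[OF v _ t] p by simp
  show ?thesis
  proof (rule tendstoI)
    fix d :: real assume d: "d > 0"
    \<comment> \<open>The minimum with 1 meets the range of the increment bound; A + 1 in place of A
      keeps the denominator positive.\<close>
    define e where "e = min 1 (d / (2 * (A + 1) * K))"
    have e: "0 < e" "e \<le> 1" using d K A by (auto simp: e_def intro!: divide_pos_pos mult_pos_pos)
    have "A * e * K \<le> (A + 1) * e * K" using K e by (intro mult_right_mono) auto
    also have "\<dots> \<le> (A + 1) * (d / (2 * (A + 1) * K)) * K"
      using A K by (intro mult_right_mono mult_left_mono) (auto simp: e_def)
    also have "\<dots> = d / 2" using A(1) K by (simp add: add_nonneg_eq_0_iff field_split_simps)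
    finally have 1: "A * e * K \<le> d / 2" .
    have "((\<lambda>s. A * (1 / e) powr p * N s) \<longlongrightarrow> A * (1 / e) powr p * 0) (at t within {0..T})"
      by (intro tendsto_intros N)
    hence "\<forall>\<^sub>F s in at t within {0..T}. A * (1 / e) powr p * N s < d / 2"
      using d by (intro order_tendstoD) auto
    moreover have "\<forall>\<^sub>F s in at t within {0..T}. s \<in> {0..T}"
      by (simp add: eventually_at_filter)
    ultimately show "\<forall>\<^sub>F s in at t within {0..T}. dist (LINT y:D|lborel. \<bar>poly f (v y s) - poly f (v y t)\<bar>) 0 < d"
    proof eventually_elim
      case (elim s)
      have "0 \<le> (LINT y:D|lborel. \<bar>poly f (v y s) - poly f (v y t)\<bar>)"
        unfolding set_lebesgue_integral_def by (intro Bochner_Integration.integral_nonneg) auto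
      with le[OF elim(2) e] 1 elim(1) show ?case by simp
    qed
  qed
qed

section \<open>The drift term\<close>

lemma exp_convolution_has_integral:
  assumes l: "l > 0" and t: "t \<ge> (0::real)"
  shows "((\<lambda>s. exp (- (l * (t - s)))) has_integral (1 - exp (- (l * t))) / l) {0..t}"
proof -
  have "((\<lambda>s. exp (- (l * (t - s))) / l) has_vector_derivative exp (- (l * (t - s)))) (at s within {0..t})" for s
    unfolding has_real_derivative_iff_has_vector_derivative[symmetric]
    using l by (auto intro!: derivative_eq_intros)
  from fundamental_theorem_of_calculus[OF t this] show ?thesis
    by (simp add: diff_divide_distrib)
qed

text \<open>The factor exp(-l t) comes out of the integral, and what remains is an indefinite
  integral of a continuous function.\<close>

lemma continuous_on_exp_convolution:
  fixes F :: "real \<Rightarrow> real"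
  assumes F: "continuous_on {0..T} F"
  shows "continuous_on {0..T} (\<lambda>t. integral {0..t} (\<lambda>s. exp (- (l * (t - s))) * F s))"
proof -
  have c: "continuous_on {0..T} (\<lambda>s. exp (l * s) * F s)" by (intro continuous_intros F)
  have eq: "exp (- (l * t)) * integral {0..t} (\<lambda>s. exp (l * s) * F s) = integral {0..t} (\<lambda>s. exp (- (l * (t - s))) * F s)" for t
  proof -
    have "exp (- (l * (t - s))) * F s = exp (- (l * t)) * (exp (l * s) * F s)" for s
      by (simp add: algebra_simps flip: exp_add mult.assoc)
    thus ?thesis by (simp only: Henstock_Kurzweil_Integration.integral_mult_right)
  qed
  show ?thesis unfolding eq[symmetric]
    by (intro continuous_intros indefinite_integral_continuous_1 integrable_continuous_interval c)
qed

lemma exp_convolution_bound: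
  fixes F :: "real \<Rightarrow> real"
  assumes F: "continuous_on {0..t} F" and B: "\<And>s. s \<in> {0..t} \<Longrightarrow> \<bar>F s\<bar> \<le> B" and l: "l > 0" and t: "t \<ge> 0"
  shows "\<bar>integral {0..t} (\<lambda>s. exp (- (l * (t - s))) * F s)\<bar> \<le> B / l"
proof -
  have B0: "B \<ge> 0" using B[of 0] t by force
  have "norm (integral {0..t} (\<lambda>s. exp (- (l * (t - s))) * F s)) \<le> integral {0..t} (\<lambda>s. exp (- (l * (t - s))) * B)"
    by (intro integral_norm_bound_integral integrable_continuous_interval continuous_intros F)
       (use B in \<open>auto simp: abs_mult\<close>)
  also have "\<dots> = (1 - exp (- (l * t))) / l * B"
    using exp_convolution_has_integral[OF l t] by (simp add: integral_unique)
  also have "\<dots> \<le> 1 / l * B" using B0 l by (intro mult_right_mono divide_right_mono) auto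
  finally show ?thesis by simp
qed

text \<open>A path that is continuous into L1 is bounded there on the compact time interval, so a
  single constant B bounds all cosine coefficients at all times. Boundedness of the coefficients
  suffices, because the smoothing in time makes the k-th term of order B k^(-2).\<close>

theorem continuous_on_drift_term:
  assumes T: "T \<ge> 0" and v: "Lp_continuous p T v" and f: "degree f \<le> 3" and p: "4 \<le> p"
  shows "continuous_on (D \<times> {0..T}) (\<lambda>(x, t). drift_term f v x t)"
proof -
  define F where "F k s = (LINT y:D|lborel. mode k y * poly f (v y s))" for k s
  define E where "E k t = integral {0..t} (\<lambda>s. exp (- (real k ^ 4 * (t - s))) * F k s)" for k t
  define n where "n s = (LINT y:D|lborel. \<bar>poly f (v y s)\<bar>)" for s
  have fv: "set_integrable lborel D (\<lambda>y. poly f (v y s))" if "s \<in> {0..T}" for s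
    using v that by (intro Lp_cubic_integrable[OF f p]) (auto simp: Lp_continuous_def)
  \<comment> \<open>The zero sequence stands in for the coefficients when only the bound on a single
    cosine coefficient is taken from \<open>mode_series_integral\<close>.\<close>
  have s0: "summable (\<lambda>k::nat. \<bar>0::real\<bar>)" by simp
  have n_diff: "\<bar>n s - n t\<bar> \<le> (LINT y:D|lborel. \<bar>poly f (v y s) - poly f (v y t)\<bar>)" if "s \<in> {0..T}" "t \<in> {0..T}" for s t
  proof -
    have d: "set_integrable lborel D (\<lambda>y. \<bar>poly f (v y s)\<bar> - \<bar>poly f (v y t)\<bar>)"
      using fv that by (intro set_integral_diff set_integrable_abs) auto
    have "n s - n t = (LINT y:D|lborel. \<bar>poly f (v y s)\<bar> - \<bar>poly f (v y t)\<bar>)"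
      unfolding n_def using fv that by (intro set_integral_diff(2)[symmetric] set_integrable_abs) auto
    also have "\<bar>\<dots>\<bar> \<le> (LINT y:D|lborel. \<bar>\<bar>poly f (v y s)\<bar> - \<bar>poly f (v y t)\<bar>\<bar>)"
      using set_integral_norm_bound[OF d] by simp
    also have "\<dots> \<le> (LINT y:D|lborel. \<bar>poly f (v y s) - poly f (v y t)\<bar>)"
      using fv that by (intro set_integral_mono set_integrable_abs set_integral_diff) auto
    finally show ?thesis .
  qed
  have F_diff: "\<bar>F k s - F k t\<bar> \<le> (LINT y:D|lborel. \<bar>poly f (v y s) - poly f (v y t)\<bar>)" if "s \<in> {0..T}" "t \<in> {0..T}" for k s t
  proof -
    have i: "set_integrable lborel D (\<lambda>y. mode k y * poly f (v y s))" if "s \<in> {0..T}" for s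
      by (rule mode_times_integrable[OF fv[OF that]])
    have "F k s - F k t = (LINT y:D|lborel. mode k y * poly f (v y s) - mode k y * poly f (v y t))"
      unfolding F_def using that i by (intro set_integral_diff(2)[symmetric]) auto
    also have "\<dots> = (LINT y:D|lborel. mode k y * (poly f (v y s) - poly f (v y t)))" by (simp add: right_diff_distrib)
    finally show ?thesis
      using mode_series_integral(3)[OF s0 set_integral_diff(1)[OF fv fv]] that by auto
  qed
  \<comment> \<open>A function of time whose increments are dominated by the L1 increments of f(v)
    is continuous; this serves both the coefficients \<open>F k\<close> and the norm
    \<open>n\<close>.\<close>
  have cont: "continuous_on {0..T} g"
    if "\<And>s t. s \<in> {0..T} \<Longrightarrow> t \<in> {0..T} \<Longrightarrow> \<bar>g s - g t\<bar> \<le> (LINT y:D|lborel. \<bar>poly f (v y s) - poly f (v y t)\<bar>)" for g :: "real \<Rightarrow> real"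
    unfolding continuous_on_def
  proof
    fix t assume t: "t \<in> {0..T}"
    have "((\<lambda>s. g s - g t) \<longlongrightarrow> 0) (at t within {0..T})"
      by (rule Lim_null_comparison[OF _ Lp_continuous_cubic[OF v f p t]])
         (use that t in \<open>auto simp: eventually_at_filter\<close>)
    thus "(g \<longlongrightarrow> g t) (at t within {0..T})" by (simp add: LIM_zero_iff)
  qed
  have F_cont: "continuous_on {0..T} (F k)" for k by (rule cont[OF F_diff])
  have "continuous_on {0..T} n" by (rule cont[OF n_diff])
  hence "bounded (n ` {0..T})" by (intro compact_imp_bounded compact_continuous_image compact_Icc)
  then obtain B where "\<forall>x\<in>n ` {0..T}. norm x \<le> B" unfolding bounded_iff by blast
  hence B: "\<And>s. s \<in> {0..T} \<Longrightarrow> \<bar>n s\<bar> \<le> B" by simp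
  have B0: "B \<ge> 0" using B[of 0] T by force
  have FB: "\<bar>F k s\<bar> \<le> B" if "s \<in> {0..T}" for k s
  proof -
    have "\<bar>F k s\<bar> \<le> n s" unfolding F_def n_def by (rule mode_series_integral(3)[OF s0 fv[OF that]])
    thus ?thesis using B[OF that] by linarith
  qed
  have E_cont: "continuous_on {0..T} (E k)" for k unfolding E_def by (rule continuous_on_exp_convolution[OF F_cont])
  have k4: "real k ^ 4 = real k ^ 2 * real k ^ 2" for k by (simp flip: power_add)
  have k4': "q * (B / (q * q)) = B * inverse q" if "q \<noteq> 0" for q B :: real
    using that by (simp add: divide_inverse)
  have E_bound: "\<bar>real k ^ 2 * E k t\<bar> \<le> B * inverse (real k ^ 2)" if t: "t \<in> {0..T}" for k t
  proof (cases "k = 0")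
    case False
    have "\<bar>E k t\<bar> \<le> B / real k ^ 4"
      unfolding E_def using False t FB by (intro exp_convolution_bound continuous_on_subset[OF F_cont]) auto
    hence "real k ^ 2 * \<bar>E k t\<bar> \<le> real k ^ 2 * (B / real k ^ 4)" by (intro mult_left_mono) auto
    also have "\<dots> = B * inverse (real k ^ 2)" unfolding k4 by (rule k4') (use False in simp)
    finally show ?thesis by (simp add: abs_mult)
  qed simp
  have drift: "drift_term f v x t = (\<Sum>k. - (real k ^ 2 * E k t) * mode k x)" if t: "t \<in> {0..T}" for x t
  proof -
    define g where "g s = (LINT y:D|lborel. green_yy x y (t - s) * poly f (v y s))" for s
    define h where "h k s = indicator {0..<t} s * (- (real k ^ 2 * mode k x) * (exp (- (real k ^ 4 * (t - s))) * F k s))" for k s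
    have F_cont_t: "continuous_on {0..t} (F k)" for k by (rule continuous_on_subset[OF F_cont]) (use t in auto)
    have int0: "set_integrable lborel {0..t} (\<lambda>s. exp (- (real k ^ 4 * (t - s))) * F k s)" for k
      by (intro borel_integrable_atLeastAtMost' continuous_intros F_cont_t)
    hence int: "set_integrable lborel {0..<t} (\<lambda>s. exp (- (real k ^ 4 * (t - s))) * F k s)" for k
      by (rule set_integrable_subset) auto
    have ih: "integrable lborel (h k)" for k
      using integrable_mult_right[OF int[of k, unfolded set_integrable_def], of "- (real k ^ 2 * mode k x)"]
      by (simp add: h_def [abs_def] mult_ac)
    have hm [measurable]: "h k \<in> borel_measurable borel" for k using ih[of k] by auto
    have g: "g s = (\<Sum>k. h k s)" "summable (\<lambda>k. \<bar>h k s\<bar>)" if s: "0 \<le> s" "s < t" for s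
    proof -
      have ts: "t - s > 0" "s \<in> {0..T}" using s t by auto
      define c where "c k = - (real k ^ 2 * exp (- (real k ^ 4 * (t - s))) * mode k x)" for k
      have "summable (\<lambda>k. \<bar>(real k ^ 2 * exp (- (real k ^ 4 * (t - s)))) * mode k x\<bar>)"
        using summable_power_exp[OF ts(1), of 2] by (intro summable_mode) simp
      hence c: "summable (\<lambda>k. \<bar>c k\<bar>)" by (simp add: c_def)
      have hc: "h k s = c k * F k s" for k using s by (simp add: h_def c_def)
      show "g s = (\<Sum>k. h k s)" "summable (\<lambda>k. \<bar>h k s\<bar>)"
        using mode_series_integral(1,2)[OF c fv[OF ts(2)]]
        by (simp_all add: g_def hc F_def green_yy_eq[OF ts(1)] c_def)
    qed
    have h0: "h k s = 0" if "\<not> (0 \<le> s \<and> s < t)" for k s using that by (simp add: h_def)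
    \<comment> \<open>At s = t the integrand is whatever \<open>green_yy\<close> yields at time 0.
      It is split off as a term at one point, which vanishes almost everywhere.\<close>
    have eq: "indicator {0..t} s *\<^sub>R g s = (\<Sum>k. h k s) + indicator {t} s *\<^sub>R g t" for s
      using g(1)[of s] h0[of s] t by (cases "0 \<le> s \<and> s < t") (auto simp: indicator_def)
    have hk: "(LINT s|lborel. h k s) = - (real k ^ 2 * E k t) * mode k x" for k
    proof -
      have "(LINT s|lborel. h k s) = - (real k ^ 2 * mode k x) * (LINT s:{0..<t}|lborel. exp (- (real k ^ 4 * (t - s))) * F k s)"
        unfolding h_def set_lebesgue_integral_def by (subst integral_mult_right_zero[symmetric]) (simp add: mult_ac)
      also have "(LINT s:{0..<t}|lborel. exp (- (real k ^ 4 * (t - s))) * F k s) = (LINT s:{0..t}|lborel. exp (- (real k ^ 4 * (t - s))) * F k s)"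
        unfolding set_lebesgue_integral_def
      proof (rule integral_cong_AE)
        show "AE s in lborel. indicator {0..<t} s *\<^sub>R (exp (- (real k ^ 4 * (t - s))) * F k s) = indicator {0..t} s *\<^sub>R (exp (- (real k ^ 4 * (t - s))) * F k s)"
          using AE_lborel_singleton[of t] by eventually_elim (auto simp: indicator_def)
      qed (use int0 int in \<open>auto simp: set_integrable_def\<close>)
      also have "\<dots> = E k t" unfolding E_def by (rule set_borel_integral_eq_integral(2)[OF int0])
      finally show ?thesis by simp
    qed
    have "drift_term f v x t = (LINT s|lborel. indicator {0..t} s *\<^sub>R g s)"
      by (simp add: drift_term_def g_def set_lebesgue_integral_def)
    also have "\<dots> = (LINT s|lborel. (\<Sum>k. h k s))"
      unfolding eq
    proof (rule integral_cong_AE)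
      show "AE s in lborel. (\<Sum>k. h k s) + indicator {t} s *\<^sub>R g t = (\<Sum>k. h k s)"
        using AE_lborel_singleton[of t] by eventually_elim auto
    qed simp_all
    also have "\<dots> = (\<Sum>k. LINT s|lborel. h k s)"
    proof (rule integral_suminf[OF ih])
      show "AE s in lborel. summable (\<lambda>k. norm (h k s))"
      proof (intro always_eventually allI)
        fix s
        show "summable (\<lambda>k. norm (h k s))"
          using g(2)[of s] h0[of s] by (cases "0 \<le> s \<and> s < t") auto
      qed
      \<comment> \<open>These L1 norms in s justify integrating the series termwise. For k = 0 both
        sides are 0, on the left because of the factor k^2.\<close>
      have "(LINT s|lborel. norm (h k s)) \<le> B * inverse (real k ^ 2)" for k
      proof (cases "k = 0")
        case False
        have "(LINT s|lborel. norm (h k s)) \<le> (LINT s|lborel. indicator {0..t} s *\<^sub>R (real k ^ 2 * B * exp (- (real k ^ 4 * (t - s)))))"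
        proof (rule integral_mono)
          show "integrable lborel (\<lambda>s. indicator {0..t} s *\<^sub>R (real k ^ 2 * B * exp (- (real k ^ 4 * (t - s)))))"
            using borel_integrable_atLeastAtMost'[of 0 t "\<lambda>s. real k ^ 2 * B * exp (- (real k ^ 4 * (t - s)))"]
            by (simp add: set_integrable_def continuous_intros)
          fix s
          show "norm (h k s) \<le> indicator {0..t} s *\<^sub>R (real k ^ 2 * B * exp (- (real k ^ 4 * (t - s))))"
          proof (cases "0 \<le> s \<and> s < t")
            case True
            have "\<bar>real k ^ 2 * mode k x\<bar> * (exp (- (real k ^ 4 * (t - s))) * \<bar>F k s\<bar>) \<le> \<bar>real k ^ 2\<bar> * (exp (- (real k ^ 4 * (t - s))) * B)"
              using True t by (intro mult_mono mult_left_mono abs_mode_mult_le FB) auto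
            thus ?thesis using True by (simp add: h_def abs_mult mult_ac)
          qed (use B0 in \<open>auto simp: h0 intro!: mult_nonneg_nonneg\<close>)
        qed (use ih in auto)
        also have "\<dots> = integral {0..t} (\<lambda>s. real k ^ 2 * B * exp (- (real k ^ 4 * (t - s))))"
          unfolding set_lebesgue_integral_def[symmetric]
          by (intro set_borel_integral_eq_integral borel_integrable_atLeastAtMost' continuous_intros)
        also have "\<dots> = real k ^ 2 * B * ((1 - exp (- (real k ^ 4 * t))) / real k ^ 4)"
          using exp_convolution_has_integral[of "real k ^ 4" t] False t by (simp add: integral_unique)
        also have "\<dots> \<le> real k ^ 2 * B * (1 / real k ^ 4)"
          using B0 by (intro mult_left_mono divide_right_mono) auto
        also have "\<dots> = real k ^ 2 * (B / real k ^ 4)" by (simp only: mult.assoc times_divide_eq_right mult_1_right)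
        also have "\<dots> = B * inverse (real k ^ 2)" unfolding k4 by (rule k4') (use False in simp)
        finally show ?thesis .
      qed (simp add: h_def)
      thus "summable (\<lambda>k. LINT s|lborel. norm (h k s))"
        by (intro summable_comparison_test'[OF summable_mult[OF inverse_power_summable[of 2]], of 0])
           (auto simp: abs_of_nonneg[OF Bochner_Integration.integral_nonneg])
    qed
    also have "\<dots> = (\<Sum>k. - (real k ^ 2 * E k t) * mode k x)" by (simp only: hk)
    finally show ?thesis .
  qed
  have "continuous_on (D \<times> {0..T}) (\<lambda>z. \<Sum>k. - (real k ^ 2 * E k (snd z)) * mode k (fst z))"
  proof (rule uniform_limit_theorem)
    show "uniform_limit (D \<times> {0..T}) (\<lambda>n z. \<Sum>k<n. - (real k ^ 2 * E k (snd z)) * mode k (fst z))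
        (\<lambda>z. \<Sum>k. - (real k ^ 2 * E k (snd z)) * mode k (fst z)) sequentially"
    proof (rule Weierstrass_m_test[OF _ summable_mult[OF inverse_power_summable[of 2]]])
      fix k z assume "z \<in> D \<times> {0..T}"
      thus "norm (- (real k ^ 2 * E k (snd z)) * mode k (fst z)) \<le> B * inverse (real k ^ 2)"
        using E_bound[of "snd z" k] abs_mode_mult_le[of "- (real k ^ 2 * E k (snd z))" k "fst z"]
        by (auto simp: mem_Times_iff)
    qed simp
    show "\<forall>\<^sub>F n in sequentially. continuous_on (D \<times> {0..T}) (\<lambda>z. \<Sum>k<n. - (real k ^ 2 * E k (snd z)) * mode k (fst z))"
      by (intro always_eventually allI continuous_intros continuous_on_compose2[OF E_cont]) auto
  qed simp
  thus ?thesis by (rule continuous_on_eq) (auto simp: drift)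
qed

section \<open>Kolmogorov's continuity criterion\<close>

lemma power_powr_commute:
  fixes x :: real
  assumes "x > 0"
  shows "(x ^ m) powr a = (x powr a) ^ m"
  using assms by (simp add: powr_powr mult.commute flip: powr_realpow)

text \<open>The point of the level-n grid of [0, T] at or to the left of t. The endpoint t = T has
  index 2^n, so both ends belong to the grid. With T = pi the same map later discretises
  space.\<close>

definition dyadic :: "real \<Rightarrow> nat \<Rightarrow> real \<Rightarrow> real" where
  "dyadic T n t = T * real (nat \<lfloor>2 ^ n * t / T\<rfloor>) / 2 ^ n"

lemma dyadic_bounds:
  assumes T: "T > 0" and t: "t \<in> {0..T}"
  shows "dyadic T n t \<in> {0..T}" "\<bar>dyadic T n t - t\<bar> \<le> T / 2 ^ n" "nat \<lfloor>2 ^ n * t / T\<rfloor> \<le> 2 ^ n"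
proof -
  define z where "z = 2 ^ n * t / T"
  have z: "0 \<le> z" "z \<le> 2 ^ n" using assms by (auto simp: z_def divide_le_eq)
  define k where "k = nat \<lfloor>z\<rfloor>"
  have k: "real k \<le> z" "z < real k + 1" using z by (auto simp: k_def)
  have "real k \<le> 2 ^ n" using k z by linarith
  thus le: "nat \<lfloor>2 ^ n * t / T\<rfloor> \<le> 2 ^ n"
    unfolding k_def z_def using of_nat_le_iff[of _ "2 ^ n", where 'a = real] by simp
  have d: "dyadic T n t = T * real k / 2 ^ n" by (simp add: dyadic_def k_def z_def)
  have tz: "t = T * z / 2 ^ n" using T by (simp add: z_def)
  have "t - dyadic T n t = T * (z - real k) / 2 ^ n"
    unfolding d by (subst tz) (simp add: right_diff_distrib diff_divide_distrib)
  moreover have "0 \<le> T * (z - real k)" "T * (z - real k) \<le> T * 1" using k T by (auto intro!: mult_left_mono)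
  ultimately have "0 \<le> t - dyadic T n t" "t - dyadic T n t \<le> T / 2 ^ n"
    by (auto intro!: divide_right_mono)
  thus "\<bar>dyadic T n t - t\<bar> \<le> T / 2 ^ n" by linarith
  show "dyadic T n t \<in> {0..T}"
    using \<open>0 \<le> t - dyadic T n t\<close> t T by (auto simp: d)
qed

text \<open>From level n to n + 1 the grid point of t stays or moves by one cell of level n + 1, so
  the values along the grid are dominated by a geometric series. Two times at distance at most T/2^n
  have equal or adjacent grid points; one such increment and two tails give 1 + 2/(1 - r). The
  limits along the grid replace the values of x, about which nothing is assumed off the
  grid.\<close>

lemma dyadic_chaining:
  fixes x :: "real \<Rightarrow> real"
  assumes T: "T > 0" and r: "0 < r" "r < 1"
    and inc: "\<And>m j. j < 2 ^ m \<Longrightarrow> \<bar>x (T * real (Suc j) / 2 ^ m) - x (T * real j / 2 ^ m)\<bar> \<le> L * r ^ m"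
  shows "t \<in> {0..T} \<Longrightarrow> convergent (\<lambda>n. x (dyadic T n t))"
    and "s \<in> {0..T} \<Longrightarrow> t \<in> {0..T} \<Longrightarrow> \<bar>t - s\<bar> \<le> T / 2 ^ n \<Longrightarrow>
      \<bar>lim (\<lambda>n. x (dyadic T n t)) - lim (\<lambda>n. x (dyadic T n s))\<bar> \<le> (1 + 2 / (1 - r)) * L * r ^ n"
proof -
  define k where "k n t = nat \<lfloor>2 ^ n * t / T\<rfloor>" for n t
  define X where "X t n = x (dyadic T n t)" for t n
  have X: "X t n = x (T * real (k n t) / 2 ^ n)" for t n by (simp add: X_def dyadic_def k_def)
  have k_le: "k n t \<le> 2 ^ n" if "t \<in> {0..T}" for n t
    using dyadic_bounds(3)[OF T that] by (simp add: k_def)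
  have L: "L \<ge> 0" using order_trans[OF abs_ge_zero inc[of 0 0]] by simp
  have step: "\<bar>X t (Suc n) - X t n\<bar> \<le> L * r ^ n" if t: "t \<in> {0..T}" for t n
  proof -
    define z where "z = 2 ^ n * t / T"
    have z: "0 \<le> z" using t T by (simp add: z_def)
    have "\<lfloor>2 * z\<rfloor> = 2 * \<lfloor>z\<rfloor> \<or> \<lfloor>2 * z\<rfloor> = 2 * \<lfloor>z\<rfloor> + 1" by linarith
    moreover have "0 \<le> \<lfloor>z\<rfloor>" using z by simp
    ultimately have "nat \<lfloor>2 * z\<rfloor> = 2 * nat \<lfloor>z\<rfloor> \<or> nat \<lfloor>2 * z\<rfloor> = Suc (2 * nat \<lfloor>z\<rfloor>)" by linarith
    hence "k (Suc n) t = 2 * k n t \<or> k (Suc n) t = Suc (2 * k n t)"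
      by (simp add: k_def z_def mult.assoc)
    moreover have eq: "X t n = x (T * real (2 * k n t) / 2 ^ Suc n)" by (simp add: X)
    moreover have "L * r ^ Suc n \<le> L * r ^ n"
      using L r by (intro mult_left_mono power_decreasing) auto
    moreover have "0 \<le> L * r ^ n" using L r by simp
    ultimately show ?thesis
      using inc[of "2 * k n t" "Suc n"] k_le[OF t, of "Suc n"] unfolding X by auto
  qed
  have sums_r: "(\<lambda>i. L * r ^ n * r ^ i) sums (L * r ^ n * (1 / (1 - r)))" for n
    using r by (intro sums_mult geometric_sums) auto
  have tel: "\<bar>X t (n + j) - X t n\<bar> \<le> L * r ^ n * (1 / (1 - r))" if t: "t \<in> {0..T}" for t n j
  proof -
    have "X t (n + j) - X t n = (\<Sum>i<j. X t (Suc (n + i)) - X t (n + i))"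
      using sum_lessThan_telescope[of "\<lambda>i. X t (n + i)" j] by simp
    also have "\<bar>\<dots>\<bar> \<le> (\<Sum>i<j. \<bar>X t (Suc (n + i)) - X t (n + i)\<bar>)" by (rule sum_abs)
    also have "\<dots> \<le> (\<Sum>i<j. L * r ^ n * r ^ i)"
    proof (rule sum_mono)
      fix i show "\<bar>X t (Suc (n + i)) - X t (n + i)\<bar> \<le> L * r ^ n * r ^ i"
        using step[OF t, of "n + i"] by (simp add: power_add mult.assoc)
    qed
    also have "\<dots> \<le> (\<Sum>i. L * r ^ n * r ^ i)"
      using L r sums_r[of n] by (intro sum_le_suminf) (auto simp: sums_iff)
    finally show ?thesis using sums_r[of n] by (simp add: sums_iff)
  qed
  have conv: "convergent (X t)" if t: "t \<in> {0..T}" for t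
  proof -
    have "summable (\<lambda>n. X t (Suc n) - X t n)"
    proof (rule summable_comparison_test'[where N = 0])
      show "summable (\<lambda>i. L * r ^ i)" using sums_r[of 0] by (simp add: sums_iff)
    qed (use step[OF t] in simp)
    hence "convergent (\<lambda>n. \<Sum>i<n. X t (Suc i) - X t i)" by (simp add: summable_iff_convergent)
    hence "convergent (\<lambda>n. X t n - X t 0)" by (simp add: sum_lessThan_telescope)
    from convergent_add[OF this convergent_const[of "X t 0"]] show ?thesis by simp
  qed
  show "convergent (\<lambda>n. x (dyadic T n t))" if "t \<in> {0..T}" using conv[OF that] by (simp add: X_def [abs_def])
  have tail: "\<bar>lim (X t) - X t n\<bar> \<le> L * r ^ n * (1 / (1 - r))" if t: "t \<in> {0..T}" for t n
  proof -
    have "(\<lambda>j. X t (n + j)) \<longlonglongrightarrow> lim (X t)"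
      using LIMSEQ_ignore_initial_segment[OF convergent_LIMSEQ_iff[THEN iffD1, OF conv[OF t]], of n]
      by (simp add: add.commute)
    hence "(\<lambda>j. \<bar>X t (n + j) - X t n\<bar>) \<longlonglongrightarrow> \<bar>lim (X t) - X t n\<bar>" by (intro tendsto_intros)
    thus ?thesis by (rule LIMSEQ_le_const2) (use tel[OF t] in auto)
  qed
  have close: "\<bar>X t n - X s n\<bar> \<le> L * r ^ n"
    if s: "s \<in> {0..T}" and t: "t \<in> {0..T}" and st: "s \<le> t" and d: "t - s \<le> T / 2 ^ n" for s t n
  proof -
    have "2 ^ n * s / T \<le> 2 ^ n * t / T" using st T by (intro divide_right_mono mult_left_mono) auto
    moreover have "2 ^ n * t / T \<le> 2 ^ n * s / T + 1"
    proof -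
      have "2 ^ n * (t - s) / T \<le> 2 ^ n * (T / 2 ^ n) / T" using d T by (intro divide_right_mono mult_left_mono) auto
      also have "\<dots> = 1" using T by simp
      finally show ?thesis by (simp add: right_diff_distrib diff_divide_distrib)
    qed
    moreover have "0 \<le> 2 ^ n * s / T" using s T by simp
    ultimately have "k n t = k n s \<or> k n t = Suc (k n s)" unfolding k_def by linarith
    thus ?thesis using inc[of "k n s" n] k_le[OF t, of n] L r unfolding X by auto
  qed
  have main: "\<bar>lim (X t) - lim (X s)\<bar> \<le> (1 + 2 / (1 - r)) * L * r ^ n"
    if s: "s \<in> {0..T}" and t: "t \<in> {0..T}" and st: "s \<le> t" and d: "t - s \<le> T / 2 ^ n" for s t n
  proof -
    have "\<bar>lim (X t) - lim (X s)\<bar> \<le> L * r ^ n + 2 * (L * r ^ n * (1 / (1 - r)))"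
      using tail[OF s, of n] tail[OF t, of n] close[OF that] by linarith
    also have "\<dots> = (1 + 2 / (1 - r)) * L * r ^ n" by (simp add: distrib_right)
    finally show ?thesis .
  qed
  show "\<bar>lim (\<lambda>n. x (dyadic T n t)) - lim (\<lambda>n. x (dyadic T n s))\<bar> \<le> (1 + 2 / (1 - r)) * L * r ^ n"
    if "s \<in> {0..T}" "t \<in> {0..T}" "\<bar>t - s\<bar> \<le> T / 2 ^ n"
    using main[of s t n] main[of t s n] that unfolding X_def [abs_def]
    by (cases "s \<le> t") (auto simp: abs_minus_commute)
qed

text \<open>The level n is the last one whose mesh is still at least d; one level further the mesh
  is below d, which gives the second inequality.\<close>

lemma dyadic_scale:
  fixes d T :: real
  assumes "0 < d" "d \<le> T"
  obtains n :: nat where "d \<le> T / 2 ^ n" "T / 2 ^ n < 2 * d"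
proof -
  have T: "T > 0" using assms by linarith
  obtain N where N: "(1 / 2) ^ N < d / T" using real_arch_pow_inv[of "d / T" "1 / 2"] assms T by auto
  define P where "P n \<longleftrightarrow> T / 2 ^ n < d" for n :: nat
  have "P N" using N T by (simp add: P_def power_one_over field_simps)
  moreover have "\<not> P 0" using assms by (simp add: P_def)
  ultimately obtain n where n: "\<not> P n" "P (Suc n)" using ex_least_nat_less[of P N] by blast
  show ?thesis by (rule that[of n]) (use n in \<open>auto simp: P_def\<close>)
qed

text \<open>The first factor is the q-th power of the Hoelder constant that chaining attaches to
  increments bounded by r^m. The second is the sum over all levels of the increment moments, a
  geometric series of ratio 2^(gamma q - b). It is explicit so that one constant can serve all
  modes.\<close>

definition kolmogorov_const :: "real \<Rightarrow> real \<Rightarrow> real \<Rightarrow> nat \<Rightarrow> real" where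
  "kolmogorov_const T \<gamma> b q =
     ((1 + 2 / (1 - 2 powr (- \<gamma>))) * (2 / T) powr \<gamma>) ^ q * (T powr (1 + b) / (1 - 2 powr (\<gamma> * q - b)))"

text \<open>Level m has 2^m increments, each with q-th moment at most C (T/2^m)^(1 + b). Weighted by
  r^(-m q) = 2^(gamma q m), the whole level contributes C T^(1 + b) times \<open>\<rho>\<close>^m
  with \<open>\<rho>\<close> < 1. The q-th root of the total controls all increments at once, which
  yields a Hoelder constant together with its q-th moment.\<close>

theorem kolmogorov_hoelder:
  fixes X :: "real \<Rightarrow> 'a \<Rightarrow> real"
  assumes T: "T > 0" and q: "q > 0" and \<gamma>: "\<gamma> > 0" "\<gamma> * real q < b" and C: "C \<ge> 0"
    and meas: "\<And>t. t \<in> {0..T} \<Longrightarrow> X t \<in> borel_measurable M"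
    and mom: "\<And>s t. s \<in> {0..T} \<Longrightarrow> t \<in> {0..T} \<Longrightarrow>
      (\<integral>\<^sup>+\<omega>. ennreal (\<bar>X t \<omega> - X s \<omega>\<bar> ^ q) \<partial>M) \<le> ennreal (C * \<bar>t - s\<bar> powr (1 + b))"
  obtains Y K where "\<And>t. t \<in> {0..T} \<Longrightarrow> Y t \<in> borel_measurable M" "K \<in> borel_measurable M"
    "\<And>\<omega>. K \<omega> \<ge> 0"
    "\<And>s t \<omega>. s \<in> {0..T} \<Longrightarrow> t \<in> {0..T} \<Longrightarrow> \<bar>Y t \<omega> - Y s \<omega>\<bar> \<le> K \<omega> * \<bar>t - s\<bar> powr \<gamma>"
    "\<And>t. t \<in> {0..T} \<Longrightarrow> AE \<omega> in M. Y t \<omega> = X t \<omega>"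
    "(\<integral>\<^sup>+\<omega>. ennreal (K \<omega> ^ q) \<partial>M) \<le> ennreal (C * kolmogorov_const T \<gamma> b q)"
proof -
  define r where "r = 2 powr (- \<gamma>)"
  have r: "0 < r" "r < 1" using \<gamma> by (auto simp: r_def powr_less_one)
  define \<rho> where "\<rho> = 2 powr (\<gamma> * q - b)"
  have \<rho>: "0 < \<rho>" "\<rho> < 1" using \<gamma> by (auto simp: \<rho>_def powr_less_one)
  define inc where "inc m j \<omega> = \<bar>X (T * real (Suc j) / 2 ^ m) \<omega> - X (T * real j / 2 ^ m) \<omega>\<bar>" for m j \<omega>
  have dy_in: "T * real j / 2 ^ m \<in> {0..T}" if "j \<le> 2 ^ m" for j m
  proof -
    have "real j \<le> 2 ^ m" using of_nat_le_iff[of j "2 ^ m", where 'a = real] that by simp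
    hence "T * real j / 2 ^ m \<le> T * 2 ^ m / 2 ^ m" using T by (intro divide_right_mono mult_left_mono) auto
    thus ?thesis using T by simp
  qed
  have inc_meas [measurable]: "inc m j \<in> borel_measurable M" if "j < 2 ^ m" for m j
    unfolding inc_def using that
    by (intro borel_measurable_abs borel_measurable_diff meas dy_in) auto
  define S where "S \<omega> = (\<Sum>m. \<Sum>j<2 ^ m. ennreal ((inc m j \<omega> / r ^ m) ^ q))" for \<omega>
  have S_meas [measurable]: "S \<in> borel_measurable M"
    unfolding S_def by (intro borel_measurable_suminf_order borel_measurable_sum measurable_compose[OF _ measurable_ennreal] borel_measurable_power borel_measurable_divide inc_meas) auto
  have S_int: "(\<integral>\<^sup>+\<omega>. S \<omega> \<partial>M) \<le> ennreal (C * (T powr (1 + b) / (1 - \<rho>)))"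
  proof -
    have term_le: "(\<integral>\<^sup>+\<omega>. ennreal ((inc m j \<omega> / r ^ m) ^ q) \<partial>M) \<le> ennreal (C * T powr (1 + b) * (\<rho> / 2) ^ m)" if j: "j < 2 ^ m" for m j
    proof -
      have "(\<integral>\<^sup>+\<omega>. ennreal ((inc m j \<omega> / r ^ m) ^ q) \<partial>M) = (\<integral>\<^sup>+\<omega>. ennreal (inverse ((r ^ m) ^ q)) * ennreal (inc m j \<omega> ^ q) \<partial>M)"
        using r by (intro nn_integral_cong) (simp add: power_divide divide_inverse power_mult_distrib power_inverse mult.commute inc_def flip: ennreal_mult)
      also have "\<dots> = ennreal (inverse ((r ^ m) ^ q)) * (\<integral>\<^sup>+\<omega>. ennreal (inc m j \<omega> ^ q) \<partial>M)"
        using j by (intro nn_integral_cmult) measurable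
      also have "\<dots> \<le> ennreal (inverse ((r ^ m) ^ q)) * ennreal (C * \<bar>T * real (Suc j) / 2 ^ m - T * real j / 2 ^ m\<bar> powr (1 + b))"
        unfolding inc_def using j by (intro mult_left_mono mom dy_in) auto
      also have "T * real (Suc j) / 2 ^ m - T * real j / 2 ^ m = T / 2 ^ m"
        by (simp add: diff_divide_distrib[symmetric] algebra_simps)
      also have "\<bar>T / 2 ^ m\<bar> powr (1 + b) = T powr (1 + b) * (2 powr (- (1 + b))) ^ m"
          unfolding powr_minus_divide using T by (simp add: powr_divide power_powr_commute power_divide)
      also have "ennreal (inverse ((r ^ m) ^ q)) * ennreal (C * (T powr (1 + b) * (2 powr (- (1 + b))) ^ m))
          = ennreal (C * T powr (1 + b) * (inverse ((r ^ m) ^ q) * (2 powr (- (1 + b))) ^ m))"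
        using r C by (subst ennreal_mult[symmetric]) (auto simp: mult_ac)
      also have "inverse ((r ^ m) ^ q) * (2 powr (- (1 + b))) ^ m = (\<rho> / 2) ^ m"
      proof -
        have "inverse ((r ^ m) ^ q) = (2 powr (\<gamma> * q)) ^ m"
        proof -
          have rq: "r ^ q = 2 powr (- (\<gamma> * q))"
            unfolding r_def by (simp add: powr_powr flip: powr_realpow)
          have "(r ^ m) ^ q = (r ^ q) ^ m" by (simp add: mult.commute flip: power_mult)
          thus ?thesis unfolding rq by (simp add: powr_minus power_inverse)
        qed
        moreover have "\<rho> / 2 = 2 powr (\<gamma> * q) * 2 powr (- (1 + b))"
          unfolding powr_add[symmetric] \<rho>_def using powr_diff[of 2 "\<gamma> * q - b" 1] by (simp add: algebra_simps)
        ultimately show ?thesis by (simp add: power_mult_distrib)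
      qed
      finally show ?thesis .
    qed
    have "(\<integral>\<^sup>+\<omega>. S \<omega> \<partial>M) = (\<Sum>m. \<Sum>j<2 ^ m. \<integral>\<^sup>+\<omega>. ennreal ((inc m j \<omega> / r ^ m) ^ q) \<partial>M)"
    proof -
      have em: "(\<lambda>\<omega>. ennreal ((inc m j \<omega> / r ^ m) ^ q)) \<in> borel_measurable M" if "j < 2 ^ m" for m j
        using inc_meas[OF that] by measurable
      have "(\<integral>\<^sup>+\<omega>. S \<omega> \<partial>M) = (\<Sum>m. \<integral>\<^sup>+\<omega>. (\<Sum>j<2 ^ m. ennreal ((inc m j \<omega> / r ^ m) ^ q)) \<partial>M)"
        unfolding S_def by (rule nn_integral_suminf[OF borel_measurable_sum]) (use em in auto)
      also have "\<dots> = (\<Sum>m. \<Sum>j<2 ^ m. \<integral>\<^sup>+\<omega>. ennreal ((inc m j \<omega> / r ^ m) ^ q) \<partial>M)"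
        by (intro suminf_cong nn_integral_sum) (use em in auto)
      finally show ?thesis .
    qed
    also have "\<dots> \<le> (\<Sum>m. \<Sum>j<(2::nat) ^ m. ennreal (C * T powr (1 + b) * (\<rho> / 2) ^ m))"
      by (rule suminf_le[OF sum_mono[OF term_le]]) auto
    also have "(\<lambda>m. \<Sum>j<(2::nat) ^ m. ennreal (C * T powr (1 + b) * (\<rho> / 2) ^ m)) = (\<lambda>m. ennreal (C * T powr (1 + b) * \<rho> ^ m))"
    proof
      fix m
      have "(\<Sum>j<(2::nat) ^ m. ennreal (C * T powr (1 + b) * (\<rho> / 2) ^ m)) = ennreal (\<Sum>j<(2::nat) ^ m. C * T powr (1 + b) * (\<rho> / 2) ^ m)"
        using C \<rho> by (intro sum_ennreal) auto
      thus "(\<Sum>j<(2::nat) ^ m. ennreal (C * T powr (1 + b) * (\<rho> / 2) ^ m)) = ennreal (C * T powr (1 + b) * \<rho> ^ m)"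
        by (simp add: power_divide)
    qed
    also have "(\<Sum>m. ennreal (C * T powr (1 + b) * \<rho> ^ m)) = ennreal (\<Sum>m. C * T powr (1 + b) * \<rho> ^ m)"
      using C \<rho> by (intro suminf_ennreal2) (auto intro!: summable_mult summable_geometric)
    also have "(\<Sum>m. C * T powr (1 + b) * \<rho> ^ m) = C * (T powr (1 + b) / (1 - \<rho>))"
      using \<rho> by (subst suminf_mult) (auto simp: suminf_geometric)
    finally show ?thesis .
  qed
  \<comment> \<open>On the null event where S is infinite, L and (below) Y are set to 0, so that the
    Hoelder estimate holds for every omega.\<close>
  define L where "L \<omega> = (if S \<omega> = \<infinity> then 0 else root q (enn2real (S \<omega>)))" for \<omega>
  have L0: "L \<omega> \<ge> 0" for \<omega> using q by (simp add: L_def)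
  have L_meas [measurable]: "L \<in> borel_measurable M" unfolding L_def by measurable
  have inc_L: "inc m j \<omega> \<le> L \<omega> * r ^ m" if fin: "S \<omega> \<noteq> \<infinity>" and j: "j < 2 ^ m" for m j \<omega>
  proof -
    have "ennreal ((inc m j \<omega> / r ^ m) ^ q) \<le> (\<Sum>j<2 ^ m. ennreal ((inc m j \<omega> / r ^ m) ^ q))"
      using j by (intro member_le_sum[where f = "\<lambda>j. ennreal ((inc m j \<omega> / r ^ m) ^ q)"]) auto
    also have "\<dots> \<le> S \<omega>"
      unfolding S_def using sum_le_suminf[OF summableI, of "{m}" "\<lambda>m. \<Sum>j<2 ^ m. ennreal ((inc m j \<omega> / r ^ m) ^ q)"]
      by simp
    finally have "ennreal ((inc m j \<omega> / r ^ m) ^ q) \<le> ennreal (enn2real (S \<omega>))"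
      using fin by (simp add: less_top)
    hence "(inc m j \<omega> / r ^ m) ^ q \<le> enn2real (S \<omega>)" by (simp add: ennreal_le_iff)
    hence "root q ((inc m j \<omega> / r ^ m) ^ q) \<le> L \<omega>" using q fin by (simp add: L_def)
    moreover have "0 \<le> inc m j \<omega> / r ^ m" using r by (simp add: inc_def)
    ultimately have "inc m j \<omega> / r ^ m \<le> L \<omega>" using q by (simp add: real_root_power_cancel)
    thus ?thesis using r by (simp add: divide_le_eq)
  qed
  define Y where "Y t \<omega> = (if S \<omega> = \<infinity> then 0 else lim (\<lambda>n. X (dyadic T n t) \<omega>))" for t \<omega>
  define c where "c = (1 + 2 / (1 - r)) * (2 / T) powr \<gamma>"
  have c: "c \<ge> 0" using r by (simp add: c_def)
  define K where "K \<omega> = c * L \<omega>" for \<omega>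
  have chain: "t \<in> {0..T} \<Longrightarrow> convergent (\<lambda>n. X (dyadic T n t) \<omega>)"
      "s \<in> {0..T} \<Longrightarrow> t \<in> {0..T} \<Longrightarrow> \<bar>t - s\<bar> \<le> T / 2 ^ n \<Longrightarrow> \<bar>Y t \<omega> - Y s \<omega>\<bar> \<le> (1 + 2 / (1 - r)) * L \<omega> * r ^ n"
    if fin: "S \<omega> \<noteq> \<infinity>" for s t n \<omega>
    using dyadic_chaining[OF T r, of "\<lambda>t. X t \<omega>" "L \<omega>"] inc_L[OF fin] fin by (auto simp: inc_def Y_def)
  show ?thesis
  proof (rule that)
    show "Y t \<in> borel_measurable M" if t: "t \<in> {0..T}" for t
    proof -
      have [measurable]: "X (dyadic T n t) \<in> borel_measurable M" for n by (intro meas dyadic_bounds T t)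
      show ?thesis unfolding Y_def by measurable
    qed
    show "K \<in> borel_measurable M" unfolding K_def by measurable
    show "K \<omega> \<ge> 0" for \<omega> using L0 c by (simp add: K_def)
    show "\<bar>Y t \<omega> - Y s \<omega>\<bar> \<le> K \<omega> * \<bar>t - s\<bar> powr \<gamma>" if s: "s \<in> {0..T}" and t: "t \<in> {0..T}" for s t \<omega>
    proof (cases "S \<omega> = \<infinity> \<or> s = t")
      case True
      thus ?thesis using L0 c by (auto simp: Y_def K_def)
    next
      case False
      obtain n where n: "\<bar>t - s\<bar> \<le> T / 2 ^ n" "T / 2 ^ n < 2 * \<bar>t - s\<bar>"
        by (rule dyadic_scale[of "\<bar>t - s\<bar>" T]) (use s t False in auto)
      have "r ^ n = 1 / (2 powr \<gamma>) ^ n" by (simp add: r_def powr_minus_divide power_divide)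
      also have "\<dots> = (1 / 2 ^ n) powr \<gamma>"
        by (simp only: powr_divide power_powr_commute powr_one_eq_one zero_less_numeral)
      \<comment> \<open>The level n was chosen so that the mesh is comparable to |t - s|; this turns
        r^n = (2^(-n))^gamma into a power of |t - s|.\<close>
      also have "1 / 2 ^ n \<le> 2 / T * \<bar>t - s\<bar>" using n T by (simp add: field_simps)
      hence "(1 / 2 ^ n) powr \<gamma> \<le> (2 / T * \<bar>t - s\<bar>) powr \<gamma>" using \<gamma> by (intro powr_mono2) auto
      also have "\<dots> = (2 / T) powr \<gamma> * \<bar>t - s\<bar> powr \<gamma>" by (rule powr_mult)
      finally have rn: "r ^ n \<le> (2 / T) powr \<gamma> * \<bar>t - s\<bar> powr \<gamma>" .
      have "\<bar>Y t \<omega> - Y s \<omega>\<bar> \<le> (1 + 2 / (1 - r)) * L \<omega> * r ^ n"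
        using chain(2)[OF _ s t n(1)] False by auto
      also have "\<dots> \<le> (1 + 2 / (1 - r)) * L \<omega> * ((2 / T) powr \<gamma> * \<bar>t - s\<bar> powr \<gamma>)"
        using rn L0 r by (intro mult_left_mono) auto
      finally show ?thesis by (simp add: K_def c_def mult_ac)
    qed
    have "(\<integral>\<^sup>+\<omega>. S \<omega> \<partial>M) \<noteq> \<infinity>" using S_int by (auto simp: top_unique)
    hence fin: "AE \<omega> in M. S \<omega> \<noteq> \<infinity>" by (intro nn_integral_PInf_AE) auto
    have L_pow: "ennreal (L \<omega> ^ q) \<le> S \<omega>" for \<omega>
      using q by (cases "S \<omega> = \<infinity>") (auto simp: L_def less_top)
    show "(\<integral>\<^sup>+\<omega>. ennreal (K \<omega> ^ q) \<partial>M) \<le> ennreal (C * kolmogorov_const T \<gamma> b q)"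
    proof -
      have "(\<integral>\<^sup>+\<omega>. ennreal (K \<omega> ^ q) \<partial>M) \<le> (\<integral>\<^sup>+\<omega>. ennreal (c ^ q) * S \<omega> \<partial>M)"
      proof (rule nn_integral_mono)
        fix \<omega>
        have "ennreal (K \<omega> ^ q) = ennreal (c ^ q) * ennreal (L \<omega> ^ q)"
          using c L0 by (simp add: K_def power_mult_distrib ennreal_mult)
        also have "\<dots> \<le> ennreal (c ^ q) * S \<omega>" by (intro mult_left_mono L_pow) auto
        finally show "ennreal (K \<omega> ^ q) \<le> ennreal (c ^ q) * S \<omega>" .
      qed
      also have "\<dots> = ennreal (c ^ q) * (\<integral>\<^sup>+\<omega>. S \<omega> \<partial>M)" by (rule nn_integral_cmult) measurable
      also have "\<dots> \<le> ennreal (c ^ q) * ennreal (C * (T powr (1 + b) / (1 - \<rho>)))" by (intro mult_left_mono S_int) auto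
      also have "\<dots> = ennreal (C * kolmogorov_const T \<gamma> b q)"
        using c C \<rho> by (subst ennreal_mult[symmetric]) (auto simp: kolmogorov_const_def c_def r_def \<rho>_def mult_ac)
      finally show ?thesis .
    qed
    show "AE \<omega> in M. Y t \<omega> = X t \<omega>" if t: "t \<in> {0..T}" for t
    proof -
      \<comment> \<open>The q-th moments of X(dyadic time) - X t decay like 2^(-n), since 1 + b > 1.
        Their sum is finite, so the differences tend to 0 almost surely, and the limit Y t is X
        t.\<close>
      define d where "d n \<omega> = ennreal (\<bar>X (dyadic T n t) \<omega> - X t \<omega>\<bar> ^ q)" for n \<omega>
      have "0 \<le> \<gamma> * real q" using \<gamma> by simp
      hence b: "b > 0" using \<gamma>(2) by linarith
      have d_le: "(\<integral>\<^sup>+\<omega>. d n \<omega> \<partial>M) \<le> ennreal (C * T powr (1 + b) * (1 / 2) ^ n)" for n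
      proof -
        have "(\<integral>\<^sup>+\<omega>. d n \<omega> \<partial>M) \<le> ennreal (C * \<bar>dyadic T n t - t\<bar> powr (1 + b))"
          unfolding d_def by (intro mom dyadic_bounds T t)
        also have "\<dots> \<le> ennreal (C * (T / 2 ^ n) powr (1 + b))"
          using C b by (intro ennreal_leI mult_left_mono powr_mono2 dyadic_bounds T t) auto
        also have "(T / 2 ^ n) powr (1 + b) = T powr (1 + b) * (1 / 2 ^ n) powr (1 + b)"
          using powr_mult[of T "1 / 2 ^ n" "1 + b"] by simp
        also have "ennreal (C * (T powr (1 + b) * (1 / 2 ^ n) powr (1 + b))) \<le> ennreal (C * T powr (1 + b) * (1 / 2) ^ n)"
        proof (rule ennreal_leI)
          have "(1 / 2 ^ n :: real) powr (1 + b) \<le> (1 / 2 ^ n) powr 1"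
            using b by (intro powr_mono') (auto simp: divide_le_eq)
          hence "C * (T powr (1 + b) * (1 / 2 ^ n) powr (1 + b)) \<le> C * (T powr (1 + b) * (1 / 2 ^ n) powr 1)"
            using C by (intro mult_left_mono) auto
          thus "C * (T powr (1 + b) * (1 / 2 ^ n) powr (1 + b)) \<le> C * T powr (1 + b) * (1 / 2) ^ n"
            by (simp add: power_one_over)
        qed
        finally show ?thesis .
      qed
      have dm: "d n \<in> borel_measurable M" for n
        unfolding d_def by (intro measurable_compose[OF _ measurable_ennreal] borel_measurable_power
          borel_measurable_abs borel_measurable_diff meas dyadic_bounds(1) T t)
      have "(\<integral>\<^sup>+\<omega>. (\<Sum>n. d n \<omega>) \<partial>M) = (\<Sum>n. \<integral>\<^sup>+\<omega>. d n \<omega> \<partial>M)" by (rule nn_integral_suminf[OF dm])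
      also have "\<dots> \<le> (\<Sum>n. ennreal (C * T powr (1 + b) * (1 / 2) ^ n))" by (rule suminf_le[OF d_le]) auto
      also have "\<dots> = ennreal (\<Sum>n. C * T powr (1 + b) * (1 / 2) ^ n)"
        using C by (intro suminf_ennreal2) (auto intro!: summable_mult summable_geometric)
      also have "\<dots> < \<infinity>" by simp
      finally have "AE \<omega> in M. (\<Sum>n. d n \<omega>) \<noteq> \<infinity>" by (intro nn_integral_PInf_AE borel_measurable_suminf_order dm) auto
      with fin show ?thesis
      proof eventually_elim
        case (elim \<omega>)
        have "summable (\<lambda>n. \<bar>X (dyadic T n t) \<omega> - X t \<omega>\<bar> ^ q)"
          using elim(2) unfolding d_def by (intro summable_suminf_not_top) auto
        hence "(\<lambda>n. root q (\<bar>X (dyadic T n t) \<omega> - X t \<omega>\<bar> ^ q)) \<longlonglongrightarrow> root q 0"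
          by (intro tendsto_intros summable_LIMSEQ_zero)
        hence "(\<lambda>n. \<bar>X (dyadic T n t) \<omega> - X t \<omega>\<bar>) \<longlonglongrightarrow> 0" using q by (simp add: real_root_power_cancel)
        hence "(\<lambda>n. X (dyadic T n t) \<omega>) \<longlonglongrightarrow> X t \<omega>"
          by (simp add: tendsto_rabs_zero_iff LIM_zero_iff)
        thus ?case using elim(1) by (simp add: Y_def limI)
      qed
    qed
  qed
qed

section \<open>Step functions and the covariance of the noise\<close>

text \<open>The eighth moment of a standard normal variable is 7 * 5 * 3 * 1 = 105, and a variance
  s^2 scales it by (s^2)^4. The degenerate case obeys the same formula with both sides 0.\<close>

lemma (in prob_space) centered_gaussian_moments:
  assumes X: "centered_gaussian M X"
  shows "integrable M (\<lambda>\<omega>. (X \<omega>)\<^sup>2)"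
    and "(\<integral>\<^sup>+\<omega>. ennreal (\<bar>X \<omega>\<bar> ^ 8) \<partial>M) = ennreal (105 * (\<integral>\<omega>. (X \<omega>)\<^sup>2 \<partial>M) ^ 4)"
proof -
  have m [measurable]: "X \<in> borel_measurable M" using X by (simp add: centered_gaussian_def)
  have "integrable M (\<lambda>\<omega>. (X \<omega>)\<^sup>2) \<and> (\<integral>\<^sup>+\<omega>. ennreal (\<bar>X \<omega>\<bar> ^ 8) \<partial>M) = ennreal (105 * (\<integral>\<omega>. (X \<omega>)\<^sup>2 \<partial>M) ^ 4)"
  proof (cases "AE \<omega> in M. X \<omega> = 0")
    case True
    have "AE \<omega> in M. (X \<omega>)\<^sup>2 = 0" using True by eventually_elim simp
    hence "integrable M (\<lambda>\<omega>. (X \<omega>)\<^sup>2)" "(\<integral>\<omega>. (X \<omega>)\<^sup>2 \<partial>M) = 0"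
      by (auto intro: integrable_cong_AE_imp[where g = "\<lambda>_. 0"] simp: integral_eq_zero_AE)
    moreover have "(\<integral>\<^sup>+\<omega>. ennreal (\<bar>X \<omega>\<bar> ^ 8) \<partial>M) = 0"
      by (subst nn_integral_0_iff_AE) (use True in \<open>auto elim!: eventually_mono\<close>)
    ultimately show ?thesis by simp
  next
    case False
    then obtain s where s: "s > 0" and D: "distributed M lborel X (normal_density 0 s)"
      using X by (auto simp: centered_gaussian_def)
    have ev: "has_bochner_integral lborel (\<lambda>x. normal_density 0 s x * x ^ (2 * k)) (fact (2 * k) / ((2 / s\<^sup>2) ^ k * fact k))" for k
      using normal_moment_even[OF s, of 0 k] by simp
    have i: "integrable M (\<lambda>\<omega>. X \<omega> ^ (2 * k))" "(\<integral>\<omega>. X \<omega> ^ (2 * k) \<partial>M) = fact (2 * k) / ((2 / s\<^sup>2) ^ k * fact k)" for k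
      using distributed_integrable[OF D, of "\<lambda>x. x ^ (2 * k)"] distributed_integral[OF D, of "\<lambda>x. x ^ (2 * k)"] ev[of k]
      by (auto simp: has_bochner_integral_iff)
    have "(\<integral>\<omega>. (X \<omega>)\<^sup>2 \<partial>M) = s\<^sup>2" using i(2)[of 1] by simp
    moreover have "(\<integral>\<omega>. X \<omega> ^ 8 \<partial>M) = 105 * (s\<^sup>2) ^ 4" using i(2)[of 4] by (simp add: fact_numeral power_divide)
    moreover have "(\<integral>\<^sup>+\<omega>. ennreal (\<bar>X \<omega>\<bar> ^ 8) \<partial>M) = ennreal (\<integral>\<omega>. X \<omega> ^ 8 \<partial>M)"
      using i(1)[of 4] by (subst nn_integral_eq_integral[symmetric]) (auto simp: power_even_abs)
    ultimately show ?thesis using i(1)[of 1] by simp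
  qed
  thus "integrable M (\<lambda>\<omega>. (X \<omega>)\<^sup>2)"
    "(\<integral>\<^sup>+\<omega>. ennreal (\<bar>X \<omega>\<bar> ^ 8) \<partial>M) = ennreal (105 * (\<integral>\<omega>. (X \<omega>)\<^sup>2 \<partial>M) ^ 4)" by auto
qed

lemma integrable_mult_of_squares:
  fixes X Y :: "'a \<Rightarrow> real"
  assumes [measurable]: "X \<in> borel_measurable M" "Y \<in> borel_measurable M"
    and "integrable M (\<lambda>\<omega>. (X \<omega>)\<^sup>2)" "integrable M (\<lambda>\<omega>. (Y \<omega>)\<^sup>2)"
  shows "integrable M (\<lambda>\<omega>. X \<omega> * Y \<omega>)"
proof (rule Bochner_Integration.integrable_bound)
  show "integrable M (\<lambda>\<omega>. (X \<omega>)\<^sup>2 + (Y \<omega>)\<^sup>2)" using assms by (intro Bochner_Integration.integrable_add)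
  have "\<bar>X \<omega> * Y \<omega>\<bar> \<le> (X \<omega>)\<^sup>2 + (Y \<omega>)\<^sup>2" for \<omega>
    using sum_squares_bound[of "\<bar>X \<omega>\<bar>" "\<bar>Y \<omega>\<bar>"] abs_ge_zero[of "X \<omega> * Y \<omega>"]
    unfolding abs_mult power2_abs by linarith
  thus "AE \<omega> in M. norm (X \<omega> * Y \<omega>) \<le> norm ((X \<omega>)\<^sup>2 + (Y \<omega>)\<^sup>2)" by simp
qed simp

lemma integrable_add_square:
  fixes X Y :: "'a \<Rightarrow> real"
  assumes [measurable]: "X \<in> borel_measurable M" "Y \<in> borel_measurable M"
    and "integrable M (\<lambda>\<omega>. (X \<omega>)\<^sup>2)" "integrable M (\<lambda>\<omega>. (Y \<omega>)\<^sup>2)"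
  shows "integrable M (\<lambda>\<omega>. (X \<omega> + c * Y \<omega>)\<^sup>2)"
proof -
  have "integrable M (\<lambda>\<omega>. (X \<omega>)\<^sup>2 + (2 * c) * (X \<omega> * Y \<omega>) + c\<^sup>2 * (Y \<omega>)\<^sup>2)"
    using assms integrable_mult_of_squares[OF assms]
    by (intro Bochner_Integration.integrable_add integrable_mult_right)
  moreover have "(X \<omega> + c * Y \<omega>)\<^sup>2 = (X \<omega>)\<^sup>2 + (2 * c) * (X \<omega> * Y \<omega>) + c\<^sup>2 * (Y \<omega>)\<^sup>2" for \<omega>
    by (simp add: power2_eq_square algebra_simps)
  ultimately show ?thesis by (simp only:)
qed

section \<open>Linear operations on formal step functions\<close>

lemma step_noise_simps [simp]:
  "step_noise W [] \<omega> = 0"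
  "step_noise W ((c, U, t) # \<phi>) \<omega> = c * W U t \<omega> + step_noise W \<phi> \<omega>"
  "step_noise W (\<phi> @ \<psi>) \<omega> = step_noise W \<phi> \<omega> + step_noise W \<psi> \<omega>"
  by (simp_all add: step_noise_def)

lemma step_fun_simps [simp]:
  "step_fun [] z = 0"
  "step_fun ((c, U, t) # \<phi>) z = c * indicator (U \<times> {0..t}) z + step_fun \<phi> z"
  "step_fun (\<phi> @ \<psi>) z = step_fun \<phi> z + step_fun \<psi> z"
  by (simp_all add: step_fun_def)

lemma is_step_simps [simp]:
  "is_step T []"
  "is_step T ((c, U, t) # \<phi>) \<longleftrightarrow> U \<in> sets borel \<and> U \<subseteq> D \<and> t \<in> {0..T} \<and> is_step T \<phi>"
  "is_step T (\<phi> @ \<psi>) \<longleftrightarrow> is_step T \<phi> \<and> is_step T \<psi>"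
  by (simp_all add: is_step_def ball_Un)

definition step_scale :: "real \<Rightarrow> step \<Rightarrow> step" where
  "step_scale a \<phi> = map (\<lambda>(c, U, t). (a * c, U, t)) \<phi>"

lemma step_scale_simps [simp]:
  "step_noise W (step_scale a \<phi>) \<omega> = a * step_noise W \<phi> \<omega>"
  "step_fun (step_scale a \<phi>) z = a * step_fun \<phi> z"
  "is_step T (step_scale a \<phi>) \<longleftrightarrow> is_step T \<phi>"
proof -
  show "step_noise W (step_scale a \<phi>) \<omega> = a * step_noise W \<phi> \<omega>"
    by (induction \<phi>) (auto simp: step_scale_def algebra_simps)
  show "step_fun (step_scale a \<phi>) z = a * step_fun \<phi> z"
    by (induction \<phi>) (auto simp: step_scale_def algebra_simps)
  show "is_step T (step_scale a \<phi>) \<longleftrightarrow> is_step T \<phi>"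
    by (induction \<phi>) (auto simp: step_scale_def)
qed

lemma sets_borel_rectangle [measurable]: "D \<times> {0..T} \<in> sets (borel :: (real \<times> real) measure)"
  by (intro borel_closed closed_Times) auto

lemma borel_measurable_step_fun:
  assumes "is_step T \<phi>"
  shows "step_fun \<phi> \<in> borel_measurable borel"
  using assms
proof (induction \<phi>)
  case (Cons a \<phi>)
  obtain c U t where a: "a = (c, U, t)" by (cases a) auto
  have "U \<times> {0..t} \<in> sets (borel \<Otimes>\<^sub>M borel)" using Cons.prems unfolding a by auto
  hence [measurable]: "U \<times> {0..t} \<in> sets (borel :: (real \<times> real) measure)" by (simp only: borel_prod)
  have [measurable]: "step_fun \<phi> \<in> borel_measurable borel" using Cons unfolding a by simp
  have "(\<lambda>z. c * indicator (U \<times> {0..t}) z + step_fun \<phi> z) \<in> borel_measurable borel" by measurable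
  thus ?case unfolding a by simp
qed (simp add: step_fun_def [abs_def])

text \<open>\<open>w\<close> is the derivative of r -> (r^(2H) - |r - s|^(2H))/2. The exponent 2H -
  1 is positive, so \<open>w\<close> stays bounded; its integral over [0, t] is the time factor of
  the noise covariance.\<close>

lemma fractional_kernel:
  fixes H s t T :: real
  assumes H: "1 / 2 < H" and s: "s \<in> {0..T}" and t: "t \<in> {0..T}"
  defines "w \<equiv> \<lambda>r. H * (r powr (2 * H - 1) + sgn (r - s) * - (\<bar>r - s\<bar> powr (2 * H - 1)))"
  shows "w \<in> borel_measurable borel" "r \<in> {0..T} \<Longrightarrow> \<bar>w r\<bar> \<le> 2 * H * T powr (2 * H - 1)"
    "(LINT r:{0..t}|lborel. w r) = (t powr (2 * H) + s powr (2 * H) - \<bar>t - s\<bar> powr (2 * H)) / 2"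
proof -
  show m: "w \<in> borel_measurable borel" unfolding w_def sgn_real_def by measurable
  show b: "\<bar>w r\<bar> \<le> 2 * H * T powr (2 * H - 1)" if r: "r \<in> {0..T}" for r
  proof -
    have 1: "r powr (2 * H - 1) \<le> T powr (2 * H - 1)" using H r by (intro powr_mono2) auto
    have 2: "\<bar>r - s\<bar> powr (2 * H - 1) \<le> T powr (2 * H - 1)" using H r s by (intro powr_mono2) auto
    have "\<bar>r powr (2 * H - 1) + sgn (r - s) * - (\<bar>r - s\<bar> powr (2 * H - 1))\<bar>
        \<le> \<bar>r powr (2 * H - 1)\<bar> + \<bar>sgn (r - s)\<bar> * \<bar>- (\<bar>r - s\<bar> powr (2 * H - 1))\<bar>"
      unfolding abs_mult[symmetric] by (rule abs_triangle_ineq)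
    also have "\<dots> \<le> T powr (2 * H - 1) + 1 * T powr (2 * H - 1)"
      using 1 2 by (intro add_mono mult_mono) (auto simp: sgn_real_def)
    finally show ?thesis using H unfolding w_def abs_mult by (simp add: mult_left_mono)
  qed
  have int: "set_integrable lborel {0..t} w"
    unfolding set_integrable_def
  proof (rule integrableI_bounded_set_indicator[where B = "2 * H * T powr (2 * H - 1)"])
    show "AE x in lborel. x \<in> {0..t} \<longrightarrow> norm (w x) \<le> 2 * H * T powr (2 * H - 1)" using b t by auto
  qed (use m t in \<open>auto simp: emeasure_lborel_Icc_eq\<close>)
  define F where "F r = (r powr (2 * H) - \<bar>r - s\<bar> powr (2 * H)) / 2" for r
  have "(w has_integral F t - F 0) {0..t}"
  proof (rule fundamental_theorem_of_calculus_interior_strong[where S = "{s}"])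
    show "continuous_on {0..t} F"
      unfolding F_def using H by (intro continuous_intros continuous_on_powr') auto
    \<comment> \<open>The point r = s is exempt, so r - s has constant sign near r and the absolute
      value in F can be resolved.\<close>
    fix r assume r: "r \<in> {0<..<t} - {s}"
    have "(F has_real_derivative w r) (at r)"
    proof (cases "r > s")
      case True
      have "((\<lambda>r. (r powr (2 * H) - (r - s) powr (2 * H)) / 2) has_real_derivative w r) (at r)"
        using r True by (auto intro!: derivative_eq_intros simp: w_def sgn_real_def field_simps)
      moreover have "\<forall>\<^sub>F r in nhds r. F r = (r powr (2 * H) - (r - s) powr (2 * H)) / 2"
        using eventually_nhds_in_open[of "{s<..}" r] True by (auto elim!: eventually_mono simp: F_def)
      ultimately show ?thesis by (subst DERIV_cong_ev[OF refl _ refl])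
    next
      case False
      hence rs: "r < s" using r by auto
      have "((\<lambda>r. (r powr (2 * H) - (s - r) powr (2 * H)) / 2) has_real_derivative w r) (at r)"
        using r rs by (auto intro!: derivative_eq_intros simp: w_def sgn_real_def field_simps)
      moreover have "\<forall>\<^sub>F r in nhds r. F r = (r powr (2 * H) - (s - r) powr (2 * H)) / 2"
        using eventually_nhds_in_open[of "{..<s}" r] rs by (auto elim!: eventually_mono simp: F_def)
      ultimately show ?thesis by (subst DERIV_cong_ev[OF refl _ refl])
    qed
    thus "(F has_vector_derivative w r) (at r)" by (simp add: has_real_derivative_iff_has_vector_derivative)
  qed (use t in auto)
  hence "(LINT r:{0..t}|lborel. w r) = F t - F 0"
    using set_borel_integral_eq_integral(2)[OF int] by (simp add: integral_unique)
  thus "(LINT r:{0..t}|lborel. w r) = (t powr (2 * H) + s powr (2 * H) - \<bar>t - s\<bar> powr (2 * H)) / 2"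
    using s by (simp add: F_def)
qed

text \<open>For \<open>H > 1/2\<close> pairing with an indicator is integration against a bounded kernel.\<close>

lemma step_inner_L1_bound:
  fixes H T :: real
  assumes H: "1 / 2 < H" and T: "T > 0" and V: "V \<in> sets borel" "V \<subseteq> D" and s: "s \<in> {0..T}" and \<phi>: "is_step T \<phi>"
  shows "ennreal \<bar>\<Sum>(c, U, t) \<leftarrow> \<phi>. c * noise_cov H U t V s\<bar>
    \<le> ennreal (2 * H * T powr (2 * H - 1)) * (\<integral>\<^sup>+z. ennreal (indicator (D \<times> {0..T}) z * \<bar>step_fun \<phi> z\<bar>) \<partial>lborel)"
proof -
  define w where "w r = H * (r powr (2 * H - 1) + sgn (r - s) * - (\<bar>r - s\<bar> powr (2 * H - 1)))" for r
  define C where "C = 2 * H * T powr (2 * H - 1)"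
  note k = fractional_kernel[OF H s, folded w_def]
  have [measurable]: "w \<in> borel_measurable borel" using k(1)[OF s] by (simp add: w_def [abs_def])
  have wC: "\<bar>w r\<bar> \<le> C" if "r \<in> {0..T}" for r using k(2)[OF s that] by (simp add: w_def C_def)
  have wI: "(LINT r:{0..t}|lborel. w r) = (t powr (2 * H) + s powr (2 * H) - \<bar>t - s\<bar> powr (2 * H)) / 2" if "t \<in> {0..T}" for t
    using k(3)[OF that] by (simp add: w_def [abs_def])
  \<comment> \<open>By Fubini, the indicator of U x [0, t] integrated against this kernel is m(U
    \<inter> V) times the integral of w over [0, t], which is the covariance.\<close>
  define g where "g z = indicator V (fst z) * w (snd z)" for z :: "real \<times> real"
  have [measurable]: "V \<in> sets borel" by (fact V)
  have main: "integrable (lborel \<Otimes>\<^sub>M lborel) (\<lambda>z. step_fun \<phi> z * g z) \<and>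
      (LINT z|(lborel \<Otimes>\<^sub>M lborel). step_fun \<phi> z * g z) = (\<Sum>(c, U, t) \<leftarrow> \<phi>. c * noise_cov H U t V s)"
    using \<phi>
  proof (induction \<phi>)
    case (Cons a \<phi>)
    obtain c U t where a: "a = (c, U, t)" by (cases a) auto
    have U: "U \<in> sets borel" "U \<subseteq> D" and t: "t \<in> {0..T}" and \<phi>: "is_step T \<phi>" using Cons.prems by (auto simp: a)
    have [measurable]: "U \<in> sets borel" by (fact U)
    note IH = Cons.IH[OF \<phi>]
    have fin: "emeasure lborel (U \<inter> V) < \<infinity>"
    proof -
      have "emeasure lborel (U \<inter> V) \<le> emeasure lborel D" by (intro emeasure_mono) (use U in auto)
      also have "\<dots> < \<infinity>" by simp
      finally show ?thesis .
    qed
    have eq: "indicator (U \<times> {0..t}) z * g z = indicator (U \<inter> V) (fst z) * (indicator {0..t} (snd z) * w (snd z))" for z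
      by (cases z) (auto simp: g_def indicator_def)
    have ii: "integrable (lborel \<Otimes>\<^sub>M lborel) (\<lambda>z. indicator (U \<times> {0..t}) z * g z)"
    proof -
      have "integrable (lborel \<Otimes>\<^sub>M lborel) (\<lambda>z. indicator ((U \<inter> V) \<times> {0..t}) z *\<^sub>R w (snd z))"
      proof (rule integrableI_bounded_set_indicator[where B = C])
        show "emeasure (lborel \<Otimes>\<^sub>M lborel) ((U \<inter> V) \<times> {0..t}) < \<infinity>"
          using fin by (subst lborel.emeasure_pair_measure_Times) (auto simp: ennreal_mult_less_top emeasure_lborel_Icc_eq)
        show "AE z in lborel \<Otimes>\<^sub>M lborel. z \<in> (U \<inter> V) \<times> {0..t} \<longrightarrow> norm (w (snd z)) \<le> C"
          using wC t by auto
      qed auto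
      moreover have "indicator ((U \<inter> V) \<times> {0..t}) z *\<^sub>R w (snd z) = indicator (U \<times> {0..t}) z * g z" for z
        by (cases z) (auto simp: g_def indicator_def)
      ultimately show ?thesis by (simp only:)
    qed
    have vi: "(LINT z|(lborel \<Otimes>\<^sub>M lborel). indicator (U \<times> {0..t}) z * g z) = noise_cov H U t V s"
    proof -
      have "(LINT z|(lborel \<Otimes>\<^sub>M lborel). indicator (U \<times> {0..t}) z * g z)
          = (LINT y|lborel. LINT r|lborel. indicator (U \<inter> V) y * (indicator {0..t} r * w r))"
        using lborel_pair.integral_fst'[OF ii] by (simp add: eq)
      also have "\<dots> = measure lborel (U \<inter> V) * (LINT r:{0..t}|lborel. w r)"
        by (simp add: set_lebesgue_integral_def)
      finally show ?thesis using wI[OF t] by (simp add: noise_cov_def)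
    qed
    show ?case using ii vi IH by (simp add: a distrib_right mult.assoc)
  qed simp
  have "ennreal \<bar>LINT z|(lborel \<Otimes>\<^sub>M lborel). step_fun \<phi> z * g z\<bar> \<le> (\<integral>\<^sup>+z. ennreal \<bar>step_fun \<phi> z * g z\<bar> \<partial>(lborel \<Otimes>\<^sub>M lborel))"
    using integral_norm_bound_ennreal[of "lborel \<Otimes>\<^sub>M lborel" "\<lambda>z. step_fun \<phi> z * g z"] main by simp
  also have "\<dots> \<le> (\<integral>\<^sup>+z. ennreal C * ennreal (indicator (D \<times> {0..T}) z * \<bar>step_fun \<phi> z\<bar>) \<partial>(lborel \<Otimes>\<^sub>M lborel))"
  proof (rule nn_integral_mono)
    fix z :: "real \<times> real"
    have "\<bar>step_fun \<phi> z * g z\<bar> \<le> C * (indicator (D \<times> {0..T}) z * \<bar>step_fun \<phi> z\<bar>)"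
    proof (cases "z \<in> D \<times> {0..T}")
      case True
      have "\<bar>g z\<bar> \<le> C" using True wC[of "snd z"] by (auto simp: g_def indicator_def)
      from mult_left_mono[OF this, of "\<bar>step_fun \<phi> z\<bar>"] True show ?thesis by (simp add: abs_mult mult.commute)
    next
      case False
      have "step_fun \<phi> z = 0" using \<phi> False
      proof (induction \<phi>)
        case (Cons a \<phi>)
        obtain c U t where a: "a = (c, U, t)" by (cases a) auto
        show ?case using Cons unfolding a by (cases z) (auto simp: indicator_def)
      qed simp
      thus ?thesis by simp
    qed
    thus "ennreal \<bar>step_fun \<phi> z * g z\<bar> \<le> ennreal C * ennreal (indicator (D \<times> {0..T}) z * \<bar>step_fun \<phi> z\<bar>)"
      using H by (simp add: C_def ennreal_leI flip: ennreal_mult)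
  qed
  also have "\<dots> = ennreal C * (\<integral>\<^sup>+z. ennreal (indicator (D \<times> {0..T}) z * \<bar>step_fun \<phi> z\<bar>) \<partial>(lborel \<Otimes>\<^sub>M lborel))"
  proof (rule nn_integral_cmult)
    have [measurable]: "step_fun \<phi> \<in> borel_measurable borel" by (rule borel_measurable_step_fun[OF \<phi>])
    have "(\<lambda>z. ennreal (indicator (D \<times> {0..T}) z * \<bar>step_fun \<phi> z\<bar>)) \<in> borel_measurable borel" by measurable
    thus "(\<lambda>z. ennreal (indicator (D \<times> {0..T}) z * \<bar>step_fun \<phi> z\<bar>)) \<in> borel_measurable (lborel \<Otimes>\<^sub>M lborel)" by (simp add: lborel_prod)
  qed
  finally show ?thesis using main by (simp add: lborel_prod C_def)
qed

section \<open>The Wiener integral\<close>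

locale fractional_noise_space = prob_space M for M :: "'a measure" +
  fixes T H :: real and W :: "real set \<Rightarrow> real \<Rightarrow> 'a \<Rightarrow> real"
  assumes T_pos: "T > 0" and H_gt: "1 / 2 < H" and H_lt: "H < 1"
    and noise: "fractional_noise M H T W"
begin

abbreviation N :: "step \<Rightarrow> 'a \<Rightarrow> real" where "N \<equiv> step_noise W"
abbreviation Q :: "(real \<times> real) set" where "Q \<equiv> D \<times> {0..T}"

lemma gaussian_step: "is_step T \<phi> \<Longrightarrow> centered_gaussian M (N \<phi>)"
  using noise by (simp add: fractional_noise_def)

lemma N_meas: "is_step T \<phi> \<Longrightarrow> N \<phi> \<in> borel_measurable M"
  using gaussian_step by (auto simp: centered_gaussian_def)

lemma N_square_integrable: "is_step T \<phi> \<Longrightarrow> integrable M (\<lambda>\<omega>. (N \<phi> \<omega>)\<^sup>2)"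
  by (rule centered_gaussian_moments[OF gaussian_step])

lemma N_mult_integrable: "is_step T \<phi> \<Longrightarrow> is_step T \<psi> \<Longrightarrow> integrable M (\<lambda>\<omega>. N \<phi> \<omega> * N \<psi> \<omega>)"
  by (intro integrable_mult_of_squares N_meas N_square_integrable)

lemma expectation_W_W:
  assumes "U \<in> sets borel" "U \<subseteq> D" "t \<in> {0..T}" "V \<in> sets borel" "V \<subseteq> D" "s \<in> {0..T}"
  shows "(\<integral>\<omega>. W U t \<omega> * W V s \<omega> \<partial>M) = noise_cov H U t V s"
  using noise assms by (simp add: fractional_noise_def)

lemma expectation_N_W:
  assumes \<phi>: "is_step T \<phi>" and V: "V \<in> sets borel" "V \<subseteq> D" "s \<in> {0..T}"
  shows "(\<integral>\<omega>. N \<phi> \<omega> * W V s \<omega> \<partial>M) = (\<Sum>(c, U, t) \<leftarrow> \<phi>. c * noise_cov H U t V s)"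
  using \<phi>
proof (induction \<phi>)
  case (Cons a \<phi>)
  obtain c U t where a: "a = (c, U, t)" by (cases a) auto
  have U: "is_step T [(1, U, t)]" and V': "is_step T [(1, V, s)]" and \<phi>: "is_step T \<phi>"
    using Cons.prems V by (auto simp: a)
  have i: "integrable M (\<lambda>\<omega>. W U t \<omega> * W V s \<omega>)" "integrable M (\<lambda>\<omega>. N \<phi> \<omega> * W V s \<omega>)"
    using N_mult_integrable[OF U V'] N_mult_integrable[OF \<phi> V'] by simp_all
  have "(\<integral>\<omega>. N (a # \<phi>) \<omega> * W V s \<omega> \<partial>M) = (\<integral>\<omega>. c * (W U t \<omega> * W V s \<omega>) + N \<phi> \<omega> * W V s \<omega> \<partial>M)"
    by (simp add: a distrib_right mult.assoc)
  also have "\<dots> = c * noise_cov H U t V s + (\<integral>\<omega>. N \<phi> \<omega> * W V s \<omega> \<partial>M)"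
    using i V Cons.prems by (subst Bochner_Integration.integral_add) (auto simp: a expectation_W_W)
  finally show ?case using Cons.IH[OF \<phi>] by (simp add: a)
qed simp

text \<open>With values in \<open>ennreal\<close> the distance makes sense for every pair of
  measurable integrands; integrability is deduced afterwards from finiteness.\<close>

definition L1_dist :: "(real \<times> real \<Rightarrow> real) \<Rightarrow> (real \<times> real \<Rightarrow> real) \<Rightarrow> ennreal" where
  "L1_dist \<phi> \<psi> = (\<integral>\<^sup>+z. ennreal \<bar>indicator Q z * \<phi> z - indicator Q z * \<psi> z\<bar> \<partial>lborel)"

text \<open>This is the square of the L2 distance, hence the factors 2 in its triangle
  inequality.\<close>

definition L2_dist :: "('a \<Rightarrow> real) \<Rightarrow> ('a \<Rightarrow> real) \<Rightarrow> ennreal" where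
  "L2_dist X Y = (\<integral>\<^sup>+\<omega>. ennreal ((X \<omega> - Y \<omega>)\<^sup>2) \<partial>M)"

text \<open>Integrands matter on the rectangle only, so measurability is asked of their extension by
  zero.\<close>

definition Q_meas :: "(real \<times> real \<Rightarrow> real) \<Rightarrow> bool" where
  "Q_meas \<phi> \<longleftrightarrow> (\<lambda>z. indicator Q z * \<phi> z) \<in> borel_measurable borel"

text \<open>The closure in \<open>L\<^sup>1(D \<times> [0,T]) \<times> L\<^sup>2(\<Omega>)\<close> of the graph of the noise on step functions. It is the
  graph of a function by \<open>wiener_unique\<close> below.\<close>

definition wiener :: "(real \<times> real \<Rightarrow> real) \<Rightarrow> ('a \<Rightarrow> real) \<Rightarrow> bool" where
  "wiener \<phi> X \<longleftrightarrow> X \<in> borel_measurable M \<and> Q_meas \<phi> \<and>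
     (\<forall>e>0. \<exists>S. is_step T S \<and> L1_dist (step_fun S) \<phi> < ennreal e \<and> L2_dist (N S) X < ennreal e)"

lemma Q_meas_step: "is_step T S \<Longrightarrow> Q_meas (step_fun S)"
  using borel_measurable_step_fun[of T S] unfolding Q_meas_def by (intro borel_measurable_times) simp_all

lemma Q_meas_borel: "\<phi> \<in> borel_measurable borel \<Longrightarrow> Q_meas \<phi>"
  unfolding Q_meas_def by (intro borel_measurable_times) simp_all

lemma L1_triangle:
  assumes "Q_meas \<phi>" "Q_meas \<psi>" "Q_meas \<xi>"
  shows "L1_dist \<phi> \<xi> \<le> L1_dist \<phi> \<psi> + L1_dist \<psi> \<xi>"
proof -
  have [measurable]: "(\<lambda>z. indicator Q z * \<phi> z) \<in> borel_measurable borel" "(\<lambda>z. indicator Q z * \<psi> z) \<in> borel_measurable borel"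
    "(\<lambda>z. indicator Q z * \<xi> z) \<in> borel_measurable borel" using assms by (simp_all add: Q_meas_def)
  have "L1_dist \<phi> \<xi> \<le> (\<integral>\<^sup>+z. ennreal \<bar>indicator Q z * \<phi> z - indicator Q z * \<psi> z\<bar> + ennreal \<bar>indicator Q z * \<psi> z - indicator Q z * \<xi> z\<bar> \<partial>lborel)"
    unfolding L1_dist_def
  proof (rule nn_integral_mono)
    have "ennreal \<bar>a - c\<bar> \<le> ennreal \<bar>a - b\<bar> + ennreal \<bar>b - c\<bar>" for a b c :: real
      using ennreal_leI[of "\<bar>a - c\<bar>" "\<bar>a - b\<bar> + \<bar>b - c\<bar>"] ennreal_plus[of "\<bar>a - b\<bar>" "\<bar>b - c\<bar>"] by simp
    thus "ennreal \<bar>indicator Q z * \<phi> z - indicator Q z * \<xi> z\<bar>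
        \<le> ennreal \<bar>indicator Q z * \<phi> z - indicator Q z * \<psi> z\<bar> + ennreal \<bar>indicator Q z * \<psi> z - indicator Q z * \<xi> z\<bar>" for z .
  qed
  also have "\<dots> = L1_dist \<phi> \<psi> + L1_dist \<psi> \<xi>"
    unfolding L1_dist_def by (rule nn_integral_add)
      (auto intro!: measurable_compose[OF _ measurable_ennreal] borel_measurable_abs borel_measurable_diff assms[unfolded Q_meas_def])
  finally show ?thesis .
qed

lemma L2_triangle:
  assumes [measurable]: "X \<in> borel_measurable M" "Y \<in> borel_measurable M" "Z \<in> borel_measurable M"
  shows "L2_dist X Z \<le> 2 * L2_dist X Y + 2 * L2_dist Y Z"
proof -
  have "(X \<omega> - Z \<omega>)\<^sup>2 \<le> 2 * (X \<omega> - Y \<omega>)\<^sup>2 + 2 * (Y \<omega> - Z \<omega>)\<^sup>2" for \<omega>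
  proof -
    have "(a + b)\<^sup>2 \<le> 2 * a\<^sup>2 + 2 * b\<^sup>2" for a b :: real
      using sum_squares_bound[of a b] unfolding power2_sum by linarith
    from this[of "X \<omega> - Y \<omega>" "Y \<omega> - Z \<omega>"] show ?thesis by simp
  qed
  note le = this
  have "L2_dist X Z \<le> (\<integral>\<^sup>+\<omega>. 2 * ennreal ((X \<omega> - Y \<omega>)\<^sup>2) + 2 * ennreal ((Y \<omega> - Z \<omega>)\<^sup>2) \<partial>M)"
    unfolding L2_dist_def
  proof (rule nn_integral_mono)
    fix \<omega>
    have "ennreal (2 * (X \<omega> - Y \<omega>)\<^sup>2 + 2 * (Y \<omega> - Z \<omega>)\<^sup>2) = 2 * ennreal ((X \<omega> - Y \<omega>)\<^sup>2) + 2 * ennreal ((Y \<omega> - Z \<omega>)\<^sup>2)"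
      by (simp add: ennreal_mult)
    with ennreal_leI[OF le, of \<omega>]
    show "ennreal ((X \<omega> - Z \<omega>)\<^sup>2) \<le> 2 * ennreal ((X \<omega> - Y \<omega>)\<^sup>2) + 2 * ennreal ((Y \<omega> - Z \<omega>)\<^sup>2)" by simp
  qed
  also have "\<dots> = 2 * L2_dist X Y + 2 * L2_dist Y Z"
    unfolding L2_dist_def by (simp add: nn_integral_add nn_integral_cmult)
  finally show ?thesis .
qed

section \<open>The closed graph and its linear structure\<close>

lemma wiener_meas: "wiener \<phi> X \<Longrightarrow> X \<in> borel_measurable M" "wiener \<phi> X \<Longrightarrow> Q_meas \<phi>"
  by (simp_all add: wiener_def)

lemma wiener_approx:
  assumes "wiener \<phi> X" "e > 0"
  obtains S where "is_step T S" "L1_dist (step_fun S) \<phi> < ennreal e" "L2_dist (N S) X < ennreal e"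
proof -
  have "\<exists>S. is_step T S \<and> L1_dist (step_fun S) \<phi> < ennreal e \<and> L2_dist (N S) X < ennreal e"
    using assms by (simp add: wiener_def)
  thus thesis using that by auto
qed

lemma wiener_step: "is_step T S \<Longrightarrow> wiener (step_fun S) (N S)"
  unfolding wiener_def by (auto simp: N_meas Q_meas_step L1_dist_def L2_dist_def intro!: exI[of _ S])

text \<open>The closure of the graph is closed. Approximating twice within e/4 suffices, since the
  triangle inequality for squared distances doubles each error.\<close>

lemma wiener_closed:
  assumes X: "X \<in> borel_measurable M" and \<phi>: "Q_meas \<phi>"
    and apx: "\<And>e. e > 0 \<Longrightarrow> \<exists>\<phi>' X'. wiener \<phi>' X' \<and> L1_dist \<phi>' \<phi> < ennreal e \<and> L2_dist X' X < ennreal e"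
  shows "wiener \<phi> X"
  unfolding wiener_def
proof (intro conjI X \<phi> allI impI)
  fix e :: real assume e: "e > 0"
  obtain \<phi>' X' where 1: "wiener \<phi>' X'" "L1_dist \<phi>' \<phi> < ennreal (e / 4)" "L2_dist X' X < ennreal (e / 4)"
    using apx[of "e / 4"] e by auto
  obtain S where S: "is_step T S" "L1_dist (step_fun S) \<phi>' < ennreal (e / 4)" "L2_dist (N S) X' < ennreal (e / 4)"
    by (rule wiener_approx[OF 1(1), of "e / 4"]) (use e in auto)
  have "L1_dist (step_fun S) \<phi> \<le> L1_dist (step_fun S) \<phi>' + L1_dist \<phi>' \<phi>"
    by (intro L1_triangle Q_meas_step S wiener_meas[OF 1(1)] \<phi>)
  also have "\<dots> \<le> ennreal (e / 4) + ennreal (e / 4)" using S 1 by (intro add_mono less_imp_le)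
  also have "\<dots> = ennreal (e / 2)" using e by (simp flip: ennreal_plus)
  also have "\<dots> < ennreal e" using e by (intro ennreal_lessI) auto
  finally have A: "L1_dist (step_fun S) \<phi> < ennreal e" .
  have "L2_dist (N S) X \<le> 2 * L2_dist (N S) X' + 2 * L2_dist X' X"
    by (intro L2_triangle N_meas S wiener_meas[OF 1(1)] X)
  also have "\<dots> < ennreal e"
  proof -
    have "2 * L2_dist (N S) X' < ennreal (e / 2)" "2 * L2_dist X' X < ennreal (e / 2)"
      using ennreal_mult_strict_left_mono[OF S(3), of 2] ennreal_mult_strict_left_mono[OF 1(3), of 2] e
      by (auto simp flip: ennreal_mult ennreal_numeral)
    hence "2 * L2_dist (N S) X' + 2 * L2_dist X' X < ennreal (e / 2) + ennreal (e / 2)" by (rule add_strict_mono)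
    also have "\<dots> = ennreal e" using e by (simp flip: ennreal_plus)
    finally show ?thesis .
  qed
  finally show "\<exists>S. is_step T S \<and> L1_dist (step_fun S) \<phi> < ennreal e \<and> L2_dist (N S) X < ennreal e"
    using A S by blast
qed

text \<open>Integrands beyond finite combinations of steps enter the graph through this criterion:
  spatial profiles, exponential kernels and finally the Green function.\<close>

lemma wiener_LIMSEQ:
  assumes X: "X \<in> borel_measurable M" and \<phi>: "Q_meas \<phi>" and w: "\<And>n. wiener (\<phi>' n) (X' n)"
    and 1: "(\<lambda>n. L1_dist (\<phi>' n) \<phi>) \<longlonglongrightarrow> 0" and 2: "(\<lambda>n. L2_dist (X' n) X) \<longlonglongrightarrow> 0"
  shows "wiener \<phi> X"
proof (rule wiener_closed[OF X \<phi>])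
  fix e :: real assume "e > 0"
  hence "\<forall>\<^sub>F n in sequentially. L1_dist (\<phi>' n) \<phi> < ennreal e" "\<forall>\<^sub>F n in sequentially. L2_dist (X' n) X < ennreal e"
    using order_tendstoD(2)[OF 1, of "ennreal e"] order_tendstoD(2)[OF 2, of "ennreal e"] by auto
  hence "\<forall>\<^sub>F n in sequentially. L1_dist (\<phi>' n) \<phi> < ennreal e \<and> L2_dist (X' n) X < ennreal e" by (rule eventually_conj)
  then obtain n where "L1_dist (\<phi>' n) \<phi> < ennreal e \<and> L2_dist (X' n) X < ennreal e"
    by (auto simp: eventually_sequentially)
  thus "\<exists>\<phi>' X'. wiener \<phi>' X' \<and> L1_dist \<phi>' \<phi> < ennreal e \<and> L2_dist X' X < ennreal e" using w by blast
qed

lemma wiener_add: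
  assumes "wiener \<phi> X" "wiener \<psi> Y"
  shows "wiener (\<lambda>z. \<phi> z + \<psi> z) (\<lambda>\<omega>. X \<omega> + Y \<omega>)"
proof (rule wiener_closed)
  note m = wiener_meas[OF assms(1)] wiener_meas[OF assms(2)]
  show "(\<lambda>\<omega>. X \<omega> + Y \<omega>) \<in> borel_measurable M" using m by (intro borel_measurable_add)
  have q: "Q_meas (\<lambda>z. \<phi> z + \<psi> z)" if "Q_meas \<phi>" "Q_meas \<psi>" for \<phi> \<psi>
    using borel_measurable_add[OF that[unfolded Q_meas_def]] by (simp add: Q_meas_def distrib_left)
  show "Q_meas (\<lambda>z. \<phi> z + \<psi> z)" using m by (intro q)
  fix e :: real assume e: "e > 0"
  obtain S where S: "is_step T S" "L1_dist (step_fun S) \<phi> < ennreal (e / 4)" "L2_dist (N S) X < ennreal (e / 4)"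
    by (rule wiener_approx[OF assms(1), of "e / 4"]) (use e in auto)
  obtain R where R: "is_step T R" "L1_dist (step_fun R) \<psi> < ennreal (e / 4)" "L2_dist (N R) Y < ennreal (e / 4)"
    by (rule wiener_approx[OF assms(2), of "e / 4"]) (use e in auto)
  have SR: "is_step T (S @ R)" using S R by simp
  have "L1_dist (step_fun (S @ R)) (\<lambda>z. \<phi> z + \<psi> z) \<le> L1_dist (\<lambda>z. step_fun S z + step_fun R z) (\<lambda>z. \<phi> z + step_fun R z) + L1_dist (\<lambda>z. \<phi> z + step_fun R z) (\<lambda>z. \<phi> z + \<psi> z)"
    unfolding step_fun_simps(3)[abs_def] by (intro L1_triangle q Q_meas_step S R m)
  also have "\<dots> = L1_dist (step_fun S) \<phi> + L1_dist (step_fun R) \<psi>"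
    by (simp add: L1_dist_def distrib_left)
  also have "\<dots> < ennreal (e / 4) + ennreal (e / 4)" using S R by (intro add_strict_mono)
  also have "\<dots> = ennreal (e / 2)" using e by (simp flip: ennreal_plus)
  also have "\<dots> < ennreal e" using e by (intro ennreal_lessI) auto
  finally have A: "L1_dist (step_fun (S @ R)) (\<lambda>z. \<phi> z + \<psi> z) < ennreal e" .
  have "L2_dist (N (S @ R)) (\<lambda>\<omega>. X \<omega> + Y \<omega>) \<le> 2 * L2_dist (\<lambda>\<omega>. N S \<omega> + N R \<omega>) (\<lambda>\<omega>. X \<omega> + N R \<omega>) + 2 * L2_dist (\<lambda>\<omega>. X \<omega> + N R \<omega>) (\<lambda>\<omega>. X \<omega> + Y \<omega>)"
    unfolding step_noise_simps(3)[abs_def] by (intro L2_triangle borel_measurable_add N_meas S R m)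
  also have "\<dots> = 2 * L2_dist (N S) X + 2 * L2_dist (N R) Y" by (simp add: L2_dist_def)
  also have "\<dots> < ennreal e"
  proof -
    have "2 * L2_dist (N S) X < ennreal (e / 2)" "2 * L2_dist (N R) Y < ennreal (e / 2)"
      using ennreal_mult_strict_left_mono[OF S(3), of 2] ennreal_mult_strict_left_mono[OF R(3), of 2] e
      by (auto simp flip: ennreal_mult ennreal_numeral)
    hence "2 * L2_dist (N S) X + 2 * L2_dist (N R) Y < ennreal (e / 2) + ennreal (e / 2)" by (rule add_strict_mono)
    also have "\<dots> = ennreal e" using e by (simp flip: ennreal_plus)
    finally show ?thesis .
  qed
  finally show "\<exists>\<phi>' X'. wiener \<phi>' X' \<and> L1_dist \<phi>' (\<lambda>z. \<phi> z + \<psi> z) < ennreal e \<and> L2_dist X' (\<lambda>\<omega>. X \<omega> + Y \<omega>) < ennreal e"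
    using A wiener_step[OF SR] by blast
qed

lemma wiener_cmult:
  assumes w: "wiener \<phi> X"
  shows "wiener (\<lambda>z. c * \<phi> z) (\<lambda>\<omega>. c * X \<omega>)"
proof (rule wiener_closed)
  note m = wiener_meas[OF w]
  show "(\<lambda>\<omega>. c * X \<omega>) \<in> borel_measurable M" using m by (intro borel_measurable_times) auto
  show "Q_meas (\<lambda>z. c * \<phi> z)"
    using borel_measurable_times[OF borel_measurable_const[of c] m(2)[unfolded Q_meas_def]] by (simp add: Q_meas_def mult_ac)
  fix e :: real assume e: "e > 0"
  \<comment> \<open>Scaling by c multiplies the L1 distance by |c| and the squared L2 distance by
    c^2; this tolerance brings both products below e.\<close>
  define d where "d = e / (1 + \<bar>c\<bar> + c\<^sup>2)"
  have p: "1 + \<bar>c\<bar> + c\<^sup>2 > 0" by (simp add: add_pos_nonneg)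
  have d: "d > 0" using e p by (simp add: d_def)
  have "\<bar>c\<bar> * d < (1 + \<bar>c\<bar> + c\<^sup>2) * d" "c\<^sup>2 * d < (1 + \<bar>c\<bar> + c\<^sup>2) * d"
    using d by (intro mult_strict_right_mono; simp add: add_pos_nonneg add.commute)+
  moreover have "(1 + \<bar>c\<bar> + c\<^sup>2) * d = e" using p by (simp add: d_def)
  ultimately have cd: "\<bar>c\<bar> * d < e" "c\<^sup>2 * d < e" by auto
  obtain S where S: "is_step T S" "L1_dist (step_fun S) \<phi> < ennreal d" "L2_dist (N S) X < ennreal d"
    by (rule wiener_approx[OF w d])
  have "L1_dist (step_fun (step_scale c S)) (\<lambda>z. c * \<phi> z) = ennreal \<bar>c\<bar> * L1_dist (step_fun S) \<phi>"
  proof -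
    have "L1_dist (step_fun (step_scale c S)) (\<lambda>z. c * \<phi> z) = (\<integral>\<^sup>+z. ennreal \<bar>c\<bar> * ennreal \<bar>indicator Q z * step_fun S z - indicator Q z * \<phi> z\<bar> \<partial>lborel)"
      unfolding L1_dist_def
    proof (rule nn_integral_cong)
      fix z
      have "indicator Q z * step_fun (step_scale c S) z - indicator Q z * (c * \<phi> z) = c * (indicator Q z * step_fun S z - indicator Q z * \<phi> z)"
        by (simp add: algebra_simps)
      thus "ennreal \<bar>indicator Q z * step_fun (step_scale c S) z - indicator Q z * (c * \<phi> z)\<bar> = ennreal \<bar>c\<bar> * ennreal \<bar>indicator Q z * step_fun S z - indicator Q z * \<phi> z\<bar>"
        by (simp only: abs_mult ennreal_mult[OF abs_ge_zero abs_ge_zero])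
    qed
    also have "\<dots> = ennreal \<bar>c\<bar> * L1_dist (step_fun S) \<phi>"
      unfolding L1_dist_def using m(2) Q_meas_step[OF S(1)] unfolding Q_meas_def
      by (intro nn_integral_cmult measurable_compose[OF _ measurable_ennreal] borel_measurable_abs borel_measurable_diff) auto
    finally show ?thesis .
  qed
  also have "\<dots> \<le> ennreal \<bar>c\<bar> * ennreal d" using S by (intro mult_left_mono) auto
  also have "\<dots> < ennreal e" using cd d e by (simp add: ennreal_lessI flip: ennreal_mult)
  finally have A: "L1_dist (step_fun (step_scale c S)) (\<lambda>z. c * \<phi> z) < ennreal e" .
  have "L2_dist (N (step_scale c S)) (\<lambda>\<omega>. c * X \<omega>) = (\<integral>\<^sup>+\<omega>. ennreal (c\<^sup>2) * ennreal ((N S \<omega> - X \<omega>)\<^sup>2) \<partial>M)"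
    unfolding L2_dist_def
    by (intro nn_integral_cong) (simp add: power_mult_distrib flip: ennreal_mult right_diff_distrib)
  also have "\<dots> = ennreal (c\<^sup>2) * L2_dist (N S) X"
    unfolding L2_dist_def using m(1) N_meas[OF S(1)]
    by (intro nn_integral_cmult measurable_compose[OF _ measurable_ennreal] borel_measurable_power borel_measurable_diff) auto
  also have "\<dots> \<le> ennreal (c\<^sup>2) * ennreal d" using S by (intro mult_left_mono) auto
  also have "\<dots> < ennreal e" using cd d e by (simp add: ennreal_lessI flip: ennreal_mult)
  finally show "\<exists>\<phi>' X'. wiener \<phi>' X' \<and> L1_dist \<phi>' (\<lambda>z. c * \<phi> z) < ennreal e \<and> L2_dist X' (\<lambda>\<omega>. c * X \<omega>) < ennreal e"
    using A wiener_step[of "step_scale c S"] S(1) step_scale_simps(3) by blast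
qed

lemma wiener_sum:
  assumes "\<And>i. i \<in> I \<Longrightarrow> wiener (\<phi> i) (X i)" "finite I"
  shows "wiener (\<lambda>z. \<Sum>i\<in>I. \<phi> i z) (\<lambda>\<omega>. \<Sum>i\<in>I. X i \<omega>)"
  using assms(2,1)
proof (induction I rule: finite_induct)
  case empty
  show ?case using wiener_step[of "[]"] by (simp add: step_fun_def [abs_def] step_noise_def [abs_def])
qed (auto intro!: wiener_add)

lemma wiener_cong_AE:
  assumes w: "wiener \<phi> X" and Y: "Y \<in> borel_measurable M" "AE \<omega> in M. X \<omega> = Y \<omega>"
    and \<psi>: "Q_meas \<psi>" "AE z in lborel. z \<in> Q \<longrightarrow> \<phi> z = \<psi> z"
  shows "wiener \<psi> Y"
proof (rule wiener_closed[OF Y(1) \<psi>(1)])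
  fix e :: real assume e: "e > 0"
  have "L1_dist \<phi> \<psi> = (\<integral>\<^sup>+z. 0 \<partial>(lborel :: (real \<times> real) measure))"
    unfolding L1_dist_def by (intro nn_integral_cong_AE) (use \<psi>(2) in \<open>auto elim!: eventually_mono simp: indicator_def\<close>)
  moreover have "L2_dist X Y = (\<integral>\<^sup>+\<omega>. 0 \<partial>M)"
    unfolding L2_dist_def by (intro nn_integral_cong_AE) (use Y(2) in \<open>auto elim!: eventually_mono\<close>)
  ultimately show "\<exists>\<phi>' X'. wiener \<phi>' X' \<and> L1_dist \<phi>' \<psi> < ennreal e \<and> L2_dist X' Y < ennreal e"
    using w e by (intro exI[of _ \<phi>] exI[of _ X]) simp
qed

section \<open>Orthogonality and uniqueness\<close>

lemma wiener_square_integrable: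
  assumes w: "wiener \<phi> X"
  shows "integrable M (\<lambda>\<omega>. (X \<omega>)\<^sup>2)"
proof -
  obtain S where S: "is_step T S" "L1_dist (step_fun S) \<phi> < ennreal 1" "L2_dist (N S) X < ennreal 1"
    by (rule wiener_approx[OF w, of 1]) auto
  note m = wiener_meas(1)[OF w] N_meas[OF S(1)]
  have "integrable M (\<lambda>\<omega>. (N S \<omega> - X \<omega>)\<^sup>2)"
    using S(3) m unfolding L2_dist_def by (intro integrableI_bounded) (auto simp: less_top[symmetric])
  hence "integrable M (\<lambda>\<omega>. (N S \<omega> + (-1) * (N S \<omega> - X \<omega>))\<^sup>2)"
    by (intro integrable_add_square N_square_integrable S borel_measurable_diff m)
  thus ?thesis by simp
qed

text \<open>Closability. If step functions tend to 0 in L1 while their noises tend to X in L2, then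
  the covariance of X with each \<open>W V s\<close> is the limit of integrals of those step
  functions against a bounded kernel, hence 0. So X is orthogonal to all step noises, and being a
  limit of such noises it is orthogonal to itself.\<close>

lemma wiener_zero:
  assumes w: "wiener (\<lambda>z. 0) X"
  shows "AE \<omega> in M. X \<omega> = 0"
proof -
  note m = wiener_meas(1)[OF w] and sq = wiener_square_integrable[OF w]
  have L2: "integrable M (\<lambda>\<omega>. (N S \<omega> - X \<omega>)\<^sup>2)" "L2_dist (N S) X = ennreal (\<integral>\<omega>. (N S \<omega> - X \<omega>)\<^sup>2 \<partial>M)" if S: "is_step T S" for S
  proof -
    show i: "integrable M (\<lambda>\<omega>. (N S \<omega> - X \<omega>)\<^sup>2)"
      using integrable_add_square[OF N_meas[OF S] m N_square_integrable[OF S] sq, of "-1"] by simp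
    show "L2_dist (N S) X = ennreal (\<integral>\<omega>. (N S \<omega> - X \<omega>)\<^sup>2 \<partial>M)"
      unfolding L2_dist_def using i by (intro nn_integral_eq_integral) auto
  qed
  have orth: "(\<integral>\<omega>. X \<omega> * W V s \<omega> \<partial>M) = 0" if V: "V \<in> sets borel" "V \<subseteq> D" "s \<in> {0..T}" for V s
  proof -
    define K where "K = (\<integral>\<omega>. (W V s \<omega>)\<^sup>2 \<partial>M)"
    define C where "C = 2 * H * T powr (2 * H - 1)"
    have C: "C \<ge> 0" using H_gt by (simp add: C_def)
    have K: "K \<ge> 0" by (simp add: K_def)
    have Vs: "is_step T [(1, V, s)]" using V by simp
    have Wm: "W V s \<in> borel_measurable M" "integrable M (\<lambda>\<omega>. (W V s \<omega>)\<^sup>2)"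
      using N_meas[OF Vs] N_square_integrable[OF Vs] by (simp_all add: step_noise_def [abs_def])
    \<comment> \<open>Two quantities are small when tested against \<open>W V s\<close>: the step
      noise, by the L1 bound on covariances, and its distance to X, by Cauchy-Schwarz in the form of
      Young's inequality.\<close>
    have le: "\<bar>\<integral>\<omega>. X \<omega> * W V s \<omega> \<partial>M\<bar> \<le> e * (1 + K + C)" if e: "e > 0" "e \<le> 1" for e
    proof -
      \<comment> \<open>The tolerance is e^2 because Young's inequality, weighted by e, divides the
        squared L2 error by e.\<close>
      obtain S where S: "is_step T S" "L1_dist (step_fun S) (\<lambda>z. 0) < ennreal (e\<^sup>2)" "L2_dist (N S) X < ennreal (e\<^sup>2)"
        by (rule wiener_approx[OF w, of "e\<^sup>2"]) (use e in auto)
      have ee: "e\<^sup>2 \<le> e" using e power_decreasing[of 1 2 e] by simp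
      have d: "(\<integral>\<omega>. (N S \<omega> - X \<omega>)\<^sup>2 \<partial>M) < e\<^sup>2" using S(3) L2(2)[OF S(1)] by (simp add: ennreal_less_iff)
      have i1: "integrable M (\<lambda>\<omega>. N S \<omega> * W V s \<omega>)" "integrable M (\<lambda>\<omega>. X \<omega> * W V s \<omega>)"
        "integrable M (\<lambda>\<omega>. (N S \<omega> - X \<omega>) * W V s \<omega>)"
        by (intro integrable_mult_of_squares N_meas S N_square_integrable Wm m sq L2 borel_measurable_diff)+
      have "ennreal \<bar>\<integral>\<omega>. N S \<omega> * W V s \<omega> \<partial>M\<bar> \<le> ennreal C * L1_dist (step_fun S) (\<lambda>z. 0)"
        using step_inner_L1_bound[OF H_gt T_pos V S(1)] by (simp add: expectation_N_W[OF S(1) V] L1_dist_def C_def abs_mult)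
      also have "\<dots> \<le> ennreal C * ennreal (e\<^sup>2)" using S by (intro mult_left_mono) auto
      also have "\<dots> = ennreal (C * e\<^sup>2)" using C by (simp add: ennreal_mult)
      finally have 1: "\<bar>\<integral>\<omega>. N S \<omega> * W V s \<omega> \<partial>M\<bar> \<le> C * e\<^sup>2" using C by (simp add: ennreal_le_iff)
      have "\<bar>\<integral>\<omega>. (N S \<omega> - X \<omega>) * W V s \<omega> \<partial>M\<bar> \<le> (\<integral>\<omega>. \<bar>(N S \<omega> - X \<omega>) * W V s \<omega>\<bar> \<partial>M)"
        by (rule integral_abs_bound)
      also have "\<dots> \<le> (\<integral>\<omega>. (1 / e) * (N S \<omega> - X \<omega>)\<^sup>2 + e * (W V s \<omega>)\<^sup>2 \<partial>M)"
      proof (rule integral_mono)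
        show "integrable M (\<lambda>\<omega>. \<bar>(N S \<omega> - X \<omega>) * W V s \<omega>\<bar>)" using i1(3) by (rule integrable_abs)
        show "integrable M (\<lambda>\<omega>. (1 / e) * (N S \<omega> - X \<omega>)\<^sup>2 + e * (W V s \<omega>)\<^sup>2)"
          by (intro Bochner_Integration.integrable_add integrable_mult_right L2 S Wm)
        fix \<omega>
        have young: "\<bar>a * b\<bar> \<le> (1 / e) * a\<^sup>2 + e * b\<^sup>2" for a b :: real
        proof -
          have "2 * (\<bar>a\<bar> * (e * \<bar>b\<bar>)) \<le> a\<^sup>2 + (e * b)\<^sup>2"
            using sum_squares_bound[of "\<bar>a\<bar>" "e * \<bar>b\<bar>"] by (simp add: power_mult_distrib mult_ac)
          moreover have "0 \<le> \<bar>a\<bar> * (e * \<bar>b\<bar>)" using e by simp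
          ultimately have "\<bar>a\<bar> * (e * \<bar>b\<bar>) \<le> a\<^sup>2 + (e * b)\<^sup>2" by linarith
          moreover have "e * \<bar>a * b\<bar> = \<bar>a\<bar> * (e * \<bar>b\<bar>)" by (simp add: abs_mult)
          moreover have "e * ((1 / e) * a\<^sup>2 + e * b\<^sup>2) = a\<^sup>2 + (e * b)\<^sup>2"
            using e by (simp add: distrib_left power_mult_distrib power2_eq_square mult_ac)
          ultimately have "e * \<bar>a * b\<bar> \<le> e * ((1 / e) * a\<^sup>2 + e * b\<^sup>2)" by (simp only:)
          thus ?thesis using e by (simp only: mult_le_cancel_left_pos)
        qed
        show "\<bar>(N S \<omega> - X \<omega>) * W V s \<omega>\<bar> \<le> (1 / e) * (N S \<omega> - X \<omega>)\<^sup>2 + e * (W V s \<omega>)\<^sup>2" by (rule young)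
      qed
      also have "\<dots> = (1 / e) * (\<integral>\<omega>. (N S \<omega> - X \<omega>)\<^sup>2 \<partial>M) + e * K"
        unfolding K_def using L2[OF S(1)] Wm by (subst Bochner_Integration.integral_add) auto
      also have "\<dots> \<le> (1 / e) * e\<^sup>2 + e * K" using d e by (intro add_right_mono mult_left_mono) auto
      also have "\<dots> = e * (1 + K)" using e by (simp add: power2_eq_square distrib_left)
      finally have 2: "\<bar>\<integral>\<omega>. (N S \<omega> - X \<omega>) * W V s \<omega> \<partial>M\<bar> \<le> e * (1 + K)" .
      have "(\<integral>\<omega>. (N S \<omega> - X \<omega>) * W V s \<omega> \<partial>M) = (\<integral>\<omega>. N S \<omega> * W V s \<omega> \<partial>M) - (\<integral>\<omega>. X \<omega> * W V s \<omega> \<partial>M)"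
        using i1 by (simp add: left_diff_distrib)
      moreover have "C * e\<^sup>2 \<le> C * e" using C ee by (rule mult_left_mono[rotated])
      ultimately have "\<bar>\<integral>\<omega>. X \<omega> * W V s \<omega> \<partial>M\<bar> \<le> e * (1 + K) + C * e" using 1 2 by linarith
      thus ?thesis by (simp add: algebra_simps)
    qed
    have "\<bar>\<integral>\<omega>. X \<omega> * W V s \<omega> \<partial>M\<bar> \<le> d" if d: "d > 0" for d
    proof -
      define e where "e = min 1 (d / (1 + K + C))"
      have p: "1 + K + C > 0" using K C by simp
      have "e > 0" "e \<le> 1" using d p by (auto simp: e_def)
      from le[OF this] have "\<bar>\<integral>\<omega>. X \<omega> * W V s \<omega> \<partial>M\<bar> \<le> e * (1 + K + C)" .
      also have "\<dots> \<le> d / (1 + K + C) * (1 + K + C)" using p by (intro mult_right_mono) (auto simp: e_def)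
      also have "\<dots> = d" using p by simp
      finally show ?thesis .
    qed
    hence "\<bar>\<integral>\<omega>. X \<omega> * W V s \<omega> \<partial>M\<bar> \<le> 0" by (rule field_le_epsilon[OF order_trans]) auto
    thus ?thesis by simp
  qed
  have orth_N: "(\<integral>\<omega>. X \<omega> * N S \<omega> \<partial>M) = 0" if S: "is_step T S" for S
    using S
  proof (induction S)
    case (Cons a S)
    obtain c U t where a: "a = (c, U, t)" by (cases a) auto
    have U: "is_step T [(1, U, t)]" and S: "is_step T S" using Cons.prems by (auto simp: a)
    have i: "integrable M (\<lambda>\<omega>. X \<omega> * W U t \<omega>)" "integrable M (\<lambda>\<omega>. X \<omega> * N S \<omega>)"
      using integrable_mult_of_squares[OF m N_meas[OF U] sq N_square_integrable[OF U]]
        integrable_mult_of_squares[OF m N_meas[OF S] sq N_square_integrable[OF S]] by simp_all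
    have "(\<integral>\<omega>. X \<omega> * N (a # S) \<omega> \<partial>M) = (\<integral>\<omega>. c * (X \<omega> * W U t \<omega>) + X \<omega> * N S \<omega> \<partial>M)"
      by (simp add: a distrib_left mult_ac)
    also have "\<dots> = 0" using i orth Cons by (subst Bochner_Integration.integral_add) (auto simp: a)
    finally show ?case .
  qed simp
  have "(\<integral>\<omega>. (X \<omega>)\<^sup>2 \<partial>M) \<le> e" if e: "e > 0" for e
  proof -
    obtain S where S: "is_step T S" "L1_dist (step_fun S) (\<lambda>z. 0) < ennreal e" "L2_dist (N S) X < ennreal e"
      by (rule wiener_approx[OF w e])
    have i: "integrable M (\<lambda>\<omega>. X \<omega> * N S \<omega>)" by (intro integrable_mult_of_squares m N_meas sq N_square_integrable S)
    \<comment> \<open>By orthogonality the squared norms of X and of its approximation add up to the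
      squared norm of their difference, which is below e.\<close>
    have "(\<integral>\<omega>. (X \<omega>)\<^sup>2 \<partial>M) \<le> (\<integral>\<omega>. (X \<omega>)\<^sup>2 \<partial>M) + (\<integral>\<omega>. (N S \<omega>)\<^sup>2 \<partial>M)" by simp
    also have "\<dots> = (\<integral>\<omega>. (X \<omega>)\<^sup>2 + (N S \<omega>)\<^sup>2 - 2 * (X \<omega> * N S \<omega>) \<partial>M)"
      using i sq N_square_integrable[OF S(1)] orth_N[OF S(1)] by simp
    also have "\<dots> = (\<integral>\<omega>. (N S \<omega> - X \<omega>)\<^sup>2 \<partial>M)"
      by (intro Bochner_Integration.integral_cong) (auto simp: power2_eq_square algebra_simps)
    also have "\<dots> < e" using S(3) L2(2)[OF S(1)] e by (simp add: ennreal_less_iff)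
    finally show ?thesis by simp
  qed
  hence "(\<integral>\<omega>. (X \<omega>)\<^sup>2 \<partial>M) \<le> 0" by (rule field_le_epsilon[OF order_trans]) auto
  moreover have "(\<integral>\<omega>. (X \<omega>)\<^sup>2 \<partial>M) \<ge> 0" by simp
  ultimately have "(\<integral>\<omega>. (X \<omega>)\<^sup>2 \<partial>M) = 0" by linarith
  hence "AE \<omega> in M. (X \<omega>)\<^sup>2 = 0" using integral_nonneg_eq_0_iff_AE[OF sq] by simp
  thus ?thesis by eventually_elim simp
qed

lemma wiener_unique:
  assumes "wiener \<phi> X" "wiener \<phi> Y"
  shows "AE \<omega> in M. X \<omega> = Y \<omega>"
proof -
  have "wiener (\<lambda>z. \<phi> z + (-1) * \<phi> z) (\<lambda>\<omega>. X \<omega> + (-1) * Y \<omega>)"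
    by (intro wiener_add wiener_cmult assms)
  hence "AE \<omega> in M. X \<omega> + (-1) * Y \<omega> = 0" by (intro wiener_zero) simp
  thus ?thesis by eventually_elim simp
qed

lemma step_fun_integrable:
  assumes "is_step T S"
  shows "set_integrable lborel Q (step_fun S)"
  using assms
proof (induction S)
  case (Cons a S)
  obtain c U t where a: "a = (c, U, t)" by (cases a) auto
  have U: "U \<in> sets borel" "U \<subseteq> D" and t: "t \<in> {0..T}" and S: "is_step T S" using Cons.prems by (auto simp: a)
  have "U \<times> {0..t} \<in> sets (borel \<Otimes>\<^sub>M borel)" using U by auto
  hence [measurable]: "U \<times> {0..t} \<in> sets (borel :: (real \<times> real) measure)" by (simp only: borel_prod)
  have fin: "emeasure lborel (Q \<inter> U \<times> {0..t}) < \<infinity>"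
  proof -
    have "emeasure lborel (Q \<inter> U \<times> {0..t}) \<le> emeasure (lborel \<Otimes>\<^sub>M lborel) Q"
      unfolding lborel_prod by (intro emeasure_mono) auto
    also have "\<dots> < \<infinity>"
      by (subst lborel.emeasure_pair_measure_Times) (auto simp: ennreal_mult_less_top emeasure_lborel_Icc_eq)
    finally show ?thesis .
  qed
  have "set_integrable lborel Q (indicator (U \<times> {0..t}) :: _ \<Rightarrow> real)"
    unfolding set_integrable_def using fin by (simp flip: indicator_inter_arith)
  hence "set_integrable lborel Q (\<lambda>z. c * indicator (U \<times> {0..t}) z + step_fun S z)"
    using Cons.IH[OF S] by (intro set_integral_add set_integrable_mult_right)
  thus ?case by (simp add: a)
qed (simp add: step_fun_def [abs_def] set_integrable_def)

text \<open>Here the stochastic term of the mild equation enters the closed graph; by uniqueness it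
  then suffices to find any other description of the same graph point.\<close>

lemma has_wiener_integral_wiener:
  assumes "has_wiener_integral M H T W \<phi> X"
  shows "wiener \<phi> X"
proof -
  obtain S where X [measurable]: "X \<in> borel_measurable M" and sq: "integrable M (\<lambda>\<omega>. (X \<omega>)\<^sup>2)"
    and S: "\<And>n. is_step T (S n)" "set_integrable lborel Q \<phi>"
      "(\<lambda>n. LINT z:Q|lborel. \<bar>step_fun (S n) z - \<phi> z\<bar>) \<longlonglongrightarrow> 0"
    and L2: "(\<lambda>n. \<integral>\<omega>. (N (S n) \<omega> - X \<omega>)\<^sup>2 \<partial>M) \<longlonglongrightarrow> 0"
    using assms unfolding has_wiener_integral_def represents_def by blast
  have \<phi>: "Q_meas \<phi>" using S(2) unfolding set_integrable_def Q_meas_def by auto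
  show ?thesis
  proof (rule wiener_LIMSEQ[OF X \<phi> wiener_step[OF S(1)]])
    have "L1_dist (step_fun (S n)) \<phi> = ennreal (LINT z:Q|lborel. \<bar>step_fun (S n) z - \<phi> z\<bar>)" for n
    proof -
      have eq: "\<bar>indicator Q z * step_fun (S n) z - indicator Q z * \<phi> z\<bar> = indicator Q z *\<^sub>R \<bar>step_fun (S n) z - \<phi> z\<bar>" for z
        by (auto simp: indicator_def)
      have "set_integrable lborel Q (step_fun (S n))" by (rule step_fun_integrable[OF S(1)])
      hence "set_integrable lborel Q (\<lambda>z. \<bar>step_fun (S n) z - \<phi> z\<bar>)"
        using S(2) by (intro set_integrable_abs set_integral_diff)
      thus ?thesis unfolding L1_dist_def eq set_integrable_def set_lebesgue_integral_def
        by (intro nn_integral_eq_integral) auto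
    qed
    thus "(\<lambda>n. L1_dist (step_fun (S n)) \<phi>) \<longlonglongrightarrow> 0" using tendsto_ennrealI[OF S(3)] by simp
    have "L2_dist (N (S n)) X = ennreal (\<integral>\<omega>. (N (S n) \<omega> - X \<omega>)\<^sup>2 \<partial>M)" for n
      unfolding L2_dist_def
      using integrable_add_square[OF N_meas[OF S(1)] X N_square_integrable[OF S(1)] sq, of n "-1"]
      by (intro nn_integral_eq_integral) auto
    thus "(\<lambda>n. L2_dist (N (S n)) X) \<longlonglongrightarrow> 0" using tendsto_ennrealI[OF L2] by simp
  qed
qed

end

section \<open>Noise integrated against a function of space\<close>

text \<open>Fatou's lemma. The bound is asked from some index on, which suits estimates that hold
  only for levels m >= n.\<close>

lemma nn_integral_limit_le:
  fixes f :: "nat \<Rightarrow> 'a \<Rightarrow> ennreal"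
  assumes m: "\<And>n. f n \<in> borel_measurable M" and lim: "AE x in M. (\<lambda>n. f n x) \<longlonglongrightarrow> g x"
    and le: "\<And>n. n \<ge> k \<Longrightarrow> (\<integral>\<^sup>+x. f n x \<partial>M) \<le> C"
  shows "(\<integral>\<^sup>+x. g x \<partial>M) \<le> C"
proof -
  have "(\<integral>\<^sup>+x. g x \<partial>M) = (\<integral>\<^sup>+x. liminf (\<lambda>n. f n x) \<partial>M)"
    by (intro nn_integral_cong_AE) (use lim in \<open>auto elim!: eventually_mono simp: lim_imp_Liminf\<close>)
  also have "\<dots> \<le> liminf (\<lambda>n. \<integral>\<^sup>+x. f n x \<partial>M)" by (rule nn_integral_liminf[OF m])
  also have "\<dots> \<le> limsup (\<lambda>n. \<integral>\<^sup>+x. f n x \<partial>M)" by (intro Liminf_le_Limsup) simp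
  also have "\<dots> \<le> C" by (intro Limsup_bounded eventually_sequentiallyI[of k] le)
  finally show ?thesis .
qed

text \<open>A list of pairs (c, U) is a step function of space alone. \<open>lift_step t\<close>
  attaches one common time interval [0, t], so that covariances factor into a time part and an L2
  product in space.\<close>

type_synonym space_step = "(real \<times> real set) list"

definition is_space_step :: "space_step \<Rightarrow> bool" where
  "is_space_step P \<longleftrightarrow> (\<forall>(c, U) \<in> set P. U \<in> sets borel \<and> U \<subseteq> D)"

definition space_fun :: "space_step \<Rightarrow> real \<Rightarrow> real" where
  "space_fun P y = (\<Sum>(c, U) \<leftarrow> P. c * indicator U y)"

definition lift_step :: "real \<Rightarrow> space_step \<Rightarrow> step" where
  "lift_step t P = map (\<lambda>(c, U). (c, U, t)) P"

lemma space_step_simps [simp]: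
  "is_space_step []" "is_space_step ((c, U) # P) \<longleftrightarrow> U \<in> sets borel \<and> U \<subseteq> D \<and> is_space_step P"
  "space_fun [] y = 0" "space_fun ((c, U) # P) y = c * indicator U y + space_fun P y"
  "lift_step t [] = []" "lift_step t ((c, U) # P) = (c, U, t) # lift_step t P"
  by (simp_all add: is_space_step_def space_fun_def lift_step_def)

lemma step_fun_lift: "step_fun (lift_step t P) (y, r) = space_fun P y * indicator {0..t} r"
  by (induction P) (auto simp: distrib_right indicator_times)

lemma is_step_lift: "is_space_step P \<Longrightarrow> t \<in> {0..T} \<Longrightarrow> is_step T (lift_step t P)"
  by (induction P) auto

lemma integrable_indicator_inter_D:
  assumes "U \<in> sets borel" "U \<subseteq> D" "V \<in> sets borel" "V \<subseteq> D"
  shows "integrable lborel (\<lambda>y. indicator U y * indicator V y :: real)"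
proof -
  have "emeasure lborel (U \<inter> V) \<le> emeasure lborel D" by (intro emeasure_mono) (use assms in auto)
  also have "\<dots> < \<infinity>" by simp
  finally have "integrable lborel (indicator (U \<inter> V) :: real \<Rightarrow> real)" using assms by simp
  thus ?thesis by (simp add: indicator_inter_arith[abs_def])
qed

lemma integrable_space_fun_mult:
  assumes P: "is_space_step P" and R: "is_space_step R"
  shows "integrable lborel (\<lambda>y. space_fun P y * space_fun R y)"
proof -
  have 1: "integrable lborel (\<lambda>y. space_fun P y * indicator V y)" if V: "V \<in> sets borel" "V \<subseteq> D" for V
    using P
  proof (induction P)
    case (Cons a P)
    obtain c U where a: "a = (c, U)" by (cases a)
    have "integrable lborel (\<lambda>y. c * (indicator U y * indicator V y) + space_fun P y * indicator V y)"
      using Cons V unfolding a by (intro Bochner_Integration.integrable_add integrable_mult_right integrable_indicator_inter_D) auto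
    thus ?case by (simp add: a distrib_right mult.assoc)
  qed simp
  show ?thesis using R
  proof (induction R)
    case (Cons a R)
    obtain c U where a: "a = (c, U)" by (cases a)
    have "integrable lborel (\<lambda>y. c * (space_fun P y * indicator U y) + space_fun P y * space_fun R y)"
      using Cons unfolding a by (intro Bochner_Integration.integrable_add integrable_mult_right 1) auto
    thus ?case by (simp add: a distrib_left mult_ac)
  qed simp
qed

section \<open>Covariance of the noise tested against functions of space\<close>

context fractional_noise_space
begin

text \<open>The covariance function of fractional Brownian motion with Hurst parameter H.\<close>

definition time_cov :: "real \<Rightarrow> real \<Rightarrow> real" where
  "time_cov t s = (t powr (2 * H) + s powr (2 * H) - \<bar>t - s\<bar> powr (2 * H)) / 2"

lemma noise_cov_eq: "noise_cov H U t V s = time_cov t s * measure lborel (U \<inter> V)"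
  by (simp add: noise_cov_def time_cov_def)

lemma expectation_lift_W:
  assumes P: "is_space_step P" and t: "t \<in> {0..T}" and V: "V \<in> sets borel" "V \<subseteq> D" and s: "s \<in> {0..T}"
  shows "(\<integral>\<omega>. N (lift_step t P) \<omega> * W V s \<omega> \<partial>M) = time_cov t s * (LINT y|lborel. space_fun P y * indicator V y)"
  unfolding expectation_N_W[OF is_step_lift[OF P t] V s]
  using P
proof (induction P)
  case (Cons a P)
  obtain c U where a: "a = (c, U)" by (cases a)
  have U: "U \<in> sets borel" "U \<subseteq> D" and P: "is_space_step P" using Cons.prems by (auto simp: a)
  have V': "is_space_step [(1, V)]" using V by simp
  have i: "integrable lborel (\<lambda>y. indicator U y * indicator V y :: real)" "integrable lborel (\<lambda>y. space_fun P y * indicator V y)"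
    using integrable_indicator_inter_D[OF U V] integrable_space_fun_mult[OF P V'] by auto
  have "(LINT y|lborel. space_fun (a # P) y * indicator V y) = (LINT y|lborel. c * (indicator U y * indicator V y) + space_fun P y * indicator V y)"
    by (simp add: a distrib_right mult.assoc)
  also have "\<dots> = c * measure lborel (U \<inter> V) + (LINT y|lborel. space_fun P y * indicator V y)"
    using i U V by (subst Bochner_Integration.integral_add) (auto simp: indicator_inter_arith[abs_def, symmetric])
  finally show ?case using Cons.IH[OF P] by (simp add: a noise_cov_eq distrib_left mult_ac)
qed simp

text \<open>The covariance is a tensor product of \<open>time_cov\<close> and the L2 product in
  space. Tested against a fixed function of space, the noise thus has the covariance of a fractional
  Brownian motion scaled by the L2 norm of that function.\<close>

lemma expectation_lift_lift:
  assumes P: "is_space_step P" and t: "t \<in> {0..T}" and R: "is_space_step R" and s: "s \<in> {0..T}"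
  shows "(\<integral>\<omega>. N (lift_step t P) \<omega> * N (lift_step s R) \<omega> \<partial>M) = time_cov t s * (LINT y|lborel. space_fun P y * space_fun R y)"
  using R
proof (induction R)
  case (Cons a R)
  obtain d V where a: "a = (d, V)" by (cases a)
  have V: "V \<in> sets borel" "V \<subseteq> D" and R: "is_space_step R" using Cons.prems by (auto simp: a)
  have Vs: "is_step T [(1, V, s)]" and V1: "is_space_step [(1, V)]" using V s by auto
  note Ps = is_step_lift[OF P t] and Rs = is_step_lift[OF R s]
  have i: "integrable M (\<lambda>\<omega>. N (lift_step t P) \<omega> * W V s \<omega>)" "integrable M (\<lambda>\<omega>. N (lift_step t P) \<omega> * N (lift_step s R) \<omega>)"
    using N_mult_integrable[OF Ps Vs] N_mult_integrable[OF Ps Rs] by auto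
  have j: "integrable lborel (\<lambda>y. space_fun P y * indicator V y)" "integrable lborel (\<lambda>y. space_fun P y * space_fun R y)"
    using integrable_space_fun_mult[OF P V1] integrable_space_fun_mult[OF P R] by auto
  have "(\<integral>\<omega>. N (lift_step t P) \<omega> * N (lift_step s (a # R)) \<omega> \<partial>M)
      = (\<integral>\<omega>. d * (N (lift_step t P) \<omega> * W V s \<omega>) + N (lift_step t P) \<omega> * N (lift_step s R) \<omega> \<partial>M)"
    by (simp add: a distrib_left mult_ac)
  also have "\<dots> = d * (\<integral>\<omega>. N (lift_step t P) \<omega> * W V s \<omega> \<partial>M) + (\<integral>\<omega>. N (lift_step t P) \<omega> * N (lift_step s R) \<omega> \<partial>M)"
    using i by (subst Bochner_Integration.integral_add) auto
  also have "\<dots> = time_cov t s * (d * (LINT y|lborel. space_fun P y * indicator V y) + (LINT y|lborel. space_fun P y * space_fun R y))"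
    using expectation_lift_W[OF P t V s] Cons.IH[OF R] by (simp add: distrib_left)
  also have "d * (LINT y|lborel. space_fun P y * indicator V y) + (LINT y|lborel. space_fun P y * space_fun R y)
      = (LINT y|lborel. d * (space_fun P y * indicator V y) + space_fun P y * space_fun R y)"
    using j by (subst Bochner_Integration.integral_add) auto
  also have "\<dots> = (LINT y|lborel. space_fun P y * space_fun (a # R) y)" by (simp add: a distrib_left mult_ac)
  finally show ?case .
qed simp

lemma expectation_lift_diff_square:
  assumes P: "is_space_step P" and R: "is_space_step R" and t: "t \<in> {0..T}"
  shows "(\<integral>\<omega>. (N (lift_step t P) \<omega> - N (lift_step t R) \<omega>)\<^sup>2 \<partial>M) = t powr (2 * H) * (LINT y|lborel. (space_fun P y - space_fun R y)\<^sup>2)"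
proof -
  note s = is_step_lift[OF P t] is_step_lift[OF R t]
  have i: "integrable M (\<lambda>\<omega>. N (lift_step t P) \<omega> * N (lift_step t P) \<omega>)" "integrable M (\<lambda>\<omega>. N (lift_step t P) \<omega> * N (lift_step t R) \<omega>)"
    "integrable M (\<lambda>\<omega>. N (lift_step t R) \<omega> * N (lift_step t R) \<omega>)"
    by (intro N_mult_integrable s)+
  have j: "integrable lborel (\<lambda>y. space_fun P y * space_fun P y)" "integrable lborel (\<lambda>y. space_fun P y * space_fun R y)"
    "integrable lborel (\<lambda>y. space_fun R y * space_fun R y)" by (intro integrable_space_fun_mult P R)+
  have tt: "time_cov t t = t powr (2 * H)" by (simp add: time_cov_def)
  have "(\<integral>\<omega>. (N (lift_step t P) \<omega> - N (lift_step t R) \<omega>)\<^sup>2 \<partial>M)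
      = (\<integral>\<omega>. N (lift_step t P) \<omega> * N (lift_step t P) \<omega> - 2 * (N (lift_step t P) \<omega> * N (lift_step t R) \<omega>) + N (lift_step t R) \<omega> * N (lift_step t R) \<omega> \<partial>M)"
    by (intro Bochner_Integration.integral_cong) (auto simp: power2_eq_square algebra_simps)
  also have "\<dots> = t powr (2 * H) * ((LINT y|lborel. space_fun P y * space_fun P y) - 2 * (LINT y|lborel. space_fun P y * space_fun R y) + (LINT y|lborel. space_fun R y * space_fun R y))"
    using i by (simp add: expectation_lift_lift[OF P t P t] expectation_lift_lift[OF P t R t]
        expectation_lift_lift[OF R t R t] tt distrib_left right_diff_distrib)
  also have "\<dots> = t powr (2 * H) * (LINT y|lborel. space_fun P y * space_fun P y - 2 * (space_fun P y * space_fun R y) + space_fun R y * space_fun R y)"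
    using j by simp
  also have "\<dots> = t powr (2 * H) * (LINT y|lborel. (space_fun P y - space_fun R y)\<^sup>2)"
    by (intro arg_cong2[where f = "(*)"] refl Bochner_Integration.integral_cong) (auto simp: power2_eq_square algebra_simps)
  finally show ?thesis .
qed

text \<open>The increment is itself the noise of a step function, hence Gaussian, and its eighth
  moment is determined by its variance, the squared L2 norm times |t - s|^(2H).\<close>

lemma lift_increment_moment:
  assumes P: "is_space_step P" and t: "t \<in> {0..T}" and s: "s \<in> {0..T}"
  shows "(\<integral>\<^sup>+\<omega>. ennreal (\<bar>N (lift_step t P) \<omega> - N (lift_step s P) \<omega>\<bar> ^ 8) \<partial>M)
    = ennreal (105 * ((LINT y|lborel. (space_fun P y)\<^sup>2) * \<bar>t - s\<bar> powr (2 * H)) ^ 4)"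
proof -
  note st = is_step_lift[OF P t] is_step_lift[OF P s]
  have i: "integrable M (\<lambda>\<omega>. N (lift_step t P) \<omega> * N (lift_step t P) \<omega>)" "integrable M (\<lambda>\<omega>. N (lift_step t P) \<omega> * N (lift_step s P) \<omega>)"
    "integrable M (\<lambda>\<omega>. N (lift_step s P) \<omega> * N (lift_step s P) \<omega>)"
    by (intro N_mult_integrable st)+
  have step: "is_step T (lift_step t P @ step_scale (-1) (lift_step s P))" using st by simp
  have "(\<integral>\<omega>. (N (lift_step t P) \<omega> - N (lift_step s P) \<omega>)\<^sup>2 \<partial>M)
      = (\<integral>\<omega>. N (lift_step t P) \<omega> * N (lift_step t P) \<omega> - 2 * (N (lift_step t P) \<omega> * N (lift_step s P) \<omega>) + N (lift_step s P) \<omega> * N (lift_step s P) \<omega> \<partial>M)"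
    by (intro Bochner_Integration.integral_cong) (auto simp: power2_eq_square algebra_simps)
  also have "\<dots> = (time_cov t t - 2 * time_cov t s + time_cov s s) * (LINT y|lborel. space_fun P y * space_fun P y)"
    using i by (simp add: expectation_lift_lift[OF P t P t] expectation_lift_lift[OF P t P s]
        expectation_lift_lift[OF P s P s] distrib_right left_diff_distrib)
  also have "time_cov t t - 2 * time_cov t s + time_cov s s = \<bar>t - s\<bar> powr (2 * H)" by (simp add: time_cov_def field_simps)
  finally have "(\<integral>\<omega>. (N (lift_step t P) \<omega> - N (lift_step s P) \<omega>)\<^sup>2 \<partial>M) = (LINT y|lborel. (space_fun P y)\<^sup>2) * \<bar>t - s\<bar> powr (2 * H)"
    by (simp add: power2_eq_square mult.commute)
  thus ?thesis using centered_gaussian_moments(2)[OF gaussian_step[OF step]] by simp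
qed

end

text \<open>Cell j collects the points of D whose level-n grid point is pi j/2^n, and a is sampled
  there. The index 2^n is attained only at y = pi, which accounts for 2^n + 1 entries.\<close>

definition space_approx :: "(real \<Rightarrow> real) \<Rightarrow> nat \<Rightarrow> space_step" where
  "space_approx a n = map (\<lambda>j. (a (pi * real j / 2 ^ n), {y \<in> D. nat \<lfloor>2 ^ n * y / pi\<rfloor> = j})) [0..<Suc (2 ^ n)]"

lemma is_space_step_approx: "is_space_step (space_approx a n)"
proof -
  have "{y \<in> D. nat \<lfloor>2 ^ n * y / pi\<rfloor> = j} \<in> sets borel" for j by measurable
  thus ?thesis by (auto simp: is_space_step_def space_approx_def)
qed

lemma space_fun_approx: "space_fun (space_approx a n) y = (if y \<in> D then a (dyadic pi n y) else 0)"
proof (cases "y \<in> D")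
  case True
  define k where "k = nat \<lfloor>2 ^ n * y / pi\<rfloor>"
  have k: "k < Suc (2 ^ n)" unfolding k_def less_Suc_eq_le by (rule dyadic_bounds(3)[OF pi_gt_zero True])
  have "space_fun (space_approx a n) y = (\<Sum>j<Suc (2 ^ n). a (pi * real j / 2 ^ n) * indicator {y \<in> D. nat \<lfloor>2 ^ n * y / pi\<rfloor> = j} y)"
    unfolding space_fun_def space_approx_def
    by (simp add: interv_sum_list_conv_sum_set_nat comp_def atLeast0LessThan del: upt_Suc)
  also have "\<dots> = (\<Sum>j<Suc (2 ^ n). if j = k then a (pi * real j / 2 ^ n) else 0)"
    using True by (intro sum.cong) (auto simp: k_def)
  also have "\<dots> = a (pi * real k / 2 ^ n)"
    using k by (simp only: sum.delta finite_lessThan lessThan_iff if_True)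
  also have "\<dots> = a (dyadic pi n y)" by (simp add: dyadic_def k_def)
  finally show ?thesis using True by simp
next
  case False
  have "space_fun (space_approx a n) y = (\<Sum>j<Suc (2 ^ n). a (pi * real j / 2 ^ n) * indicator {y \<in> D. nat \<lfloor>2 ^ n * y / pi\<rfloor> = j} y)"
    unfolding space_fun_def space_approx_def
    by (simp add: interv_sum_list_conv_sum_set_nat comp_def atLeast0LessThan del: upt_Suc)
  also have "\<dots> = 0" using False by (intro sum.neutral) auto
  finally show ?thesis unfolding if_not_P[OF False] .
qed

section \<open>Processes obtained from Lipschitz functions of space\<close>

context fractional_noise_space
begin

text \<open>By the Lipschitz bound, the noises of the step approximations at levels n and m >= n
  differ by O(2^(-n)) in L2; this rate is summable and gives almost sure convergence for each t. As
  |a| <= 1 and D has length pi, every approximation has squared L2 norm at most pi, and Fatou's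
  lemma carries the bound 105 (pi |t - s|^(2H))^4 to the limit.\<close>

lemma space_time_process:
  fixes a :: "real \<Rightarrow> real"
  assumes a1: "\<And>x. \<bar>a x\<bar> \<le> 1" and L: "L \<ge> 0" "\<And>x y. \<bar>a x - a y\<bar> \<le> L * \<bar>x - y\<bar>"
  obtains B where
    "\<And>t. t \<in> {0..T} \<Longrightarrow> wiener (\<lambda>(y, r). a y * indicator {0..t} r) (B t)"
    "\<And>s t. s \<in> {0..T} \<Longrightarrow> t \<in> {0..T} \<Longrightarrow>
      (\<integral>\<^sup>+\<omega>. ennreal (\<bar>B t \<omega> - B s \<omega>\<bar> ^ 8) \<partial>M) \<le> ennreal (105 * pi ^ 4 * \<bar>t - s\<bar> powr (8 * H))"
proof -
  define P where "P n = space_approx a n" for n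
  define X where "X n t = N (lift_step t (P n))" for n t
  define B where "B t \<omega> = lim (\<lambda>n. X n t \<omega>)" for t \<omega>
  \<comment> \<open>Two approximations of level at least n differ by at most 2 L pi/2^n. Squaring,
    integrating over D and multiplying by the time factor gives K times 4^(-n).\<close>
  define K where "K = T powr (2 * H) * (pi * (2 * L * pi)\<^sup>2)"
  have K: "K \<ge> 0" by (simp add: K_def)
  have P: "is_space_step (P n)" for n unfolding P_def by (rule is_space_step_approx)
  have Xm [measurable]: "X n t \<in> borel_measurable M" if "t \<in> {0..T}" for n t
    unfolding X_def by (intro N_meas is_step_lift P that)
  have Pa: "\<bar>space_fun (P n) y - a y\<bar> \<le> L * pi / 2 ^ n" if y: "y \<in> D" for n y
  proof -
    have "\<bar>space_fun (P n) y - a y\<bar> \<le> L * \<bar>dyadic pi n y - y\<bar>"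
      unfolding P_def space_fun_approx if_P[OF y] by (rule L(2))
    also have "\<dots> \<le> L * (pi / 2 ^ n)" by (intro mult_left_mono dyadic_bounds pi_gt_zero y L)
    finally show ?thesis by simp
  qed
  have P0: "space_fun (P n) y = 0" if "y \<notin> D" for n y using that by (simp add: P_def space_fun_approx del: atLeastAtMost_iff)
  have sq_le: "(LINT y|lborel. (g y)\<^sup>2) \<le> pi * C\<^sup>2"
    if g: "g \<in> borel_measurable borel" "\<And>y. y \<in> D \<Longrightarrow> \<bar>g y\<bar> \<le> C" "\<And>y. y \<notin> D \<Longrightarrow> g y = 0" for g :: "real \<Rightarrow> real" and C
  proof -
    have "(LINT y|lborel. (g y)\<^sup>2) \<le> (LINT y|lborel. indicator D y * C\<^sup>2)"
    proof (rule integral_mono')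
      show "integrable lborel (\<lambda>y. indicator D y * C\<^sup>2)" by simp
      show "(g y)\<^sup>2 \<le> indicator D y * C\<^sup>2" for y
        using g(2,3)[of y] power_mono[of "\<bar>g y\<bar>" C 2] by (cases "y \<in> D") (auto simp del: atLeastAtMost_iff)
    qed simp
    thus ?thesis by simp
  qed
  have Pm: "space_fun (P n) \<in> borel_measurable borel" for n
    using integrable_space_fun_mult[OF P[of n], of "[(1, D)]"]
  proof -
    have "integrable lborel (\<lambda>y. space_fun (P n) y * space_fun [(1, D)] y)"
      by (intro integrable_space_fun_mult P) auto
    hence "(\<lambda>y. space_fun (P n) y * indicator D y) \<in> borel_measurable borel" by simp
    moreover have "(\<lambda>y. space_fun (P n) y * indicator D y) = space_fun (P n)"
      by (rule ext) (use P0 in \<open>auto simp: indicator_def simp del: atLeastAtMost_iff\<close>)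
    ultimately show ?thesis by simp
  qed
  have XX: "L2_dist (X n t) (X m t) \<le> ennreal (K * (1 / 4) ^ n)" if t: "t \<in> {0..T}" and nm: "n \<le> m" for n m t
  proof -
    have st: "is_step T (lift_step t (P n))" for n by (intro is_step_lift P t)
    have "integrable M (\<lambda>\<omega>. (X n t \<omega> + (-1) * X m t \<omega>)\<^sup>2)"
      unfolding X_def by (intro integrable_add_square N_meas N_square_integrable st)
    hence "L2_dist (X n t) (X m t) = ennreal (\<integral>\<omega>. (X n t \<omega> - X m t \<omega>)\<^sup>2 \<partial>M)"
      unfolding L2_dist_def by (intro nn_integral_eq_integral) auto
    also have "(\<integral>\<omega>. (X n t \<omega> - X m t \<omega>)\<^sup>2 \<partial>M) = t powr (2 * H) * (LINT y|lborel. (space_fun (P n) y - space_fun (P m) y)\<^sup>2)"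
      unfolding X_def by (rule expectation_lift_diff_square[OF P P t])
    also have "(LINT y|lborel. (space_fun (P n) y - space_fun (P m) y)\<^sup>2) \<le> pi * (2 * L * pi / 2 ^ n)\<^sup>2"
    proof (rule sq_le)
      fix y assume y: "y \<in> D"
      have "L * pi / 2 ^ m \<le> L * pi / 2 ^ n" using L nm by (intro divide_left_mono mult_nonneg_nonneg power_increasing) auto
      with Pa[OF y, of n] Pa[OF y, of m]
      have "\<bar>space_fun (P n) y - space_fun (P m) y\<bar> \<le> L * pi / 2 ^ n + L * pi / 2 ^ n" by linarith
      thus "\<bar>space_fun (P n) y - space_fun (P m) y\<bar> \<le> 2 * L * pi / 2 ^ n" by simp
    qed (use P0 Pm in auto)
    hence "t powr (2 * H) * (LINT y|lborel. (space_fun (P n) y - space_fun (P m) y)\<^sup>2) \<le> T powr (2 * H) * (pi * (2 * L * pi / 2 ^ n)\<^sup>2)"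
      using t H_gt by (intro mult_mono powr_mono2) auto
    also have "\<dots> = K * (1 / 4) ^ n"
    proof -
      have "(2 ^ n :: real)\<^sup>2 = 4 ^ n" by (simp add: power2_eq_square flip: power_mult_distrib)
      thus ?thesis by (simp add: K_def power_divide)
    qed
    finally show ?thesis by (simp add: ennreal_leI)
  qed
  have lim: "AE \<omega> in M. (\<lambda>n. X n t \<omega>) \<longlonglongrightarrow> B t \<omega>" if t: "t \<in> {0..T}" for t
  proof -
    have dm: "(\<lambda>\<omega>. ennreal \<bar>X n t \<omega> - X (Suc n) t \<omega>\<bar>) \<in> borel_measurable M" for n
      by (intro measurable_compose[OF _ measurable_ennreal] borel_measurable_abs borel_measurable_diff Xm t)
    have dm2: "(\<lambda>\<omega>. ennreal ((X n t \<omega> - X (Suc n) t \<omega>)\<^sup>2)) \<in> borel_measurable M" for n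
      by (intro measurable_compose[OF _ measurable_ennreal] borel_measurable_power borel_measurable_diff Xm t)
    have d: "(\<integral>\<^sup>+\<omega>. ennreal \<bar>X n t \<omega> - X (Suc n) t \<omega>\<bar> \<partial>M) \<le> ennreal ((K + 1) * (1 / 2) ^ n)" for n
    proof -
      \<comment> \<open>Young's inequality with weight 2^n trades the rate 4^(-n) of the squared
        distance for the rate 2^(-n) of the first absolute moment.\<close>
      have y: "\<bar>x\<bar> \<le> 2 ^ n * x\<^sup>2 + (1 / 2) ^ n" for x :: real
      proof -
        have "2 * (2 ^ n * \<bar>x\<bar>) \<le> (2 ^ n * \<bar>x\<bar>)\<^sup>2 + 1" using sum_squares_bound[of "2 ^ n * \<bar>x\<bar>" 1] by simp
        moreover have "0 \<le> 2 ^ n * \<bar>x\<bar>" by simp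
        ultimately have "2 ^ n * \<bar>x\<bar> \<le> (2 ^ n * \<bar>x\<bar>)\<^sup>2 + 1" by linarith
        also have "\<dots> = 2 ^ n * (2 ^ n * x\<^sup>2 + (1 / 2) ^ n)"
          by (simp add: distrib_left power_mult_distrib power2_eq_square power_one_over)
        finally show ?thesis by (simp only: mult_le_cancel_left_pos zero_less_power zero_less_numeral)
      qed
      have "(\<integral>\<^sup>+\<omega>. ennreal \<bar>X n t \<omega> - X (Suc n) t \<omega>\<bar> \<partial>M) \<le> (\<integral>\<^sup>+\<omega>. ennreal (2 ^ n) * ennreal ((X n t \<omega> - X (Suc n) t \<omega>)\<^sup>2) + ennreal ((1 / 2) ^ n) \<partial>M)"
      proof (rule nn_integral_mono)
        fix \<omega>
        have "ennreal (2 ^ n) * ennreal ((X n t \<omega> - X (Suc n) t \<omega>)\<^sup>2) + ennreal ((1 / 2) ^ n) = ennreal (2 ^ n * (X n t \<omega> - X (Suc n) t \<omega>)\<^sup>2 + (1 / 2) ^ n)"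
          by (subst ennreal_plus) (auto simp: ennreal_mult)
        thus "ennreal \<bar>X n t \<omega> - X (Suc n) t \<omega>\<bar> \<le> ennreal (2 ^ n) * ennreal ((X n t \<omega> - X (Suc n) t \<omega>)\<^sup>2) + ennreal ((1 / 2) ^ n)"
          using ennreal_leI[OF y] by simp
      qed
      also have "\<dots> = ennreal (2 ^ n) * L2_dist (X n t) (X (Suc n) t) + ennreal ((1 / 2) ^ n)"
        unfolding L2_dist_def using dm2 by (simp add: nn_integral_add nn_integral_cmult emeasure_space_1)
      also have "\<dots> \<le> ennreal (2 ^ n) * ennreal (K * (1 / 4) ^ n) + ennreal ((1 / 2) ^ n)"
        by (intro add_right_mono mult_left_mono XX t) auto
      also have "\<dots> = ennreal (2 ^ n * (K * (1 / 4) ^ n) + (1 / 2) ^ n)"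
        using K by (subst ennreal_plus) (auto simp: ennreal_mult)
      also have "2 ^ n * (K * (1 / 4) ^ n) + (1 / 2) ^ n = (K + 1) * (1 / 2) ^ n"
      proof -
        have "(2::real) ^ n * (1 / 4) ^ n = (1 / 2) ^ n" by (simp flip: power_mult_distrib)
        thus ?thesis by (simp add: distrib_right mult.left_commute)
      qed
      finally show ?thesis .
    qed
    have "(\<integral>\<^sup>+\<omega>. (\<Sum>n. ennreal \<bar>X n t \<omega> - X (Suc n) t \<omega>\<bar>) \<partial>M) = (\<Sum>n. \<integral>\<^sup>+\<omega>. ennreal \<bar>X n t \<omega> - X (Suc n) t \<omega>\<bar> \<partial>M)"
      by (rule nn_integral_suminf[OF dm])
    also have "\<dots> \<le> (\<Sum>n. ennreal ((K + 1) * (1 / 2) ^ n))" by (rule suminf_le[OF d]) auto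
    also have "\<dots> = ennreal (\<Sum>n. (K + 1) * (1 / 2) ^ n)"
      using K by (intro suminf_ennreal2) (auto intro!: summable_mult summable_geometric)
    also have "\<dots> < \<infinity>" by simp
    finally have "AE \<omega> in M. (\<Sum>n. ennreal \<bar>X n t \<omega> - X (Suc n) t \<omega>\<bar>) \<noteq> \<infinity>"
      by (intro nn_integral_PInf_AE borel_measurable_suminf_order dm) auto
    thus ?thesis
    proof eventually_elim
      case (elim \<omega>)
      have "summable (\<lambda>n. \<bar>X n t \<omega> - X (Suc n) t \<omega>\<bar>)" using elim by (intro summable_suminf_not_top) auto
      hence "summable (\<lambda>n. \<bar>X (Suc n) t \<omega> - X n t \<omega>\<bar>)" by (simp add: abs_minus_commute)
      hence "summable (\<lambda>n. X (Suc n) t \<omega> - X n t \<omega>)" by (rule summable_rabs_cancel)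
      hence "convergent (\<lambda>n. \<Sum>i<n. X (Suc i) t \<omega> - X i t \<omega>)" by (simp add: summable_iff_convergent)
      hence "convergent (\<lambda>n. X n t \<omega> - X 0 t \<omega>)" by (simp add: sum_lessThan_telescope[of "\<lambda>i. X i t \<omega>"])
      from convergent_add[OF this convergent_const[of "X 0 t \<omega>"]]
      have "convergent (\<lambda>n. X n t \<omega>)" by simp
      thus ?case by (simp add: B_def convergent_LIMSEQ_iff)
    qed
  qed
  have Bm: "B t \<in> borel_measurable M" if t: "t \<in> {0..T}" for t
    unfolding B_def [abs_def] by (intro borel_measurable_lim_metric Xm t)
  have XB: "L2_dist (X n t) (B t) \<le> ennreal (K * (1 / 4) ^ n)" if t: "t \<in> {0..T}" for n t
    unfolding L2_dist_def
  proof (rule nn_integral_limit_le[where f = "\<lambda>m \<omega>. ennreal ((X n t \<omega> - X m t \<omega>)\<^sup>2)" and k = n])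
    show "(\<lambda>\<omega>. ennreal ((X n t \<omega> - X m t \<omega>)\<^sup>2)) \<in> borel_measurable M" for m
      by (intro measurable_compose[OF _ measurable_ennreal] borel_measurable_power borel_measurable_diff Xm t)
    show "AE \<omega> in M. (\<lambda>m. ennreal ((X n t \<omega> - X m t \<omega>)\<^sup>2)) \<longlonglongrightarrow> ennreal ((X n t \<omega> - B t \<omega>)\<^sup>2)"
      using lim[OF t]
    proof eventually_elim
      case (elim \<omega>)
      show ?case by (intro tendsto_ennrealI tendsto_power tendsto_diff tendsto_const elim)
    qed
    show "(\<integral>\<^sup>+\<omega>. ennreal ((X n t \<omega> - X m t \<omega>)\<^sup>2) \<partial>M) \<le> ennreal (K * (1 / 4) ^ n)" if "m \<ge> n" for m
      using XX[OF t that] by (simp add: L2_dist_def)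
  qed
  have pow0: "(\<lambda>n. ennreal (C * q ^ n)) \<longlonglongrightarrow> 0" if "0 \<le> q" "q < 1" for C q :: real
  proof -
    have "(\<lambda>n. C * q ^ n) \<longlonglongrightarrow> C * 0" using that by (intro tendsto_intros LIMSEQ_realpow_zero)
    from tendsto_ennrealI[OF this] show ?thesis by simp
  qed
  show ?thesis
  proof (rule that[of B])
    fix t assume t: "t \<in> {0..T}"
    have am: "a \<in> borel_measurable borel"
    proof (intro borel_measurable_continuous_onI)
      have "L-lipschitz_on UNIV a" using L by (auto simp: lipschitz_on_def dist_real_def)
      thus "continuous_on UNIV a" by (rule lipschitz_on_continuous_on)
    qed
    show "wiener (\<lambda>(y, r). a y * indicator {0..t} r) (B t)"
    proof (rule wiener_LIMSEQ[where \<phi>' = "\<lambda>n. step_fun (lift_step t (P n))" and X' = "\<lambda>n. X n t"])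
      show "B t \<in> borel_measurable M" by (rule Bm[OF t])
      show "Q_meas (\<lambda>(y, r). a y * indicator {0..t} r)"
      proof (rule Q_meas_borel)
        have "(\<lambda>z. a (fst z) * indicator {0..t} (snd z)) \<in> borel_measurable (borel \<Otimes>\<^sub>M borel)"
          using am by measurable
        thus "(\<lambda>(y, r). a y * indicator {0..t} r) \<in> borel_measurable borel" by (simp add: case_prod_beta' borel_prod)
      qed
      show "wiener (step_fun (lift_step t (P n))) (X n t)" for n
        unfolding X_def by (intro wiener_step is_step_lift P t)
      show "(\<lambda>n. L2_dist (X n t) (B t)) \<longlonglongrightarrow> 0"
        by (rule tendsto_sandwich[OF _ _ tendsto_const pow0[of "1 / 4" K]]) (use XB[OF t] in auto)
      have "L1_dist (step_fun (lift_step t (P n))) (\<lambda>(y, r). a y * indicator {0..t} r) \<le> ennreal ((L * pi) * (pi * T) * (1 / 2) ^ n)" for n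
      proof -
        have "L1_dist (step_fun (lift_step t (P n))) (\<lambda>(y, r). a y * indicator {0..t} r) \<le> (\<integral>\<^sup>+z. ennreal (L * pi / 2 ^ n) * indicator Q z \<partial>lborel)"
          unfolding L1_dist_def
        proof (rule nn_integral_mono)
          fix z :: "real \<times> real"
          obtain y r where z: "z = (y, r)" by (cases z)
          have "\<bar>indicator Q z * step_fun (lift_step t (P n)) z - indicator Q z * (case z of (y, r) \<Rightarrow> a y * indicator {0..t} r)\<bar> \<le> L * pi / 2 ^ n * indicator Q z"
          proof (cases "z \<in> Q")
            case True
            hence y: "y \<in> D" by (auto simp: z)
            have "\<bar>space_fun (P n) y * indicator {0..t} r - a y * indicator {0..t} r\<bar> = \<bar>space_fun (P n) y - a y\<bar> * indicator {0..t} r"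
              by (simp add: abs_mult flip: left_diff_distrib)
            also have "\<dots> \<le> L * pi / 2 ^ n * 1" using Pa[OF y, of n] L by (intro mult_mono) (auto simp: indicator_def)
            finally show ?thesis using True by (simp add: z step_fun_lift)
          qed simp
          thus "ennreal \<bar>indicator Q z * step_fun (lift_step t (P n)) z - indicator Q z * (case z of (y, r) \<Rightarrow> a y * indicator {0..t} r)\<bar> \<le> ennreal (L * pi / 2 ^ n) * indicator Q z"
            by (auto simp: indicator_def ennreal_leI split: if_splits)
        qed
        also have "\<dots> = ennreal (L * pi / 2 ^ n) * emeasure lborel Q" by (rule nn_integral_cmult_indicator) simp
        also have "emeasure lborel Q = ennreal (pi * T)"
          unfolding lborel_prod[symmetric] using T_pos
          by (subst lborel.emeasure_pair_measure_Times) (auto simp: ennreal_mult)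
        also have "ennreal (L * pi / 2 ^ n) * ennreal (pi * T) = ennreal ((L * pi) * (pi * T) * (1 / 2) ^ n)"
          using L T_pos by (subst ennreal_mult[symmetric]) (auto simp: power_one_over)
        finally show ?thesis .
      qed
      thus "(\<lambda>n. L1_dist (step_fun (lift_step t (P n))) (\<lambda>(y, r). a y * indicator {0..t} r)) \<longlonglongrightarrow> 0"
        by (intro tendsto_sandwich[OF _ _ tendsto_const pow0[of "1 / 2" "L * pi * (pi * T)"]]) auto
    qed
  next
    fix s t assume s: "s \<in> {0..T}" and t: "t \<in> {0..T}"
    show "(\<integral>\<^sup>+\<omega>. ennreal (\<bar>B t \<omega> - B s \<omega>\<bar> ^ 8) \<partial>M) \<le> ennreal (105 * pi ^ 4 * \<bar>t - s\<bar> powr (8 * H))"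
    proof (rule nn_integral_limit_le[where f = "\<lambda>m \<omega>. ennreal (\<bar>X m t \<omega> - X m s \<omega>\<bar> ^ 8)" and k = 0])
      show "(\<lambda>\<omega>. ennreal (\<bar>X m t \<omega> - X m s \<omega>\<bar> ^ 8)) \<in> borel_measurable M" for m
        by (intro measurable_compose[OF _ measurable_ennreal] borel_measurable_power borel_measurable_abs borel_measurable_diff Xm t s)
      show "AE \<omega> in M. (\<lambda>m. ennreal (\<bar>X m t \<omega> - X m s \<omega>\<bar> ^ 8)) \<longlonglongrightarrow> ennreal (\<bar>B t \<omega> - B s \<omega>\<bar> ^ 8)"
        using lim[OF t] lim[OF s]
      proof eventually_elim
        case (elim \<omega>)
        show ?case by (intro tendsto_ennrealI tendsto_power tendsto_rabs tendsto_diff elim)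
      qed
      fix m
      have "(LINT y|lborel. (space_fun (P m) y)\<^sup>2) \<le> pi * 1\<^sup>2"
      proof (rule sq_le[OF Pm _ P0])
        fix y assume y: "y \<in> D"
        show "\<bar>space_fun (P m) y\<bar> \<le> 1" unfolding P_def space_fun_approx if_P[OF y] by (rule a1)
      qed
      hence "((LINT y|lborel. (space_fun (P m) y)\<^sup>2) * \<bar>t - s\<bar> powr (2 * H)) ^ 4 \<le> (pi * \<bar>t - s\<bar> powr (2 * H)) ^ 4"
        by (intro power_mono mult_right_mono) auto
      also have "\<dots> = pi ^ 4 * \<bar>t - s\<bar> powr (8 * H)"
      proof (cases "t = s")
        case False
        hence "(\<bar>t - s\<bar> powr (2 * H)) ^ 4 = (\<bar>t - s\<bar> powr (2 * H)) powr real 4" by (subst powr_realpow) auto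
        also have "\<dots> = \<bar>t - s\<bar> powr (2 * H * real 4)" by (rule powr_powr)
        finally show ?thesis by (simp add: power_mult_distrib)
      qed simp
      finally show "(\<integral>\<^sup>+\<omega>. ennreal (\<bar>X m t \<omega> - X m s \<omega>\<bar> ^ 8) \<partial>M) \<le> ennreal (105 * pi ^ 4 * \<bar>t - s\<bar> powr (8 * H))"
        unfolding X_def lift_increment_moment[OF P t s] by (intro ennreal_leI) simp
    qed
  qed
qed

text \<open>The moment constant of \<open>space_time_process\<close> times that of Kolmogorov's
  criterion with gamma = 3/8, b = 8 H - 1 and q = 8. It does not involve k, and the control of all
  modes by one random constant rests on that.\<close>

definition mode_const :: real where
  "mode_const = 105 * pi ^ 4 * kolmogorov_const T (3 / 8) (8 * H - 1) 8"

text \<open>Since \<open>8 H - 1 > 3\<close>, Kolmogorov's criterion with eighth moments gives the exponent \<open>3/8\<close>.\<close>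

lemma mode_process:
  obtains B K where
    "\<And>t. t \<in> {0..T} \<Longrightarrow> wiener (\<lambda>(y, r). mode k y * indicator {0..t} r) (B t)"
    "K \<in> borel_measurable M" "\<And>\<omega>. K \<omega> \<ge> 0"
    "\<And>s t \<omega>. s \<in> {0..T} \<Longrightarrow> t \<in> {0..T} \<Longrightarrow> \<bar>B t \<omega> - B s \<omega>\<bar> \<le> K \<omega> * \<bar>t - s\<bar> powr (3 / 8)"
    "(\<integral>\<^sup>+\<omega>. ennreal (K \<omega> ^ 8) \<partial>M) \<le> ennreal mode_const"
proof -
  have pre: "(0::nat) < 8" "0 < (3 / 8 :: real)" "3 / 8 * real 8 < 8 * H - 1" "0 \<le> 105 * pi ^ 4"
    using H_gt by simp_all
  show thesis
  proof (rule space_time_process[of "mode k" "real k", OF abs_mode_le of_nat_0_le_iff mode_lipschitz])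
  fix X :: "real \<Rightarrow> 'a \<Rightarrow> real"
  assume X: "\<And>t. t \<in> {0..T} \<Longrightarrow> wiener (\<lambda>(y, r). mode k y * indicator {0..t} r) (X t)"
    "\<And>s t. s \<in> {0..T} \<Longrightarrow> t \<in> {0..T} \<Longrightarrow>
      (\<integral>\<^sup>+\<omega>. ennreal (\<bar>X t \<omega> - X s \<omega>\<bar> ^ 8) \<partial>M) \<le> ennreal (105 * pi ^ 4 * \<bar>t - s\<bar> powr (8 * H))"
  have mom: "(\<integral>\<^sup>+\<omega>. ennreal (\<bar>X t \<omega> - X s \<omega>\<bar> ^ 8) \<partial>M) \<le> ennreal (105 * pi ^ 4 * \<bar>t - s\<bar> powr (1 + (8 * H - 1)))"
    if "s \<in> {0..T}" "t \<in> {0..T}" for s t using X(2)[OF that] by simp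
  show thesis
  proof (rule kolmogorov_hoelder[OF T_pos pre wiener_meas(1)[OF X(1)] mom])
    fix Y :: "real \<Rightarrow> 'a \<Rightarrow> real" and K :: "'a \<Rightarrow> real"
    assume Ym: "\<And>t. t \<in> {0..T} \<Longrightarrow> Y t \<in> borel_measurable M" and Km: "K \<in> borel_measurable M"
      and K0: "\<And>\<omega>. K \<omega> \<ge> 0"
      and hoelder: "\<And>s t \<omega>. s \<in> {0..T} \<Longrightarrow> t \<in> {0..T} \<Longrightarrow> \<bar>Y t \<omega> - Y s \<omega>\<bar> \<le> K \<omega> * \<bar>t - s\<bar> powr (3 / 8)"
      and eq: "\<And>t. t \<in> {0..T} \<Longrightarrow> AE \<omega> in M. Y t \<omega> = X t \<omega>"
      and Kq: "(\<integral>\<^sup>+\<omega>. ennreal (K \<omega> ^ 8) \<partial>M) \<le> ennreal (105 * pi ^ 4 * kolmogorov_const T (3 / 8) (8 * H - 1) 8)"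
    \<comment> \<open>The Hoelder continuous modification differs from X t on a null set for each t,
      so it represents the same Wiener integral.\<close>
    have w: "wiener (\<lambda>(y, r). mode k y * indicator {0..t} r) (Y t)" if t: "t \<in> {0..T}" for t
    proof (rule wiener_cong_AE[OF X(1)[OF t] Ym[OF t] _ wiener_meas(2)[OF X(1)[OF t]]])
      show "AE \<omega> in M. X t \<omega> = Y t \<omega>" using eq[OF t] by eventually_elim simp
    qed simp
    have Kq': "(\<integral>\<^sup>+\<omega>. ennreal (K \<omega> ^ 8) \<partial>M) \<le> ennreal mode_const"
      unfolding mode_const_def by (rule Kq)
    show thesis
    proof (rule that[of Y K])
      show "wiener (\<lambda>(y, r). mode k y * indicator {0..t} r) (Y t)" if "t \<in> {0..T}" for t by (rule w[OF that])
      show "K \<in> borel_measurable M" by (rule Km)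
      show "K \<omega> \<ge> 0" for \<omega> by (rule K0)
      show "\<bar>Y t \<omega> - Y s \<omega>\<bar> \<le> K \<omega> * \<bar>t - s\<bar> powr (3 / 8)" if "s \<in> {0..T}" "t \<in> {0..T}" for s t \<omega>
        by (rule hoelder[OF that])
      show "(\<integral>\<^sup>+\<omega>. ennreal (K \<omega> ^ 8) \<partial>M) \<le> ennreal mode_const" by (rule Kq')
    qed
  qed
  qed
qed

end

section \<open>Convolution with an exponential kernel\<close>

lemma exp_diff_le:
  fixes x y :: real
  assumes "x \<le> y" "y \<le> 0"
  shows "\<bar>exp y - exp x\<bar> \<le> y - x"
proof -
  have "exp y * (1 + (x - y)) \<le> exp y * exp (x - y)"
    using exp_ge_add_one_self[of "x - y"] by (intro mult_left_mono) auto
  also have "\<dots> = exp x" by (simp flip: exp_add)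
  finally have "exp y - exp x \<le> exp y * (y - x)" by (simp add: algebra_simps)
  also have "\<dots> \<le> 1 * (y - x)" using assms by (intro mult_right_mono) auto
  finally show ?thesis using assms by simp
qed

text \<open>With v = l r, v^gamma <= 1 + v <= 2 exp(v/2). Half of the exponential pays for the
  power, and the other half remains available for integration.\<close>

lemma exp_powr_bound:
  fixes l r \<gamma> :: real
  assumes l: "l > 0" and r: "r \<ge> 0" and \<gamma>: "0 \<le> \<gamma>" "\<gamma> \<le> 1"
  shows "exp (- (l * r)) * r powr \<gamma> \<le> 2 * l powr (- \<gamma>) * exp (- (l / 2 * r))"
proof -
  define v where "v = l * r"
  have v: "v \<ge> 0" using l r by (simp add: v_def)
  have "v powr \<gamma> \<le> 1 + v"
  proof (cases "v \<le> 1")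
    case True
    have "v powr \<gamma> \<le> 1 powr \<gamma>" using True v \<gamma> by (intro powr_mono2) auto
    thus ?thesis using v by simp
  next
    case False
    have "v powr \<gamma> \<le> v powr 1" using False \<gamma> by (intro powr_mono) auto
    thus ?thesis using False by simp
  qed
  also have "\<dots> \<le> 2 * exp (v / 2)" using exp_ge_add_one_self[of "v / 2"] v by linarith
  finally have "exp (- v) * v powr \<gamma> \<le> exp (- v) * (2 * exp (v / 2))" by (intro mult_left_mono) auto
  also have "\<dots> = 2 * exp (- (v / 2))" by (simp flip: exp_add)
  finally have le: "exp (- v) * v powr \<gamma> \<le> 2 * exp (- (v / 2))" .
  have "exp (- (l * r)) * r powr \<gamma> = l powr (- \<gamma>) * (exp (- v) * v powr \<gamma>)"
    unfolding v_def powr_mult using l by (simp add: powr_minus)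
  also have "\<dots> \<le> l powr (- \<gamma>) * (2 * exp (- (v / 2)))" by (intro mult_left_mono le) auto
  also have "\<dots> = 2 * l powr (- \<gamma>) * exp (- (l / 2 * r))" by (simp add: v_def)
  finally show ?thesis .
qed

lemma hoelder_continuous_on:
  fixes f :: "real \<Rightarrow> real"
  assumes \<gamma>: "\<gamma> > 0" and f: "\<And>s t. s \<in> A \<Longrightarrow> t \<in> A \<Longrightarrow> \<bar>f t - f s\<bar> \<le> K * \<bar>t - s\<bar> powr \<gamma>"
  shows "continuous_on A f"
  unfolding continuous_on_def
proof
  fix t assume t: "t \<in> A"
  have "((\<lambda>s. K * \<bar>s - t\<bar> powr \<gamma>) \<longlongrightarrow> K * 0) (at t within A)"
  proof (intro tendsto_mult tendsto_const)
    have "((\<lambda>s. \<bar>s - t\<bar>) \<longlongrightarrow> 0) (at t within A)"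
      by (intro tendsto_rabs_zero LIM_zero tendsto_ident_at)
    thus "((\<lambda>s. \<bar>s - t\<bar> powr \<gamma>) \<longlongrightarrow> 0) (at t within A)"
      by (rule tendsto_zero_powrI[OF _ tendsto_const]) (use \<gamma> in simp_all)
  qed
  hence lim: "((\<lambda>s. K * \<bar>s - t\<bar> powr \<gamma>) \<longlongrightarrow> 0) (at t within A)" by simp
  have "((\<lambda>s. f s - f t) \<longlongrightarrow> 0) (at t within A)"
    by (rule Lim_null_comparison[OF _ lim]) (use f t in \<open>simp_all add: eventually_at_filter\<close>)
  thus "(f \<longlongrightarrow> f t) (at t within A)" by (simp add: LIM_zero_iff)
qed

text \<open>The stochastic convolution of a path with the exponential kernel, written without stochastic
  integrals by partial integration.\<close>

definition ou_path :: "real \<Rightarrow> (real \<Rightarrow> real) \<Rightarrow> real \<Rightarrow> real" where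
  "ou_path l b t = exp (- (l * t)) * (b t - b 0) + l * integral {0..t} (\<lambda>s. exp (- (l * (t - s))) * (b t - b s))"

text \<open>The Riemann-Stieltjes sum of the kernel exp(-l (t - s)) against b on n equal cells of
  [0, t], with the kernel taken at the right end of each cell.\<close>

definition ou_sum :: "real \<Rightarrow> (real \<Rightarrow> real) \<Rightarrow> real \<Rightarrow> nat \<Rightarrow> real" where
  "ou_sum l b t n = (\<Sum>j<n. exp (- (l * (t - t * Suc j / n))) * (b (t * Suc j / n) - b (t * j / n)))"

lemma ou_path_continuous:
  assumes b: "continuous_on {0..T} b"
  shows "continuous_on {0..T} (ou_path l b)"
proof -
  define e where "e t = integral {0..t} (\<lambda>s. exp (- (l * (t - s))) * 1)" for t
  define c where "c t = integral {0..t} (\<lambda>s. exp (- (l * (t - s))) * b s)" for t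
  \<comment> \<open>Taking \<open>b t\<close> out of the integral leaves two exponential
    convolutions of continuous functions.\<close>
  have "continuous_on {0..T} (\<lambda>t. exp (- (l * t)) * (b t - b 0) + l * (b t * e t - c t))"
    unfolding e_def c_def by (intro continuous_intros continuous_on_exp_convolution b)
  moreover have "exp (- (l * t)) * (b t - b 0) + l * (b t * e t - c t) = ou_path l b t" if t: "t \<in> {0..T}" for t
  proof -
    have bt: "continuous_on {0..t} b" by (rule continuous_on_subset[OF b]) (use t in auto)
    have "integral {0..t} (\<lambda>s. exp (- (l * (t - s))) * (b t - b s)) = integral {0..t} (\<lambda>s. b t * (exp (- (l * (t - s))) * 1) - exp (- (l * (t - s))) * b s)"
      by (simp add: algebra_simps)
    also have "\<dots> = integral {0..t} (\<lambda>s. b t * (exp (- (l * (t - s))) * 1)) - c t"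
      unfolding c_def by (intro Henstock_Kurzweil_Integration.integral_diff integrable_continuous_interval continuous_intros bt)
    also have "integral {0..t} (\<lambda>s. b t * (exp (- (l * (t - s))) * 1)) = b t * e t"
      unfolding e_def by (rule Henstock_Kurzweil_Integration.integral_mult_right)
    finally show ?thesis by (simp add: ou_path_def)
  qed
  ultimately show ?thesis by (rule continuous_on_eq)
qed

text \<open>Subtracting \<open>b t\<close> puts (t - s)^gamma under the integral. Its convolution
  with the exponential has size l^(-gamma - 1), and the prefactor l leaves l^(-gamma). The constant
  is 4 from the integral plus 2 from the boundary term.\<close>

lemma ou_path_bound:
  assumes l: "l > 0" and t: "t \<in> {0..T}" and \<gamma>: "0 < \<gamma>" "\<gamma> \<le> 1" and K: "K \<ge> 0"
    and b: "\<And>s t. s \<in> {0..T} \<Longrightarrow> t \<in> {0..T} \<Longrightarrow> \<bar>b t - b s\<bar> \<le> K * \<bar>t - s\<bar> powr \<gamma>"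
  shows "\<bar>ou_path l b t\<bar> \<le> 6 * K * l powr (- \<gamma>)"
proof -
  define G where "G = l powr (- \<gamma>)"
  have G: "G \<ge> 0" by (simp add: G_def)
  have le: "\<bar>exp (- (l * (t - s))) * (b t - b s)\<bar> \<le> K * (2 * G * exp (- (l / 2 * (t - s))))" if s: "s \<in> {0..t}" for s
  proof -
    have "exp (- (l * (t - s))) * \<bar>b t - b s\<bar> \<le> exp (- (l * (t - s))) * (K * (t - s) powr \<gamma>)"
      using b[of s t] s t by (intro mult_left_mono) auto
    also have "\<dots> = K * (exp (- (l * (t - s))) * (t - s) powr \<gamma>)" by simp
    also have "\<dots> \<le> K * (2 * G * exp (- (l / 2 * (t - s))))"
      unfolding G_def using s \<gamma> l K by (intro mult_left_mono exp_powr_bound) auto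
    finally show ?thesis by (simp add: abs_mult)
  qed
  have bt: "continuous_on {0..t} b"
    by (rule continuous_on_subset[OF hoelder_continuous_on[where A = "{0..T}", OF \<gamma>(1) b]]) (use t in auto)
  have "norm (integral {0..t} (\<lambda>s. exp (- (l * (t - s))) * (b t - b s))) \<le> integral {0..t} (\<lambda>s. K * (2 * G * exp (- (l / 2 * (t - s)))))"
    by (intro integral_norm_bound_integral integrable_continuous_interval continuous_intros bt) (use le in auto)
  also have "\<dots> = K * (2 * G * ((1 - exp (- (l / 2 * t))) / (l / 2)))"
    using exp_convolution_has_integral[of "l / 2" t] l t by (simp add: integral_unique)
  also have "\<dots> \<le> K * (2 * G * (1 / (l / 2)))"
    using K G l by (intro mult_left_mono divide_right_mono) auto
  finally have "\<bar>integral {0..t} (\<lambda>s. exp (- (l * (t - s))) * (b t - b s))\<bar> \<le> K * (2 * G * (1 / (l / 2)))" by simp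
  hence "l * \<bar>integral {0..t} (\<lambda>s. exp (- (l * (t - s))) * (b t - b s))\<bar> \<le> l * (K * (2 * G * (1 / (l / 2))))"
    using l by (intro mult_left_mono) auto
  also have "\<dots> = 4 * K * G" using l by simp
  finally have 1: "\<bar>l * integral {0..t} (\<lambda>s. exp (- (l * (t - s))) * (b t - b s))\<bar> \<le> 4 * K * G" using l by (simp add: abs_mult)
  have "\<bar>exp (- (l * (t - 0))) * (b t - b 0)\<bar> \<le> K * (2 * G * exp (- (l / 2 * (t - 0))))" by (rule le) (use t in auto)
  also have "\<dots> \<le> K * (2 * G * 1)" using K G l t by (intro mult_left_mono) auto
  finally have 2: "\<bar>exp (- (l * t)) * (b t - b 0)\<bar> \<le> 2 * K * G" by simp
  show ?thesis using 1 2 unfolding ou_path_def G_def[symmetric] by linarith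
qed

text \<open>Abel summation moves the increments from b to the exponential e. On each cell the
  increment of e is l times its integral, so the error there is the oscillation of b times that
  increment. These weights telescope to e t - e 0 <= 1, so the bound is free of l.\<close>

lemma ou_sum_error:
  assumes l: "l \<ge> 0" and t: "t \<in> {0..T}" and \<gamma>: "0 < \<gamma>" and K: "K \<ge> 0" and n: "n > 0"
    and b: "\<And>s t. s \<in> {0..T} \<Longrightarrow> t \<in> {0..T} \<Longrightarrow> \<bar>b t - b s\<bar> \<le> K * \<bar>t - s\<bar> powr \<gamma>"
  shows "\<bar>ou_sum l b t n - ou_path l b t\<bar> \<le> K * (t / n) powr \<gamma>"
proof -
  define \<tau> where "\<tau> j = t * real j / real n" for j
  define e where "e s = exp (- (l * (t - s)))" for s
  define c where "c s = b t - b s" for s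
  have t0: "t \<ge> 0" using t by simp
  have \<tau>0: "\<tau> 0 = 0" "\<tau> n = t" using n by (auto simp: \<tau>_def)
  have \<tau>_mono: "\<tau> i \<le> \<tau> j" if "i \<le> j" for i j
    unfolding \<tau>_def using that t0 by (intro divide_right_mono mult_left_mono) auto
  have \<tau>_step: "\<tau> (Suc j) - \<tau> j = t / n" for j by (simp add: \<tau>_def algebra_simps flip: diff_divide_distrib)
  have \<tau>_in: "0 \<le> \<tau> j" "j \<le> n \<Longrightarrow> \<tau> j \<le> t" for j
    using \<tau>_mono[of 0 j] \<tau>_mono[of j n] by (simp_all add: \<tau>0)
  have bc: "continuous_on {0..T} b" by (rule hoelder_continuous_on[OF \<gamma> b])
  have cc: "continuous_on {x..y} (\<lambda>s. e s * c s)" if "0 \<le> x" "y \<le> t" for x y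
    unfolding e_def c_def by (intro continuous_intros continuous_on_subset[OF bc]) (use that t in auto)
  have ec: "continuous_on {x..y} (\<lambda>s. e s * C)" for x y C
    unfolding e_def by (intro continuous_intros)
  have e_int: "l * integral {x..y} e = e y - e x" if "x \<le> y" for x y
  proof -
    have "(e has_vector_derivative l * e s) (at s within {x..y})" for s
      unfolding has_real_derivative_iff_has_vector_derivative[symmetric] e_def [abs_def]
      by (auto intro!: derivative_eq_intros)
    from fundamental_theorem_of_calculus[OF that this]
    have "integral {x..y} (\<lambda>s. l * e s) = e y - e x" by (rule integral_unique)
    thus ?thesis by (simp only: Henstock_Kurzweil_Integration.integral_mult_right)
  qed
  have e_mono: "e x \<le> e y" if "x \<le> y" for x y
    unfolding e_def using l that by (simp add: mult_left_mono)
  have partial: "\<bar>(\<Sum>j<m. c (\<tau> j) * (e (\<tau> (Suc j)) - e (\<tau> j))) - l * integral {0..\<tau> m} (\<lambda>s. e s * c s)\<bar>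
      \<le> K * (t / n) powr \<gamma> * (e (\<tau> m) - e (\<tau> 0))" if "m \<le> n" for m
    using that
  proof (induction m)
    case 0
    show ?case by (simp add: \<tau>0)
  next
    case (Suc m)
    have m: "0 \<le> \<tau> m" "\<tau> m \<le> \<tau> (Suc m)" "\<tau> (Suc m) \<le> t"
      using \<tau>_in(1)[of m] \<tau>_in(2)[of "Suc m"] \<tau>_mono[of m "Suc m"] Suc.prems by auto
    have split: "integral {0..\<tau> (Suc m)} (\<lambda>s. e s * c s) = integral {0..\<tau> m} (\<lambda>s. e s * c s) + integral {\<tau> m..\<tau> (Suc m)} (\<lambda>s. e s * c s)"
      using m by (intro Henstock_Kurzweil_Integration.integral_combine[symmetric] integrable_continuous_interval cc) auto
    have eI: "integral {\<tau> m..\<tau> (Suc m)} (\<lambda>s. e s * C) = integral {\<tau> m..\<tau> (Suc m)} e * C" for C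
      by (rule Henstock_Kurzweil_Integration.integral_mult_left)
    have "integral {\<tau> m..\<tau> (Suc m)} (\<lambda>s. e s * c (\<tau> m)) - integral {\<tau> m..\<tau> (Suc m)} (\<lambda>s. e s * c s)
        = integral {\<tau> m..\<tau> (Suc m)} (\<lambda>s. e s * c (\<tau> m) - e s * c s)"
      using m by (intro Henstock_Kurzweil_Integration.integral_diff[symmetric] integrable_continuous_interval cc ec) auto
    also have "norm \<dots> \<le> integral {\<tau> m..\<tau> (Suc m)} (\<lambda>s. e s * (K * (t / n) powr \<gamma>))"
    proof (intro integral_norm_bound_integral integrable_continuous_interval ec)
      show "continuous_on {\<tau> m..\<tau> (Suc m)} (\<lambda>s. e s * c (\<tau> m) - e s * c s)"
        using m by (intro continuous_on_diff cc ec) auto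
      fix s assume s: "s \<in> {\<tau> m..\<tau> (Suc m)}"
      have sT: "s \<in> {0..T}" "\<tau> m \<in> {0..T}" using s m t by auto
      have "\<bar>b s - b (\<tau> m)\<bar> \<le> K * \<bar>s - \<tau> m\<bar> powr \<gamma>" by (rule b[OF sT(2,1)])
      also have "\<dots> \<le> K * (t / n) powr \<gamma>"
        using s \<tau>_step[of m] K \<gamma> by (intro mult_left_mono powr_mono2) auto
      finally have "\<bar>c (\<tau> m) - c s\<bar> \<le> K * (t / n) powr \<gamma>" by (simp add: c_def)
      moreover have "e s \<ge> 0" by (simp add: e_def)
      ultimately show "norm (e s * c (\<tau> m) - e s * c s) \<le> e s * (K * (t / n) powr \<gamma>)"
        unfolding right_diff_distrib[symmetric] by (simp add: abs_mult mult_left_mono)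
    qed
    finally have "l * \<bar>integral {\<tau> m..\<tau> (Suc m)} e * c (\<tau> m) - integral {\<tau> m..\<tau> (Suc m)} (\<lambda>s. e s * c s)\<bar> \<le> l * (integral {\<tau> m..\<tau> (Suc m)} e * (K * (t / n) powr \<gamma>))"
      unfolding eI using l by (intro mult_left_mono) auto
    hence "\<bar>(l * integral {\<tau> m..\<tau> (Suc m)} e) * c (\<tau> m) - l * integral {\<tau> m..\<tau> (Suc m)} (\<lambda>s. e s * c s)\<bar> \<le> (l * integral {\<tau> m..\<tau> (Suc m)} e) * (K * (t / n) powr \<gamma>)"
      using l by (simp add: abs_mult mult.assoc flip: right_diff_distrib)
    hence inc: "\<bar>(e (\<tau> (Suc m)) - e (\<tau> m)) * c (\<tau> m) - l * integral {\<tau> m..\<tau> (Suc m)} (\<lambda>s. e s * c s)\<bar> \<le> (e (\<tau> (Suc m)) - e (\<tau> m)) * (K * (t / n) powr \<gamma>)"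
      unfolding e_int[OF m(2)] .
    have "(\<Sum>j<Suc m. c (\<tau> j) * (e (\<tau> (Suc j)) - e (\<tau> j))) - l * integral {0..\<tau> (Suc m)} (\<lambda>s. e s * c s)
        = ((\<Sum>j<m. c (\<tau> j) * (e (\<tau> (Suc j)) - e (\<tau> j))) - l * integral {0..\<tau> m} (\<lambda>s. e s * c s))
          + ((e (\<tau> (Suc m)) - e (\<tau> m)) * c (\<tau> m) - l * integral {\<tau> m..\<tau> (Suc m)} (\<lambda>s. e s * c s))"
      unfolding split by (simp add: algebra_simps)
    also have "\<bar>\<dots>\<bar> \<le> K * (t / n) powr \<gamma> * (e (\<tau> m) - e (\<tau> 0)) + (e (\<tau> (Suc m)) - e (\<tau> m)) * (K * (t / n) powr \<gamma>)"
      using Suc.IH Suc.prems inc by (intro order_trans[OF abs_triangle_ineq] add_mono) auto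
    also have "\<dots> = K * (t / n) powr \<gamma> * (e (\<tau> (Suc m)) - e (\<tau> 0))" by (simp add: algebra_simps)
    finally show ?case .
  qed
  \<comment> \<open>For m = n the boundary term at t drops out because c t = 0; the one at 0 is the
    boundary term of \<open>ou_path\<close>.\<close>
  have abel: "(\<Sum>j<m. e (\<tau> (Suc j)) * (b (\<tau> (Suc j)) - b (\<tau> j))) = e (\<tau> 0) * c (\<tau> 0) - e (\<tau> m) * c (\<tau> m) + (\<Sum>j<m. c (\<tau> j) * (e (\<tau> (Suc j)) - e (\<tau> j)))" for m
    by (induction m) (auto simp: c_def algebra_simps)
  have "ou_sum l b t n = e 0 * c 0 + (\<Sum>j<n. c (\<tau> j) * (e (\<tau> (Suc j)) - e (\<tau> j)))"
  proof -
    have "ou_sum l b t n = (\<Sum>j<n. e (\<tau> (Suc j)) * (b (\<tau> (Suc j)) - b (\<tau> j)))"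
      unfolding ou_sum_def e_def \<tau>_def ..
    thus ?thesis unfolding abel[of n] by (simp add: \<tau>0 c_def)
  qed
  moreover have "ou_path l b t = e 0 * c 0 + l * integral {0..\<tau> n} (\<lambda>s. e s * c s)"
    by (simp add: ou_path_def e_def c_def \<tau>0)
  ultimately have "\<bar>ou_sum l b t n - ou_path l b t\<bar> \<le> K * (t / n) powr \<gamma> * (e (\<tau> n) - e (\<tau> 0))"
    using partial[of n] by simp
  also have "\<dots> \<le> K * (t / n) powr \<gamma> * 1"
    using K by (intro mult_left_mono) (auto simp: e_def \<tau>0)
  finally show ?thesis by simp
qed

text \<open>The sum is the integrand belonging to \<open>ou_sum\<close>. For r in a cell it equals
  the kernel at the right end of that cell, so the error is at most l times the mesh. At r = 0 all
  differences of indicators vanish while the kernel does not, which is why that point is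
  excluded.\<close>

lemma exp_step_error:
  fixes l t r :: real and n :: nat
  assumes l: "l \<ge> 0" and t: "t \<ge> 0" and n: "n > 0" and r: "r \<noteq> 0"
  shows "\<bar>(\<Sum>j<n. exp (- (l * (t - t * Suc j / n))) * (indicator {0..t * Suc j / n} r - indicator {0..t * j / n} r))
     - indicator {0..t} r * exp (- (l * (t - r)))\<bar> \<le> l * t / n"
proof -
  define \<tau> where "\<tau> j = t * real j / real n" for j
  define e where "e s = exp (- (l * (t - s)))" for s :: real
  define d where "d j = (indicator {0..\<tau> (Suc j)} r - indicator {0..\<tau> j} r :: real)" for j
  have \<tau>_mono: "\<tau> i \<le> \<tau> j" if "i \<le> j" for i j
    unfolding \<tau>_def using that t by (intro divide_right_mono mult_left_mono) auto
  have \<tau>0: "\<tau> 0 = 0" "\<tau> n = t" using n by (auto simp: \<tau>_def)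
  have \<tau>_step: "\<tau> (Suc j) - \<tau> j = t / n" for j by (simp add: \<tau>_def algebra_simps flip: diff_divide_distrib)
  have tel: "(\<Sum>j<n. d j) = indicator {0..t} r"
    unfolding d_def using sum_lessThan_telescope[of "\<lambda>j. indicator {0..\<tau> j} r :: real" n] r by (simp add: \<tau>0)
  have d0: "d j \<ge> 0" for j using \<tau>_mono[of j "Suc j"] by (auto simp: d_def indicator_def)
  have le: "\<bar>(e (\<tau> (Suc j)) - e r) * d j\<bar> \<le> l * t / n * d j" if j: "j < n" for j
  proof (cases "d j = 0")
    case False
    have m: "\<tau> j \<le> \<tau> (Suc j)" "0 \<le> \<tau> j" using \<tau>_mono[of j "Suc j"] \<tau>_mono[of 0 j] by (simp_all add: \<tau>0)
    have r': "\<tau> j < r" "r \<le> \<tau> (Suc j)"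
      using False m unfolding d_def
      by (cases "0 \<le> r"; cases "r \<le> \<tau> j"; cases "r \<le> \<tau> (Suc j)"; simp add: indicator_def)+
    have tt: "\<tau> (Suc j) \<le> t" using \<tau>_mono[of "Suc j" n] j by (simp add: \<tau>0)
    have "\<bar>e (\<tau> (Suc j)) - e r\<bar> \<le> - (l * (t - \<tau> (Suc j))) - - (l * (t - r))"
      unfolding e_def using l r' tt by (intro exp_diff_le) (auto intro!: mult_left_mono mult_nonneg_nonneg)
    also have "\<dots> = l * (\<tau> (Suc j) - r)" by (simp add: algebra_simps)
    also have "\<dots> \<le> l * (t / n)" using l r' \<tau>_step[of j] by (intro mult_left_mono) auto
    finally have "\<bar>e (\<tau> (Suc j)) - e r\<bar> \<le> l * t / n" by simp
    thus ?thesis unfolding abs_mult abs_of_nonneg[OF d0] by (rule mult_right_mono[OF _ d0])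
  qed simp
  have "(\<Sum>j<n. e (\<tau> (Suc j)) * d j) - indicator {0..t} r * e r = (\<Sum>j<n. (e (\<tau> (Suc j)) - e r) * d j)"
    unfolding tel[symmetric] sum_distrib_right sum_subtractf[symmetric]
    by (intro sum.cong refl) (simp add: algebra_simps)
  also have "\<bar>\<dots>\<bar> \<le> (\<Sum>j<n. l * t / n * d j)" by (intro order_trans[OF sum_abs] sum_mono le) auto
  also have "\<dots> = l * t / n * indicator {0..t} r" by (simp only: sum_distrib_left[symmetric] tel)
  also have "\<dots> \<le> l * t / n * 1" using l t by (intro mult_left_mono) (auto simp: indicator_def)
  finally show ?thesis by (simp add: e_def d_def \<tau>_def)
qed

lemma AE_snd_neq: "AE z in (lborel :: (real \<times> real) measure). snd z \<noteq> c"
proof -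
  have "emeasure (lborel \<Otimes>\<^sub>M lborel) (UNIV \<times> {c} :: (real \<times> real) set) = 0"
    by (subst lborel.emeasure_pair_measure_Times) auto
  hence "AE z in lborel \<Otimes>\<^sub>M lborel. z \<notin> (UNIV \<times> {c} :: (real \<times> real) set)"
    by (intro AE_not_in) (auto simp: null_sets_def)
  hence "AE z in lborel \<Otimes>\<^sub>M (lborel :: real measure). snd (z :: real \<times> real) \<noteq> c" by (simp add: mem_Times_iff)
  thus ?thesis by (simp only: lborel_prod)
qed

section \<open>Limits of distances and tails of series\<close>

lemma tendsto_zero_squeeze:
  fixes f g :: "nat \<Rightarrow> ennreal"
  assumes "\<And>n. f n \<le> g n" "g \<longlonglongrightarrow> 0"
  shows "f \<longlonglongrightarrow> 0"
  by (rule tendsto_sandwich[OF _ _ tendsto_const assms(2)]) (use assms(1) in auto)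

lemma suminf_tail_tendsto_zero:
  fixes c :: "nat \<Rightarrow> real"
  assumes c: "summable c"
  shows "(\<lambda>n. \<Sum>k. c (k + n)) \<longlonglongrightarrow> 0"
proof -
  have "(\<lambda>n. suminf c - (\<Sum>k<n. c k)) \<longlonglongrightarrow> suminf c - suminf c"
    by (intro tendsto_diff tendsto_const summable_LIMSEQ c)
  thus ?thesis by (simp add: suminf_minus_initial_segment[OF c])
qed

lemma suminf_minus_partial_le:
  fixes f c :: "nat \<Rightarrow> real"
  assumes c: "summable c" and le: "\<And>k. \<bar>f k\<bar> \<le> c k"
  shows "summable f" "\<bar>(\<Sum>k<n. f k) - suminf f\<bar> \<le> (\<Sum>k. c (k + n))"
proof -
  have s: "summable (\<lambda>k. \<bar>f k\<bar>)" by (rule summable_comparison_test'[OF c, of 0]) (use le in auto)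
  thus f: "summable f" by (rule summable_rabs_cancel)
  have sn: "summable (\<lambda>k. \<bar>f (k + n)\<bar>)" using s by (subst summable_iff_shift)
  have "\<bar>(\<Sum>k<n. f k) - suminf f\<bar> = \<bar>\<Sum>k. f (k + n)\<bar>"
    by (subst suminf_minus_initial_segment[OF f]) simp
  also have "\<dots> \<le> (\<Sum>k. \<bar>f (k + n)\<bar>)" by (rule summable_rabs[OF sn])
  also have "\<dots> \<le> (\<Sum>k. c (k + n))"
    by (rule suminf_le[OF le sn]) (use c in \<open>subst summable_iff_shift\<close>)
  finally show "\<bar>(\<Sum>k<n. f k) - suminf f\<bar> \<le> (\<Sum>k. c (k + n))" .
qed

section \<open>Distance estimates and the convolution of a single mode\<close>

context fractional_noise_space
begin

lemma emeasure_Q: "emeasure lborel Q = ennreal (pi * T)"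
  unfolding lborel_prod[symmetric] using T_pos
  by (subst lborel.emeasure_pair_measure_Times) (auto simp: ennreal_mult)

lemma L1_dist_le:
  assumes "AE z in lborel. z \<in> Q \<longrightarrow> \<bar>\<phi> z - \<psi> z\<bar> \<le> C" "C \<ge> 0"
  shows "L1_dist \<phi> \<psi> \<le> ennreal (C * (pi * T))"
proof -
  have "L1_dist \<phi> \<psi> \<le> (\<integral>\<^sup>+z. ennreal C * indicator Q z \<partial>lborel)"
    unfolding L1_dist_def
  proof (rule nn_integral_mono_AE)
    show "AE z in lborel. ennreal \<bar>indicator Q z * \<phi> z - indicator Q z * \<psi> z\<bar> \<le> ennreal C * indicator Q z"
      using assms(1)
    proof eventually_elim
      case (elim z)
      show ?case using elim by (cases "z \<in> Q") (auto intro: ennreal_leI)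
    qed
  qed
  also have "\<dots> = ennreal C * emeasure lborel Q" by (rule nn_integral_cmult_indicator) simp
  also have "\<dots> = ennreal (C * (pi * T))" using assms(2) T_pos by (simp add: emeasure_Q ennreal_mult)
  finally show ?thesis .
qed

lemma L2_dist_le:
  assumes K: "K \<in> borel_measurable M" and c: "c \<ge> 0" and le: "AE \<omega> in M. \<bar>X \<omega> - Y \<omega>\<bar> \<le> c * K \<omega>"
  shows "L2_dist X Y \<le> ennreal (c\<^sup>2) * (\<integral>\<^sup>+\<omega>. ennreal ((K \<omega>)\<^sup>2) \<partial>M)"
proof -
  have "L2_dist X Y \<le> (\<integral>\<^sup>+\<omega>. ennreal (c\<^sup>2) * ennreal ((K \<omega>)\<^sup>2) \<partial>M)"
    unfolding L2_dist_def
  proof (rule nn_integral_mono_AE)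
    show "AE \<omega> in M. ennreal ((X \<omega> - Y \<omega>)\<^sup>2) \<le> ennreal (c\<^sup>2) * ennreal ((K \<omega>)\<^sup>2)"
      using le
    proof eventually_elim
      case (elim \<omega>)
      have "(X \<omega> - Y \<omega>)\<^sup>2 \<le> (c * K \<omega>)\<^sup>2" using power_mono[OF elim, of 2] by simp
      thus ?case by (simp add: power_mult_distrib ennreal_leI flip: ennreal_mult)
    qed
  qed
  also have "\<dots> = ennreal (c\<^sup>2) * (\<integral>\<^sup>+\<omega>. ennreal ((K \<omega>)\<^sup>2) \<partial>M)"
    by (rule nn_integral_cmult[OF measurable_compose[OF borel_measurable_power[OF K] measurable_ennreal]])
  finally show ?thesis .
qed

lemma square_le_eighth: "(\<integral>\<^sup>+\<omega>. ennreal ((K \<omega>)\<^sup>2) \<partial>M) \<le> 1 + (\<integral>\<^sup>+\<omega>. ennreal (K \<omega> ^ 8) \<partial>M)"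
  if K: "K \<in> borel_measurable M" for K
proof -
  have le: "x\<^sup>2 \<le> 1 + x ^ 8" for x :: real
  proof -
    have "\<bar>x\<bar> ^ 2 \<le> 1 + \<bar>x\<bar> ^ 8"
    proof (cases "\<bar>x\<bar> \<le> 1")
      case True
      have "\<bar>x\<bar> ^ 2 \<le> 1" using True by (intro power_le_one) auto
      moreover have "0 \<le> \<bar>x\<bar> ^ 8" by simp
      ultimately show ?thesis by linarith
    next
      case False
      have "\<bar>x\<bar> ^ 2 \<le> \<bar>x\<bar> ^ 8" using False by (intro power_increasing) auto
      thus ?thesis by linarith
    qed
    thus ?thesis by (simp add: power_even_abs)
  qed
  have "(\<integral>\<^sup>+\<omega>. ennreal ((K \<omega>)\<^sup>2) \<partial>M) \<le> (\<integral>\<^sup>+\<omega>. 1 + ennreal (K \<omega> ^ 8) \<partial>M)"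
  proof (rule nn_integral_mono)
    fix \<omega>
    have "ennreal (1 + K \<omega> ^ 8) = 1 + ennreal (K \<omega> ^ 8)" by (subst ennreal_plus) auto
    thus "ennreal ((K \<omega>)\<^sup>2) \<le> 1 + ennreal (K \<omega> ^ 8)" using ennreal_leI[OF le, of "K \<omega>"] by simp
  qed
  also have "\<dots> = 1 + (\<integral>\<^sup>+\<omega>. ennreal (K \<omega> ^ 8) \<partial>M)"
  proof (subst nn_integral_add)
    show "(\<lambda>\<omega>. ennreal (K \<omega> ^ 8)) \<in> borel_measurable M"
      by (rule measurable_compose[OF borel_measurable_power[OF K] measurable_ennreal])
  qed (simp_all add: emeasure_space_1)
  finally show ?thesis .
qed

text \<open>Two approximations run in parallel. The integrands that are piecewise constant in time
  converge uniformly off the null line r = 0, hence in L1; their noises \<open>ou_sum\<close>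
  converge to \<open>ou_path\<close> in L2, since the error is (t/n)^(3/8) times a square integrable
  constant. The closed graph identifies the limits.\<close>

lemma wiener_ou_path:
  assumes B: "\<And>t. t \<in> {0..T} \<Longrightarrow> wiener (\<lambda>(y, r). mode k y * indicator {0..t} r) (B t)"
    and K: "K \<in> borel_measurable M" "\<And>\<omega>. K \<omega> \<ge> 0" "(\<integral>\<^sup>+\<omega>. ennreal ((K \<omega>)\<^sup>2) \<partial>M) < \<infinity>"
    and h: "\<And>s t \<omega>. s \<in> {0..T} \<Longrightarrow> t \<in> {0..T} \<Longrightarrow> \<bar>B t \<omega> - B s \<omega>\<bar> \<le> K \<omega> * \<bar>t - s\<bar> powr (3 / 8)"
    and l: "l \<ge> 0" and t: "t \<in> {0..T}"
  shows "wiener (\<lambda>(y, r). mode k y * (indicator {0..t} r * exp (- (l * (t - r))))) (\<lambda>\<omega>. ou_path l (\<lambda>s. B s \<omega>) t)"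
proof -
  define \<tau> where "\<tau> n j = t * real j / real n" for n j
  have \<tau>: "\<tau> n j \<in> {0..T}" if "j \<le> n" for n j
  proof -
    have "t * real j / real n \<le> t * 1" if "n > 0"
      using that t \<open>j \<le> n\<close> unfolding times_divide_eq_right[symmetric] by (intro mult_left_mono) auto
    thus ?thesis using t by (cases "n = 0") (auto simp: \<tau>_def)
  qed
  define e where "e n j = exp (- (l * (t - \<tau> n j)))" for n j
  define \<phi> where "\<phi> n z = (\<Sum>j<n. e n (Suc j) * ((case z of (y, r) \<Rightarrow> mode k y * indicator {0..\<tau> n (Suc j)} r)
      + (-1) * (case z of (y, r) \<Rightarrow> mode k y * indicator {0..\<tau> n j} r)))" for n and z :: "real \<times> real"
  define Y where "Y n \<omega> = (\<Sum>j<n. e n (Suc j) * (B (\<tau> n (Suc j)) \<omega> + (-1) * B (\<tau> n j) \<omega>))" for n \<omega>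
  have w: "wiener (\<phi> n) (Y n)" for n
    unfolding \<phi>_def [abs_def] Y_def [abs_def]
    by (intro wiener_sum wiener_cmult wiener_add B \<tau>) auto
  have Y: "Y n \<omega> = ou_sum l (\<lambda>s. B s \<omega>) t n" for n \<omega>
    by (simp add: Y_def ou_sum_def e_def \<tau>_def)
  have err: "\<bar>Y n \<omega> - ou_path l (\<lambda>s. B s \<omega>) t\<bar> \<le> (t / n) powr (3 / 8) * K \<omega>" if "n > 0" for n \<omega>
    using ou_sum_error[where b = "\<lambda>s. B s \<omega>" and K = "K \<omega>" and \<gamma> = "3 / 8", OF l t _ K(2) that h]
    unfolding Y by (simp add: mult.commute)
  have tn: "(\<lambda>n. (t / real n) powr (3 / 8)) \<longlonglongrightarrow> 0"
    by (rule tendsto_zero_powrI[OF lim_const_over_n tendsto_const]) (use t in auto)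
  have conv: "(\<lambda>n. Y n \<omega>) \<longlonglongrightarrow> ou_path l (\<lambda>s. B s \<omega>) t" for \<omega>
  proof -
    have "(\<lambda>n. (t / real n) powr (3 / 8) * K \<omega>) \<longlonglongrightarrow> 0 * K \<omega>" by (intro tendsto_mult tn tendsto_const)
    hence lim: "(\<lambda>n. (t / real n) powr (3 / 8) * K \<omega>) \<longlonglongrightarrow> 0" by simp
    have "(\<lambda>n. Y n \<omega> - ou_path l (\<lambda>s. B s \<omega>) t) \<longlonglongrightarrow> 0"
      by (rule Lim_null_comparison[OF _ lim]) (use err in \<open>auto intro!: eventually_sequentiallyI[of 1]\<close>)
    thus ?thesis by (simp add: LIM_zero_iff)
  qed
  show ?thesis
  \<comment> \<open>The index is shifted to \<open>Suc n\<close> because the error bounds require at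
    least one cell.\<close>
  proof (rule wiener_LIMSEQ[where \<phi>' = "\<lambda>n. \<phi> (Suc n)" and X' = "\<lambda>n. Y (Suc n)"])
    show "(\<lambda>\<omega>. ou_path l (\<lambda>s. B s \<omega>) t) \<in> borel_measurable M"
      by (rule borel_measurable_LIMSEQ_real[OF conv wiener_meas(1)[OF w]])
    show "Q_meas (\<lambda>(y, r). mode k y * (indicator {0..t} r * exp (- (l * (t - r)))))"
    proof (rule Q_meas_borel)
      have "(\<lambda>z. mode k (fst z) * (indicator {0..t} (snd z) * exp (- (l * (t - snd z))))) \<in> borel_measurable (borel \<Otimes>\<^sub>M borel)"
        by measurable
      thus "(\<lambda>(y, r). mode k y * (indicator {0..t} r * exp (- (l * (t - r))))) \<in> borel_measurable borel"
        by (simp add: case_prod_beta' borel_prod)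
    qed
    show "wiener (\<phi> (Suc n)) (Y (Suc n))" for n by (rule w)
    have "L1_dist (\<phi> (Suc n)) (\<lambda>(y, r). mode k y * (indicator {0..t} r * exp (- (l * (t - r))))) \<le> ennreal (l * t / Suc n * (pi * T))" for n
    proof (rule L1_dist_le)
      show "0 \<le> l * t / Suc n" using l t by auto
      show "AE z in lborel. z \<in> Q \<longrightarrow> \<bar>\<phi> (Suc n) z - (case z of (y, r) \<Rightarrow> mode k y * (indicator {0..t} r * exp (- (l * (t - r)))))\<bar> \<le> l * t / Suc n"
        using AE_snd_neq[of 0]
      proof eventually_elim
        case (elim z)
        obtain y r where z: "z = (y, r)" by (cases z)
        have "\<phi> (Suc n) z = mode k y * (\<Sum>j<Suc n. exp (- (l * (t - t * Suc j / Suc n))) * (indicator {0..t * Suc j / Suc n} r - indicator {0..t * j / Suc n} r))"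
          unfolding \<phi>_def z e_def \<tau>_def sum_distrib_left by (intro sum.cong refl) (simp add: algebra_simps)
        hence "\<phi> (Suc n) z - mode k y * (indicator {0..t} r * exp (- (l * (t - r))))
          = mode k y * ((\<Sum>j<Suc n. exp (- (l * (t - t * Suc j / Suc n))) * (indicator {0..t * Suc j / Suc n} r - indicator {0..t * j / Suc n} r)) - indicator {0..t} r * exp (- (l * (t - r))))"
          by (simp only: right_diff_distrib)
        also have "\<bar>\<dots>\<bar> \<le> 1 * (l * t / Suc n)"
          unfolding abs_mult by (intro mult_mono abs_mode_le exp_step_error l) (use t elim z in auto)
        finally show ?case by (simp add: z)
      qed
    qed
    moreover have "(\<lambda>n. ennreal (l * t / Suc n * (pi * T))) \<longlonglongrightarrow> 0"
    proof -
      have "(\<lambda>n. l * t / real (Suc n) * (pi * T)) \<longlonglongrightarrow> 0 * (pi * T)"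
        by (intro tendsto_mult tendsto_const LIMSEQ_Suc[OF lim_const_over_n])
      from tendsto_ennrealI[OF this] show ?thesis by simp
    qed
    ultimately show "(\<lambda>n. L1_dist (\<phi> (Suc n)) (\<lambda>(y, r). mode k y * (indicator {0..t} r * exp (- (l * (t - r)))))) \<longlonglongrightarrow> 0"
      by (rule tendsto_zero_squeeze)
    obtain E where E: "(\<integral>\<^sup>+\<omega>. ennreal ((K \<omega>)\<^sup>2) \<partial>M) = ennreal E" "E \<ge> 0"
      using K(3) by (cases "\<integral>\<^sup>+\<omega>. ennreal ((K \<omega>)\<^sup>2) \<partial>M") auto
    have "L2_dist (Y (Suc n)) (\<lambda>\<omega>. ou_path l (\<lambda>s. B s \<omega>) t) \<le> ennreal (((t / Suc n) powr (3 / 8))\<^sup>2 * E)" for n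
      using L2_dist_le[OF K(1), of "(t / Suc n) powr (3 / 8)" "Y (Suc n)" "\<lambda>\<omega>. ou_path l (\<lambda>s. B s \<omega>) t"] err[of "Suc n"] E
      by (simp add: ennreal_mult)
    moreover have "(\<lambda>n. ennreal (((t / Suc n) powr (3 / 8))\<^sup>2 * E)) \<longlonglongrightarrow> 0"
    proof -
      have "(\<lambda>n. ((t / real (Suc n)) powr (3 / 8))\<^sup>2 * E) \<longlonglongrightarrow> 0\<^sup>2 * E"
        by (intro tendsto_mult tendsto_const tendsto_power LIMSEQ_Suc[OF tn])
      from tendsto_ennrealI[OF this] show ?thesis by simp
    qed
    ultimately show "(\<lambda>n. L2_dist (Y (Suc n)) (\<lambda>\<omega>. ou_path l (\<lambda>s. B s \<omega>) t)) \<longlonglongrightarrow> 0"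
      by (rule tendsto_zero_squeeze)
  qed
qed

end

section \<open>The stochastic convolution\<close>

lemma exp_kernel_integral_le:
  fixes l t :: real
  assumes l: "l > 0" and t: "t \<ge> 0"
  shows "(\<integral>\<^sup>+r. ennreal (exp (- (l * (t - r)))) * indicator {0..t} r \<partial>lborel) \<le> ennreal (1 / l)"
proof -
  have "(\<integral>\<^sup>+r. ennreal (exp (- (l * (t - r)))) * indicator {0..t} r \<partial>lborel) = ennreal (exp (- (l * (t - t))) / l - exp (- (l * (t - 0))) / l)"
  proof (rule nn_integral_FTC_Icc[where F = "\<lambda>r. exp (- (l * (t - r))) / l"])
    show "((\<lambda>r. exp (- (l * (t - r))) / l) has_real_derivative exp (- (l * (t - r)))) (at r)" for r
      using l by (auto intro!: derivative_eq_intros)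
  qed (use t in auto)
  also have "\<dots> \<le> ennreal (1 / l)" using l by (intro ennreal_leI) auto
  finally show ?thesis .
qed

text \<open>For k >= 1 the k-th term has L1 norm at most pi/k^4, the length of D times the time
  integral of the exponential. The series of exponentials is summable for r < t, and the line r = t
  is null.\<close>

lemma (in fractional_noise_space) green_series_L1:
  fixes x t :: real
  assumes t: "t \<in> {0..T}"
  defines "\<phi> \<equiv> \<lambda>n z. \<Sum>k<n. mode k x * (case z of (y, r) \<Rightarrow> mode k y * (indicator {0..t} r * exp (- (real k ^ 4 * (t - r)))))"
    and "\<psi> \<equiv> \<lambda>(y, s). indicator {0..t} s * green x y (t - s)"
  shows "(\<lambda>n. L1_dist (\<phi> n) \<psi>) \<longlonglongrightarrow> 0"
proof -
  define c where "c k r = exp (- (real k ^ 4 * (t - r))) * indicator {0..t} r" for k r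
  define d where "d k = pi * inverse (real k ^ 4)" for k :: nat
  have ds: "summable d" unfolding d_def by (intro summable_mult inverse_power_summable) simp
  have c0: "c k r \<ge> 0" for k r by (simp add: c_def)
  have [measurable]: "(\<lambda>r. ennreal (c k r)) \<in> borel_measurable borel" for k unfolding c_def by measurable
  have le: "ennreal \<bar>indicator Q z * \<phi> n z - indicator Q z * \<psi> z\<bar> \<le> (\<Sum>k. indicator D (fst z) * ennreal (c (k + n) (snd z)))"
    if z: "snd z \<noteq> t" for z n
  proof (cases "z \<in> Q \<and> snd z \<in> {0..t}")
    case False
    hence "indicator Q z * \<phi> n z - indicator Q z * \<psi> z = 0"
      by (cases z) (auto simp: \<phi>_def \<psi>_def indicator_def)
    thus ?thesis by (simp only: abs_zero ennreal_0 zero_le)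
  next
    case True
    obtain y r where zz: "z = (y, r)" by (cases z)
    have r: "0 \<le> r" "r < t" and y: "y \<in> D" using True z by (auto simp: zz)
    have ck: "c k r = exp (- (real k ^ 4 * (t - r)))" for k using r by (simp add: c_def)
    have cs: "summable (\<lambda>k. c k r)" using summable_power_exp[of "t - r" 0] r by (simp add: ck)
    have fle: "\<bar>c k r * mode k x * mode k y\<bar> \<le> c k r" for k
      using order_trans[OF abs_mode_mult_le[of "c k r * mode k x" k y] abs_mode_mult_le[of "c k r" k x]] c0[of k r] by simp
    have "\<phi> n z = (\<Sum>k<n. c k r * mode k x * mode k y)"
      unfolding \<phi>_def zz by (intro sum.cong refl) (simp add: c_def mult_ac)
    moreover have "\<psi> z = (\<Sum>k. c k r * mode k x * mode k y)"
      using r by (simp add: \<psi>_def zz green_def ck)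
    ultimately have "\<bar>\<phi> n z - \<psi> z\<bar> \<le> (\<Sum>k. c (k + n) r)"
      using suminf_minus_partial_le(2)[OF cs fle] by simp
    hence "ennreal \<bar>indicator Q z * \<phi> n z - indicator Q z * \<psi> z\<bar> \<le> ennreal (\<Sum>k. c (k + n) r)"
      using True by (simp add: ennreal_leI)
    also have "\<dots> = (\<Sum>k. ennreal (c (k + n) r))"
      by (rule suminf_ennreal2[symmetric, OF c0 summable_ignore_initial_segment[OF cs]])
    also have "\<dots> = (\<Sum>k. indicator D (fst z) * ennreal (c (k + n) (snd z)))"
      using y by (simp add: zz)
    finally show ?thesis .
  qed
  \<comment> \<open>The tail starts at n + 1, so the mode k = 0, whose exponential does not decay,
    never occurs in it.\<close>
  have bound: "L1_dist (\<phi> (Suc n)) \<psi> \<le> ennreal (\<Sum>k. d (k + Suc n))" for n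
  proof -
    have m: "(\<lambda>z. indicator D (fst z) * ennreal (c k (snd z))) \<in> borel_measurable (lborel \<Otimes>\<^sub>M lborel)" for k
      by measurable
    have "L1_dist (\<phi> (Suc n)) \<psi> \<le> (\<integral>\<^sup>+z. (\<Sum>k. indicator D (fst z) * ennreal (c (k + Suc n) (snd z))) \<partial>lborel)"
      unfolding L1_dist_def
    proof (rule nn_integral_mono_AE)
      show "AE z in lborel. ennreal \<bar>indicator Q z * \<phi> (Suc n) z - indicator Q z * \<psi> z\<bar> \<le> (\<Sum>k. indicator D (fst z) * ennreal (c (k + Suc n) (snd z)))"
        using AE_snd_neq[of t] by (rule eventually_mono) (rule le)
    qed
    also have "\<dots> = (\<integral>\<^sup>+z. (\<Sum>k. indicator D (fst z) * ennreal (c (k + Suc n) (snd z))) \<partial>(lborel \<Otimes>\<^sub>M lborel))"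
      by (simp only: lborel_prod)
    also have "\<dots> = (\<Sum>k. \<integral>\<^sup>+z. indicator D (fst z) * ennreal (c (k + Suc n) (snd z)) \<partial>(lborel \<Otimes>\<^sub>M lborel))"
      by (rule nn_integral_suminf[OF m])
    also have "\<dots> \<le> (\<Sum>k. ennreal (d (k + Suc n)))"
    proof (rule suminf_le)
      fix k
      define j where "j = k + Suc n"
      have "(\<integral>\<^sup>+z. indicator D (fst z) * ennreal (c j (snd z)) \<partial>(lborel \<Otimes>\<^sub>M lborel)) = (\<integral>\<^sup>+y. \<integral>\<^sup>+r. indicator D y * ennreal (c j r) \<partial>lborel \<partial>lborel)"
        using lborel.nn_integral_fst[OF m[of j]] by simp
      also have "\<dots> = (\<integral>\<^sup>+y. indicator D y * (\<integral>\<^sup>+r. ennreal (c j r) \<partial>lborel) \<partial>lborel)"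
        by (intro nn_integral_cong nn_integral_cmult) simp
      also have "\<dots> = (\<integral>\<^sup>+y. (\<integral>\<^sup>+r. ennreal (c j r) \<partial>lborel) * indicator D y \<partial>lborel)" by (simp add: mult.commute)
      also have "\<dots> = (\<integral>\<^sup>+r. ennreal (c j r) \<partial>lborel) * ennreal pi"
        by (subst nn_integral_cmult_indicator) auto
      also have "(\<integral>\<^sup>+r. ennreal (c j r) \<partial>lborel) = (\<integral>\<^sup>+r. ennreal (exp (- (real j ^ 4 * (t - r)))) * indicator {0..t} r \<partial>lborel)"
        by (intro nn_integral_cong) (simp add: c_def indicator_def)
      also have "\<dots> * ennreal pi \<le> ennreal (1 / real j ^ 4) * ennreal pi"
        using t by (intro mult_right_mono exp_kernel_integral_le) (auto simp: j_def)
      also have "\<dots> = ennreal (d j)"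
        by (subst ennreal_mult[symmetric]) (auto simp: d_def inverse_eq_divide)
      finally show "(\<integral>\<^sup>+z. indicator D (fst z) * ennreal (c (k + Suc n) (snd z)) \<partial>(lborel \<Otimes>\<^sub>M lborel)) \<le> ennreal (d (k + Suc n))"
        unfolding j_def .
    qed auto
    also have "\<dots> = ennreal (\<Sum>k. d (k + Suc n))"
      by (rule suminf_ennreal2[OF _ summable_ignore_initial_segment[OF ds]]) (simp add: d_def)
    finally show ?thesis .
  qed
  have "(\<lambda>n. L1_dist (\<phi> (Suc n)) \<psi>) \<longlonglongrightarrow> 0"
  proof (rule tendsto_sandwich[OF _ _ tendsto_const, where h = "\<lambda>n. ennreal (\<Sum>k. d (k + Suc n))"])
    show "(\<lambda>n. ennreal (\<Sum>k. d (k + Suc n))) \<longlonglongrightarrow> 0"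
      using tendsto_ennrealI[OF LIMSEQ_Suc[OF suminf_tail_tendsto_zero[OF ds]]] by simp
  qed (use bound in auto)
  thus ?thesis by (rule LIMSEQ_imp_Suc)
qed

context fractional_noise_space
begin

text \<open>The \<open>k\<close>-th mode of the stochastic convolution is bounded by \<open>k\<close> to the power \<open>-3/2\<close> times a random constant whose
  eighth moment does not depend on \<open>k\<close>; a single random constant then works for all \<open>k\<close> at the price of a
  factor \<open>(k + 1)\<close> to the power \<open>1/4\<close>.\<close>

theorem stochastic_convolution_version:
  obtains V where
    "AE \<omega> in M. continuous_on Q (\<lambda>(x, t). V x t \<omega>)"
    "\<And>x t Z. x \<in> D \<Longrightarrow> t \<in> {0..T} \<Longrightarrow>
      has_wiener_integral M H T W (\<lambda>(y, s). indicator {0..t} s * green x y (t - s)) Z \<Longrightarrow>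
      AE \<omega> in M. Z \<omega> = V x t \<omega>"
proof -
  \<comment> \<open>Path and Hoelder constant of a mode are bundled in one predicate, so that the
    choice over all k is made for pairs.\<close>
  define good where "good k B K \<longleftrightarrow>
    (\<forall>t\<in>{0..T}. wiener (\<lambda>(y, r). mode k y * indicator {0..t} r) (B t)) \<and>
    K \<in> borel_measurable M \<and> (\<forall>\<omega>. K \<omega> \<ge> 0) \<and>
    (\<forall>s\<in>{0..T}. \<forall>t\<in>{0..T}. \<forall>\<omega>. \<bar>B t \<omega> - B s \<omega>\<bar> \<le> K \<omega> * \<bar>t - s\<bar> powr (3 / 8)) \<and>
    (\<integral>\<^sup>+\<omega>. ennreal (K \<omega> ^ 8) \<partial>M) \<le> ennreal mode_const" for k :: nat and B :: "real \<Rightarrow> 'a \<Rightarrow> real" and K :: "'a \<Rightarrow> real"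
  have "\<exists>B K. good k B K" for k
  proof (rule mode_process[of k])
    fix B :: "real \<Rightarrow> 'a \<Rightarrow> real" and K :: "'a \<Rightarrow> real"
    assume "\<And>t. t \<in> {0..T} \<Longrightarrow> wiener (\<lambda>(y, r). mode k y * indicator {0..t} r) (B t)"
      "K \<in> borel_measurable M" "\<And>\<omega>. K \<omega> \<ge> 0"
      "\<And>s t \<omega>. s \<in> {0..T} \<Longrightarrow> t \<in> {0..T} \<Longrightarrow> \<bar>B t \<omega> - B s \<omega>\<bar> \<le> K \<omega> * \<bar>t - s\<bar> powr (3 / 8)"
      "(\<integral>\<^sup>+\<omega>. ennreal (K \<omega> ^ 8) \<partial>M) \<le> ennreal mode_const"
    hence "good k B K" unfolding good_def by blast
    thus ?thesis by blast
  qed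
  hence gex: "\<exists>p. good k (fst p) (snd p)" for k by simp
  define P where "P k = (SOME p. good k (fst p) (snd p))" for k
  define B where "B k = fst (P k)" for k
  define K where "K k = snd (P k)" for k
  have g: "good k (B k) (K k)" for k
    unfolding B_def K_def P_def by (rule someI_ex[OF gex])
  have Bw: "wiener (\<lambda>(y, r). mode k y * indicator {0..t} r) (B k t)" if "t \<in> {0..T}" for k t
    using g[of k] that by (simp add: good_def)
  have Km: "K k \<in> borel_measurable M" and K0: "K k \<omega> \<ge> 0"
    and Kq: "(\<integral>\<^sup>+\<omega>. ennreal (K k \<omega> ^ 8) \<partial>M) \<le> ennreal mode_const" for k \<omega>
    using g[of k] by (simp_all add: good_def)
  have h: "\<bar>B k t \<omega> - B k s \<omega>\<bar> \<le> K k \<omega> * \<bar>t - s\<bar> powr (3 / 8)" if "s \<in> {0..T}" "t \<in> {0..T}" for k s t \<omega>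
    using g[of k] that by (simp add: good_def)
  define Z where "Z k t \<omega> = ou_path (real k ^ 4) (\<lambda>s. B k s \<omega>) t" for k t \<omega>
  define V where "V x t \<omega> = (\<Sum>k. mode k x * Z k t \<omega>)" for x t \<omega>
  have Zw: "wiener (\<lambda>(y, r). mode k y * (indicator {0..t} r * exp (- (real k ^ 4 * (t - r))))) (Z k t)" if t: "t \<in> {0..T}" for k t
    unfolding Z_def [abs_def]
  proof (rule wiener_ou_path[OF Bw Km K0 _ h])
    have "(\<integral>\<^sup>+\<omega>. ennreal ((K k \<omega>)\<^sup>2) \<partial>M) \<le> 1 + ennreal mode_const"
      by (rule order_trans[OF square_le_eighth[OF Km] add_left_mono[OF Kq]])
    also have "\<dots> < \<infinity>" by simp
    finally show "(\<integral>\<^sup>+\<omega>. ennreal ((K k \<omega>)\<^sup>2) \<partial>M) < \<infinity>" .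
  qed (use t in auto)
  have Zc: "continuous_on {0..T} (\<lambda>t. Z k t \<omega>)" for k \<omega>
    unfolding Z_def by (rule ou_path_continuous[OF hoelder_continuous_on[where \<gamma> = "3 / 8" and K = "K k \<omega>"]]) (simp, rule h)

  \<comment> \<open>The weights (k + 1)^(-2) make the expectation finite, as the eighth moments of
    \<open>K k\<close> are bounded uniformly in k.\<close>
  define S where "S \<omega> = (\<Sum>k. ennreal (inverse (real (Suc k) ^ 2) * K k \<omega> ^ 8))" for \<omega>
  have tm: "(\<lambda>\<omega>. ennreal (inverse (real (Suc k) ^ 2) * K k \<omega> ^ 8)) \<in> borel_measurable M" for k
    by (intro measurable_compose[OF _ measurable_ennreal] borel_measurable_times borel_measurable_const borel_measurable_power Km)
  have Sm: "S \<in> borel_measurable M" unfolding S_def by (rule borel_measurable_suminf_order[OF tm])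
  have inv2: "summable (\<lambda>k. inverse (real (Suc k) ^ 2))"
    using inverse_power_summable[of 2, where 'a = real] by (subst summable_Suc_iff) simp
  have S_int: "(\<integral>\<^sup>+\<omega>. S \<omega> \<partial>M) < \<infinity>"
  proof -
    define c where "c = max 0 mode_const"
    have "(\<integral>\<^sup>+\<omega>. S \<omega> \<partial>M) = (\<Sum>k. \<integral>\<^sup>+\<omega>. ennreal (inverse (real (Suc k) ^ 2) * K k \<omega> ^ 8) \<partial>M)"
      unfolding S_def by (rule nn_integral_suminf[OF tm])
    also have "\<dots> \<le> (\<Sum>k. ennreal (inverse (real (Suc k) ^ 2) * c))"
    proof (rule suminf_le)
      fix k
      have "(\<integral>\<^sup>+\<omega>. ennreal (inverse (real (Suc k) ^ 2) * K k \<omega> ^ 8) \<partial>M) = (\<integral>\<^sup>+\<omega>. ennreal (inverse (real (Suc k) ^ 2)) * ennreal (K k \<omega> ^ 8) \<partial>M)"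
        using K0 by (intro nn_integral_cong ennreal_mult) auto
      also have "\<dots> = ennreal (inverse (real (Suc k) ^ 2)) * (\<integral>\<^sup>+\<omega>. ennreal (K k \<omega> ^ 8) \<partial>M)"
        by (rule nn_integral_cmult[OF measurable_compose[OF borel_measurable_power[OF Km] measurable_ennreal]])
      also have "\<dots> \<le> ennreal (inverse (real (Suc k) ^ 2)) * ennreal c"
        by (intro mult_left_mono order_trans[OF Kq]) (auto simp: c_def intro: ennreal_leI)
      also have "\<dots> = ennreal (inverse (real (Suc k) ^ 2) * c)" by (rule ennreal_mult[symmetric]) (auto simp: c_def)
      finally show "(\<integral>\<^sup>+\<omega>. ennreal (inverse (real (Suc k) ^ 2) * K k \<omega> ^ 8) \<partial>M) \<le> ennreal (inverse (real (Suc k) ^ 2) * c)" .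
    qed auto
    also have "\<dots> = ennreal (\<Sum>k. inverse (real (Suc k) ^ 2) * c)"
      by (rule suminf_ennreal2[OF _ summable_mult2[OF inv2]]) (simp add: c_def)
    also have "\<dots> < \<infinity>" by simp
    finally show ?thesis .
  qed
  have fin: "AE \<omega> in M. S \<omega> \<noteq> \<infinity>" by (rule nn_integral_PInf_AE[OF Sm]) (use S_int in simp)
  define L where "L \<omega> = (if S \<omega> = \<infinity> then 0 else root 8 (enn2real (S \<omega>)))" for \<omega>
  have Lm: "L \<in> borel_measurable M" using Sm unfolding L_def by measurable
  have L0: "L \<omega> \<ge> 0" for \<omega> by (simp add: L_def)
  have L8: "ennreal (L \<omega> ^ 8) \<le> S \<omega>" for \<omega>
    by (cases "S \<omega> = \<infinity>") (auto simp: L_def less_top)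
  have L2: "(\<integral>\<^sup>+\<omega>. ennreal ((L \<omega>)\<^sup>2) \<partial>M) < \<infinity>"
  proof -
    have "(\<integral>\<^sup>+\<omega>. ennreal (L \<omega> ^ 8) \<partial>M) < \<infinity>" using nn_integral_mono[OF L8] S_int by (rule le_less_trans)
    hence "1 + (\<integral>\<^sup>+\<omega>. ennreal (L \<omega> ^ 8) \<partial>M) < \<infinity>" by (simp add: ennreal_add_less_top)
    with square_le_eighth[OF Lm] show ?thesis by (rule le_less_trans)
  qed
  \<comment> \<open>Each term of the series is at most S, and the eighth root of (k + 1)^2 is (k +
    1)^(1/4).\<close>
  have KL: "K k \<omega> \<le> real (Suc k) powr (1 / 4) * L \<omega>" if fin: "S \<omega> \<noteq> \<infinity>" for k \<omega>
  proof -
    define g where "g j = ennreal (inverse (real (Suc j) ^ 2) * K j \<omega> ^ 8)" for j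
    have "sum g {k} \<le> suminf g" by (rule sum_le_suminf[OF summableI]) auto
    hence "g k \<le> suminf g" by simp
    hence "ennreal (inverse (real (Suc k) ^ 2) * K k \<omega> ^ 8) \<le> S \<omega>" unfolding S_def g_def .
    also have "S \<omega> = ennreal (enn2real (S \<omega>))" using fin by (cases "S \<omega>") auto
    finally have 1: "inverse (real (Suc k) ^ 2) * K k \<omega> ^ 8 \<le> enn2real (S \<omega>)" by (simp add: ennreal_le_iff)
    have "(K k \<omega> / real (Suc k) powr (1 / 4)) ^ 8 = inverse (real (Suc k) ^ 2) * K k \<omega> ^ 8"
    proof -
      have "(real (Suc k) powr (1 / 4)) ^ 8 = (real (Suc k) powr (1 / 4)) powr real 8" by (subst powr_realpow) auto
      also have "\<dots> = real (Suc k) powr (1 / 4 * real 8)" by (rule powr_powr)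
      also have "\<dots> = real (Suc k) powr real 2" by simp
      also have "\<dots> = real (Suc k) ^ 2" by (rule powr_realpow) simp
      finally show ?thesis by (simp only: power_divide inverse_eq_divide times_divide_eq_left mult_1)
    qed
    with 1 have "root 8 ((K k \<omega> / real (Suc k) powr (1 / 4)) ^ 8) \<le> L \<omega>" using fin by (simp add: L_def)
    moreover have "root 8 ((K k \<omega> / real (Suc k) powr (1 / 4)) ^ 8) = K k \<omega> / real (Suc k) powr (1 / 4)"
      using K0 by (intro real_root_power_cancel) auto
    ultimately have "K k \<omega> / real (Suc k) powr (1 / 4) \<le> L \<omega>" by simp
    thus ?thesis by (simp add: pos_divide_le_eq mult.commute)
  qed
  \<comment> \<open>The exponent is -3/2 + 1/4. The constant 18 = 6 * 3 joins that of
    \<open>ou_path_bound\<close> with the price of replacing k by k + 1, and T^(3/8) covers the mode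
    k = 0.\<close>
  define w where "w k = (18 + T powr (3 / 8)) * real (Suc k) powr (- (5 / 4))" for k
  have w0: "w k \<ge> 0" for k by (simp add: w_def add_nonneg_nonneg)
  have ws: "summable w"
  proof -
    have "summable (\<lambda>k. real k powr (- (5 / 4)))" by (subst summable_real_powr_iff) simp
    hence "summable (\<lambda>k. real (Suc k) powr (- (5 / 4)))" by (subst summable_Suc_iff)
    thus ?thesis unfolding w_def by (rule summable_mult)
  qed
  have Zb: "\<bar>mode k x * Z k t \<omega>\<bar> \<le> w k * L \<omega>" if fin: "S \<omega> \<noteq> \<infinity>" and t: "t \<in> {0..T}" for k x t \<omega>
  proof -
    have "\<bar>Z k t \<omega>\<bar> \<le> w k * L \<omega>"
    proof (cases "k = 0")
      case True
      \<comment> \<open>At rate 0 the convolution is the increment of the path itself; only its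
        Hoelder bound over [0, T] is available.\<close>
      have "\<bar>Z 0 t \<omega>\<bar> = \<bar>B 0 t \<omega> - B 0 0 \<omega>\<bar>" by (simp add: Z_def ou_path_def)
      also have "\<dots> \<le> K 0 \<omega> * \<bar>t - 0\<bar> powr (3 / 8)" by (rule h) (use t in auto)
      also have "\<dots> \<le> L \<omega> * T powr (3 / 8)"
        using KL[OF fin, of 0] t L0 by (intro mult_mono powr_mono2) auto
      also have "\<dots> \<le> w 0 * L \<omega>" using mult_left_mono[of "T powr (3 / 8)" "18 + T powr (3 / 8)" "L \<omega>"] L0[of \<omega>] by (simp add: w_def mult.commute)
      finally show ?thesis using True by simp
    next
      case False
      define m where "m = real k"
      have m: "m \<ge> 1" using False by (simp add: m_def)
      have "\<bar>Z k t \<omega>\<bar> \<le> 6 * K k \<omega> * (m ^ 4) powr (- (3 / 8))"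
        unfolding Z_def m_def by (rule ou_path_bound[OF _ t _ _ K0 h]) (use False in auto)
      also have "(m ^ 4) powr (- (3 / 8)) = m powr (- (3 / 2))"
      proof -
        have "(m ^ 4) powr (- (3 / 8)) = (m powr real 4) powr (- (3 / 8))" using m by (subst powr_realpow) auto
        also have "\<dots> = m powr (real 4 * - (3 / 8))" by (rule powr_powr)
        finally show ?thesis by simp
      qed
      \<comment> \<open>For k >= 1 one has k + 1 <= 2 k, and 2^(3/2) <= 3.\<close>
      also have "m powr (- (3 / 2)) \<le> 3 * real (Suc k) powr (- (3 / 2))"
      proof -
        have "real (Suc k) powr (3 / 2) \<le> (2 * m) powr (3 / 2)" using m by (intro powr_mono2) (auto simp: m_def)
        also have "\<dots> = 2 powr (3 / 2) * m powr (3 / 2)" by (rule powr_mult)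
        also have "\<dots> \<le> 3 * m powr (3 / 2)"
        proof (intro mult_right_mono)
          have "(2 powr (3 / 2) :: real) = 2 powr 1 * 2 powr (1 / 2)"
            unfolding powr_add[symmetric] by (rule arg_cong2[where f = "(powr)"]) simp_all
          also have "\<dots> = 2 * sqrt 2" by (simp add: powr_half_sqrt)
          also have "sqrt 2 \<le> 3 / 2" by (rule real_le_lsqrt) (auto simp: power2_eq_square)
          finally show "(2 powr (3 / 2) :: real) \<le> 3" by simp
        qed simp
        finally have le: "real (Suc k) powr (3 / 2) \<le> 3 * m powr (3 / 2)" .
        have "1 / m powr (3 / 2) = 3 / (3 * m powr (3 / 2))" using m by simp
        also have "\<dots> \<le> 3 / real (Suc k) powr (3 / 2)" using le m by (intro divide_left_mono) auto
        finally show ?thesis unfolding powr_minus_divide by (simp only: times_divide_eq_right mult_1_right)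
      qed
      hence "6 * K k \<omega> * m powr (- (3 / 2)) \<le> 6 * (real (Suc k) powr (1 / 4) * L \<omega>) * (3 * real (Suc k) powr (- (3 / 2)))"
        using KL[OF fin, of k] K0[of k \<omega>] L0[of \<omega>] by (intro mult_mono) auto
      also have "\<dots> = 18 * (real (Suc k) powr (1 / 4) * real (Suc k) powr (- (3 / 2))) * L \<omega>"
        by algebra
      also have "real (Suc k) powr (1 / 4) * real (Suc k) powr (- (3 / 2)) = real (Suc k) powr (- (5 / 4))"
        unfolding powr_add[symmetric] by (rule arg_cong2[where f = "(powr)"]) simp_all
      also have "18 * real (Suc k) powr (- (5 / 4)) * L \<omega> \<le> w k * L \<omega>"
        unfolding w_def using L0 by (intro mult_right_mono) auto
      finally show ?thesis .
    qed
    thus ?thesis using abs_mode_mult_le[of "Z k t \<omega>" k x] by (simp add: mult.commute)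
  qed
  show thesis
  proof (rule that[of V])
    show "AE \<omega> in M. continuous_on Q (\<lambda>(x, t). V x t \<omega>)"
      using fin
    proof eventually_elim
      case (elim \<omega>)
      have "continuous_on Q (\<lambda>z. \<Sum>k. mode k (fst z) * Z k (snd z) \<omega>)"
      proof (rule uniform_limit_theorem)
        show "uniform_limit Q (\<lambda>n z. \<Sum>k<n. mode k (fst z) * Z k (snd z) \<omega>) (\<lambda>z. \<Sum>k. mode k (fst z) * Z k (snd z) \<omega>) sequentially"
        proof (rule Weierstrass_m_test[OF _ summable_mult2[OF ws]])
          show "norm (mode k (fst z) * Z k (snd z) \<omega>) \<le> w k * L \<omega>" if "z \<in> Q" for k z
            using Zb[OF elim, of "snd z" k "fst z"] that by (auto simp: mem_Times_iff)
        qed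
        show "\<forall>\<^sub>F n in sequentially. continuous_on Q (\<lambda>z. \<Sum>k<n. mode k (fst z) * Z k (snd z) \<omega>)"
        proof (intro always_eventually allI continuous_on_sum)
          fix k
          have "continuous_on Q (\<lambda>z. Z k (snd z) \<omega>)"
            by (rule continuous_on_compose2[OF Zc continuous_on_snd[OF continuous_on_id]]) auto
          thus "continuous_on Q (\<lambda>z. mode k (fst z) * Z k (snd z) \<omega>)"
            by (rule continuous_on_mult[OF continuous_on_mode[OF continuous_on_fst[OF continuous_on_id]]])
        qed
      qed simp
      thus ?case by (simp add: V_def case_prod_beta')
    qed
  next
    fix x t Z'
    assume x: "x \<in> D" and t: "t \<in> {0..T}"
      and Z': "has_wiener_integral M H T W (\<lambda>(y, s). indicator {0..t} s * green x y (t - s)) Z'"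
    define \<psi> where "\<psi> = (\<lambda>(y, s). indicator {0..t} s * green x y (t - s))"
    have wZ': "wiener \<psi> Z'" unfolding \<psi>_def by (rule has_wiener_integral_wiener[OF Z'])
    define X where "X n \<omega> = (\<Sum>k<n. mode k x * Z k t \<omega>)" for n \<omega>
    define \<phi> where "\<phi> n z = (\<Sum>k<n. mode k x * (case z of (y, r) \<Rightarrow> mode k y * (indicator {0..t} r * exp (- (real k ^ 4 * (t - r))))))" for n and z :: "real \<times> real"
    have w\<phi>: "wiener (\<phi> n) (X n)" for n
      unfolding \<phi>_def [abs_def] X_def [abs_def] by (intro wiener_sum wiener_cmult Zw t) auto
    have diff: "\<bar>X n \<omega> - V x t \<omega>\<bar> \<le> (\<Sum>k. w (k + n)) * L \<omega>" if "S \<omega> \<noteq> \<infinity>" for n \<omega>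
    proof -
      have "\<bar>X n \<omega> - V x t \<omega>\<bar> \<le> (\<Sum>k. w (k + n) * L \<omega>)"
        unfolding X_def V_def by (rule suminf_minus_partial_le(2)[OF summable_mult2[OF ws] Zb[OF that t]])
      also have "\<dots> = (\<Sum>k. w (k + n)) * L \<omega>"
        by (rule suminf_mult2[symmetric, OF summable_ignore_initial_segment[OF ws]])
      finally show ?thesis .
    qed
    have tail0: "(\<lambda>n. \<Sum>k. w (k + n)) \<longlonglongrightarrow> 0" by (rule suminf_tail_tendsto_zero[OF ws])
    have tailnn: "(\<Sum>k. w (k + n)) \<ge> 0" for n by (rule suminf_nonneg[OF summable_ignore_initial_segment[OF ws] w0])
    obtain E where E: "(\<integral>\<^sup>+\<omega>. ennreal ((L \<omega>)\<^sup>2) \<partial>M) = ennreal E" "E \<ge> 0"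
      using L2 by (cases "\<integral>\<^sup>+\<omega>. ennreal ((L \<omega>)\<^sup>2) \<partial>M") auto
    \<comment> \<open>\<open>V x t\<close> is controlled only where S is finite, while the graph
      asks for a measurable function on the whole space; the limit of the partial sums supplies
      one.\<close>
    have "\<exists>V'. V' \<in> borel_measurable M \<and> (AE \<omega> in M. V x t \<omega> = V' \<omega>)"
    proof -
      define V' where "V' \<omega> = lim (\<lambda>n. X n \<omega>)" for \<omega>
      have "V' \<in> borel_measurable M" unfolding V'_def [abs_def] by (rule borel_measurable_lim_metric[OF wiener_meas(1)[OF w\<phi>]])
      moreover have "AE \<omega> in M. V x t \<omega> = V' \<omega>"
        using fin
      proof eventually_elim
        case (elim \<omega>)
        have l0: "(\<lambda>n. (\<Sum>k. w (k + n)) * L \<omega>) \<longlonglongrightarrow> 0" by (rule tendsto_mult_left_zero[OF tail0])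
        have "(\<lambda>n. X n \<omega> - V x t \<omega>) \<longlonglongrightarrow> 0"
          by (rule Lim_null_comparison[OF always_eventually[OF allI] l0]) (simp only: real_norm_def diff[OF elim])
        hence "(\<lambda>n. X n \<omega>) \<longlonglongrightarrow> V x t \<omega>" by (simp add: LIM_zero_iff)
        from limI[OF this] show ?case by (simp only: V'_def)
      qed
      ultimately show ?thesis by blast
    qed
    then obtain V' where V': "V' \<in> borel_measurable M" "AE \<omega> in M. V x t \<omega> = V' \<omega>" by blast
    have "wiener \<psi> V'"
    proof (rule wiener_LIMSEQ[where \<phi>' = \<phi> and X' = X])
      show "V' \<in> borel_measurable M" by (rule V')
      show "Q_meas \<psi>" by (rule wiener_meas(2)[OF wZ'])
      show "wiener (\<phi> n) (X n)" for n by (rule w\<phi>)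
      have "L2_dist (X n) V' \<le> ennreal ((\<Sum>k. w (k + n))\<^sup>2 * E)" for n
      proof -
        have "AE \<omega> in M. \<bar>X n \<omega> - V' \<omega>\<bar> \<le> (\<Sum>k. w (k + n)) * L \<omega>"
          using fin V'(2)
        proof eventually_elim
          case (elim \<omega>)
          show ?case using diff[OF elim(1), of n] by (simp only: elim(2))
        qed
        from L2_dist_le[OF Lm tailnn this] show ?thesis by (simp only: E(1) ennreal_mult[OF zero_le_power2 E(2)])
      qed
      moreover have "(\<lambda>n. ennreal ((\<Sum>k. w (k + n))\<^sup>2 * E)) \<longlonglongrightarrow> 0"
      proof -
        have "(\<lambda>n. (\<Sum>k. w (k + n))\<^sup>2 * E) \<longlonglongrightarrow> 0\<^sup>2 * E" by (rule tendsto_mult[OF tendsto_power[OF tail0] tendsto_const])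
        from tendsto_ennrealI[OF this] show ?thesis by simp
      qed
      ultimately show "(\<lambda>n. L2_dist (X n) V') \<longlonglongrightarrow> 0"
      by (rule tendsto_zero_squeeze)
      show "(\<lambda>n. L1_dist (\<phi> n) \<psi>) \<longlonglongrightarrow> 0"
        unfolding \<phi>_def \<psi>_def by (rule green_series_L1[OF t])
    qed
    from wiener_unique[OF wZ' this] V'(2) show "AE \<omega> in M. Z' \<omega> = V x t \<omega>"
      by eventually_elim simp
  qed
qed

end

section \<open>The continuous version\<close>

lemma dyadic_tendsto:
  assumes "T > 0" "t \<in> {0..T}"
  shows "(\<lambda>n. dyadic T n t) \<longlonglongrightarrow> t"
proof -
  have "(\<lambda>n. T * (1 / 2) ^ n) \<longlonglongrightarrow> T * 0" by (intro tendsto_mult tendsto_const LIMSEQ_realpow_zero) auto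
  hence lim: "(\<lambda>n. T * (1 / 2) ^ n) \<longlonglongrightarrow> 0" by simp
  have "(\<lambda>n. dyadic T n t - t) \<longlonglongrightarrow> 0"
    by (rule Lim_null_comparison[OF _ lim]) (use dyadic_bounds(2)[OF assms] in \<open>simp add: power_one_over\<close>)
  thus ?thesis by (simp add: LIM_zero_iff)
qed

text \<open>Fubini requires joint measurability, but \<open>v\<close> is only known to be continuous
  in x for almost every omega. It is recovered as the limit of \<open>u\<close> at the dyadic points
  of x: this limit is jointly measurable, being built from countably many sections of
  \<open>u\<close>, and it agrees with \<open>v\<close> because \<open>v\<close> = \<open>u\<close>
  almost surely on the countable grid and \<open>v\<close> is continuous.\<close>

lemma (in prob_space) fixed_time_version:
  fixes u v :: "real \<Rightarrow> 'a \<Rightarrow> real"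
  assumes u: "(\<lambda>(x, \<omega>). u x \<omega>) \<in> borel_measurable (restrict_space borel D \<Otimes>\<^sub>M M)"
    and vc: "AE \<omega> in M. continuous_on D (\<lambda>x. v x \<omega>)"
    and vu: "\<And>x. x \<in> D \<Longrightarrow> AE \<omega> in M. v x \<omega> = u x \<omega>"
  shows "AE \<omega> in M. AE y in lborel. y \<in> D \<longrightarrow> v y \<omega> = u y \<omega>"
proof -
  define R where "R = restrict_space lborel D"
  have R_sets: "sets R = sets (restrict_space borel D)" by (simp add: R_def sets_restrict_space)
  have R_space: "space R = D" by (simp add: R_def space_restrict_space)
  interpret R: sigma_finite_measure R unfolding R_def by (rule sigma_finite_measure_restrict_space[OF sigma_finite_lborel]) simp
  interpret P: pair_sigma_finite R M ..
  have u': "(\<lambda>(x, \<omega>). u x \<omega>) \<in> borel_measurable (R \<Otimes>\<^sub>M M)"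
    using u by (subst measurable_cong_sets[OF sets_pair_measure_cong[OF R_sets refl] refl])
  define C where "C = (\<lambda>(n, j). pi * real j / 2 ^ n) ` (UNIV :: (nat \<times> nat) set) \<inter> D"
  have C: "countable C" unfolding C_def by (intro countable_Int1 countable_image) auto
  have dC: "dyadic pi n y \<in> C" if "y \<in> D" for n y
    using dyadic_bounds(1)[OF pi_gt_zero that, of n] by (auto simp: C_def dyadic_def)
  have sec: "(\<lambda>\<omega>. u x \<omega>) \<in> borel_measurable M" if "x \<in> D" for x
  proof -
    have "Pair x \<in> measurable M (R \<Otimes>\<^sub>M M)" using that by (intro measurable_Pair1') (simp add: R_space)
    from measurable_compose[OF this u'] show ?thesis by simp
  qed
  define U where "U n z = u (dyadic pi n (fst z)) (snd z)" for n and z :: "real \<times> 'a"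
  have Um: "U n \<in> borel_measurable (R \<Otimes>\<^sub>M M)" for n
  proof -
    have fm: "(\<lambda>z. u i (snd z)) \<in> borel_measurable (R \<Otimes>\<^sub>M M)" if "i \<in> C" for i
      using measurable_compose[OF measurable_snd sec[of i]] that by (auto simp: C_def)
    have gm: "(\<lambda>z. dyadic pi n (fst z)) \<in> measurable (R \<Otimes>\<^sub>M M) (count_space C)"
    proof (rule measurable_count_space_eq_countable[THEN iffD2, OF C], intro conjI ballI)
      show "(\<lambda>z. dyadic pi n (fst z)) \<in> space (R \<Otimes>\<^sub>M M) \<rightarrow> C"
        by (auto simp: space_pair_measure R_space intro!: dC simp del: atLeastAtMost_iff)
      fix c assume "c \<in> C"
      have "dyadic pi n \<in> borel_measurable borel" unfolding dyadic_def [abs_def] by measurable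
      hence "dyadic pi n \<in> borel_measurable R"
        unfolding R_def by (intro measurable_restrict_space1) simp
      hence "(\<lambda>z. dyadic pi n (fst z)) \<in> borel_measurable (R \<Otimes>\<^sub>M M)" by (rule measurable_compose[OF measurable_fst])
      from measurable_sets[OF this, of "{c}"]
      show "(\<lambda>z. dyadic pi n (fst z)) -` {c} \<inter> space (R \<Otimes>\<^sub>M M) \<in> sets (R \<Otimes>\<^sub>M M)" by simp
    qed
    show ?thesis unfolding U_def [abs_def] by (rule measurable_compose_countable'[OF fm gm C])
  qed
  define L where "L z = lim (\<lambda>n. U n z)" for z
  have Lm: "L \<in> borel_measurable (R \<Otimes>\<^sub>M M)" unfolding L_def [abs_def] by (intro borel_measurable_lim_metric Um)
  have "AE \<omega> in M. \<forall>x\<in>C. v x \<omega> = u x \<omega>"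
    using C vu by (subst AE_ball_countable) (auto simp: C_def)
  with vc have L: "AE \<omega> in M. \<forall>y\<in>D. L (y, \<omega>) = v y \<omega>"
  proof eventually_elim
    case (elim \<omega>)
    show ?case
    proof
      fix y assume y: "y \<in> D"
      have "(\<lambda>n. v (dyadic pi n y) \<omega>) \<longlonglongrightarrow> v y \<omega>"
        by (rule continuous_on_tendsto_compose[OF elim(1) dyadic_tendsto[OF pi_gt_zero y] y])
           (intro always_eventually allI dyadic_bounds(1)[OF pi_gt_zero y])
      moreover have "v (dyadic pi n y) \<omega> = U n (y, \<omega>)" for n using elim(2) dC[OF y] by (simp add: U_def)
      ultimately show "L (y, \<omega>) = v y \<omega>" unfolding L_def by (simp add: limI)
    qed
  qed
  have "AE y in R. AE \<omega> in M. L (y, \<omega>) = u y \<omega>"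
  proof (rule AE_I2)
    fix y assume "y \<in> space R"
    hence y: "y \<in> D" by (simp add: R_space)
    show "AE \<omega> in M. L (y, \<omega>) = u y \<omega>" using L vu[OF y] by eventually_elim (use y in auto)
  qed
  \<comment> \<open>Joint measurability of both the limit and \<open>u\<close> makes this set
    measurable, so that the two almost-everywhere quantifiers can be exchanged.\<close>
  moreover have "{z \<in> space (R \<Otimes>\<^sub>M M). L (fst z, snd z) = u (fst z) (snd z)} \<in> sets (R \<Otimes>\<^sub>M M)"
    using borel_measurable_eq[OF Lm u'] by (simp add: case_prod_beta')
  ultimately have "AE \<omega> in M. AE y in R. L (y, \<omega>) = u y \<omega>"
    using P.AE_commute[of "\<lambda>y \<omega>. L (y, \<omega>) = u y \<omega>"] by simp
  with L show ?thesis
  proof eventually_elim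
    case (elim \<omega>)
    have "AE y in lborel. y \<in> D \<longrightarrow> L (y, \<omega>) = u y \<omega>"
      using elim(2) unfolding R_def by (subst (asm) AE_restrict_space_iff) auto
    thus ?case using elim(1) by (auto elim!: eventually_mono)
  qed
qed

text \<open>Passing from countably many times to all times: \<open>v(\<cdot>,s) \<rightarrow> v(\<cdot>,t)\<close> pointwise and \<open>u(\<cdot>,s) \<rightarrow> u(\<cdot>,t)\<close> in
  \<open>L\<^sup>p\<close>, so Fatou's lemma identifies the two limits.\<close>

lemma all_times_version:
  fixes u v :: "real \<Rightarrow> real \<Rightarrow> real"
  assumes T: "T > 0" and p: "p > 0" and u: "Lp_continuous p T u"
    and v: "continuous_on (D \<times> {0..T}) (\<lambda>(x, t). v x t)"
    and eq: "\<And>n. AE y in lborel. y \<in> D \<longrightarrow> v y (dyadic T n t) = u y (dyadic T n t)"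
    and t: "t \<in> {0..T}"
  shows "AE y in lborel. y \<in> D \<longrightarrow> v y t = u y t"
proof -
  define s where "s n = dyadic T n t" for n
  have s: "s n \<in> {0..T}" for n unfolding s_def by (rule dyadic_bounds(1)[OF T t])
  have s_lim: "s \<longlonglongrightarrow> t" unfolding s_def by (rule dyadic_tendsto[OF T t])
  define g where "g r = (LINT y:D|lborel. \<bar>u y r - u y t\<bar> powr p)" for r
  \<comment> \<open>The limit in \<open>Lp_continuous\<close> leaves out the time t itself, whereas
    \<open>s n\<close> may equal t; the value 0 there turns it into continuity of g at t.\<close>
  have "g t = 0" by (simp add: g_def set_lebesgue_integral_def)
  hence "continuous (at t within {0..T}) g"
    using Lp_continuous_moment[OF u p t] by (simp add: continuous_within g_def[abs_def])
  from continuous_within_tendsto_compose[OF this _ s_lim] s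
  have g0: "(\<lambda>n. g (s n)) \<longlonglongrightarrow> 0" using \<open>g t = 0\<close> by simp
  have inLp: "in_Lp p (\<lambda>y. u y (s n) - u y t)" for n
    using u s t p by (intro in_Lp_diff) (auto simp: Lp_continuous_def)
  define f where "f n y = ennreal (indicator D y * \<bar>u y (s n) - u y t\<bar> powr p)" for n y
  have fi: "integrable lborel (\<lambda>y. indicator D y * \<bar>u y (s n) - u y t\<bar> powr p)" for n
    using inLp[of n] by (simp add: in_Lp_def set_integrable_def)
  have fm: "f n \<in> borel_measurable lborel" for n
    unfolding f_def by (rule measurable_compose[OF borel_measurable_integrable[OF fi] measurable_ennreal])
  have f_int: "(\<integral>\<^sup>+y. f n y \<partial>lborel) = ennreal (g (s n))" for n
    unfolding f_def g_def set_lebesgue_integral_def using fi by (subst nn_integral_eq_integral) auto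
  have "AE y in lborel. \<forall>n. y \<in> D \<longrightarrow> v y (s n) = u y (s n)"
    by (subst AE_all_countable) (use eq in \<open>auto simp: s_def elim: eventually_mono\<close>)
  hence lim: "AE y in lborel. (\<lambda>n. f n y) \<longlonglongrightarrow> ennreal (indicator D y * \<bar>v y t - u y t\<bar> powr p)"
  proof eventually_elim
    case (elim y)
    show ?case
    proof (cases "y \<in> D")
      case True
      have "(\<lambda>n. v y (s n)) \<longlonglongrightarrow> v y t"
        using continuous_on_tendsto_compose[OF v tendsto_Pair[OF tendsto_const s_lim], of y] True t s by simp
      hence l: "(\<lambda>n. u y (s n)) \<longlonglongrightarrow> v y t" using elim True by simp
      have "(\<lambda>n. \<bar>u y (s n) - u y t\<bar> powr p) \<longlonglongrightarrow> \<bar>v y t - u y t\<bar> powr p"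
        by (rule tendsto_powr'[OF tendsto_rabs[OF tendsto_diff[OF l tendsto_const]] tendsto_const]) (use p in auto)
      from tendsto_ennrealI[OF this] show ?thesis using True by (simp add: f_def)
    qed (simp add: f_def)
  qed
  \<comment> \<open>The lower limit is measurable as such and agrees almost everywhere with the
    limit, which involves \<open>v\<close> at time t.\<close>
  define G where "G y = liminf (\<lambda>n. f n y)" for y
  have Gm: "G \<in> borel_measurable lborel" unfolding G_def by (intro borel_measurable_liminf fm)
  have limG: "AE y in lborel. G y = ennreal (indicator D y * \<bar>v y t - u y t\<bar> powr p)"
    using lim by eventually_elim (simp add: G_def lim_imp_Liminf)
  have le: "(\<integral>\<^sup>+y. G y \<partial>lborel) \<le> ennreal e" if e: "e > 0" for e
  proof -
    obtain k where k: "\<And>n. n \<ge> k \<Longrightarrow> g (s n) < e"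
      using order_tendstoD(2)[OF g0 e] unfolding eventually_sequentially by blast
    show ?thesis
    proof (rule nn_integral_limit_le[OF fm])
      show "AE y in lborel. (\<lambda>n. f n y) \<longlonglongrightarrow> G y" using lim limG by eventually_elim simp
      show "(\<integral>\<^sup>+y. f n y \<partial>lborel) \<le> ennreal e" if "n \<ge> k" for n
        unfolding f_int using k[OF that] by (intro ennreal_leI) simp
    qed
  qed
  have "(\<integral>\<^sup>+y. G y \<partial>lborel) \<le> 0" by (rule ennreal_le_epsilon) (simp only: add_0 le)
  hence "AE y in lborel. G y = 0" using nn_integral_0_iff_AE[OF Gm] by simp
  with limG show ?thesis
  proof eventually_elim
    case (elim y)
    show ?case
    proof
      assume "y \<in> D"
      hence "ennreal (\<bar>v y t - u y t\<bar> powr p) = 0" using elim by simp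
      hence "\<bar>v y t - u y t\<bar> powr p \<le> 0" by (simp only: ennreal_eq_0_iff)
      hence "\<bar>v y t - u y t\<bar> powr p = 0" by (rule order_antisym) simp
      thus "v y t = u y t" by simp
    qed
  qed
qed

text \<open>The version is the right-hand side of the equation for \<open>u\<close> itself, with the
  Wiener integrals replaced by the continuous field V. The drift is still that of \<open>u\<close>,
  so no fixed point argument is involved: continuity is read off term by term, and agreement with
  \<open>u\<close> at each point is the mild equation.\<close>

theorem lemma3p2:
  fixes M :: "'a measure" and T H \<sigma> p :: real and f :: "real poly" and u0 :: "real \<Rightarrow> real"
    and W :: "real set \<Rightarrow> real \<Rightarrow> 'a \<Rightarrow> real" and u :: "real \<Rightarrow> real \<Rightarrow> 'a \<Rightarrow> real"
  assumes "prob_space M" and "complete_measure M"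
    and "T > 0" and "1 / 2 < H" and "H < 1"
    and "degree f = 3" and "lead_coeff f > 0"
    and "continuous_on D u0"
    and "fractional_noise M H T W"
    and "p \<ge> 4"
    and "mild_solution M H T W \<sigma> f u0 p u"
  shows "\<exists>v. version_of M T u v \<and> as_continuous M T v"
proof -
  interpret prob_space M by fact
  interpret fractional_noise_space M T H W by unfold_locales fact+
  have um: "(\<lambda>(x, \<omega>). u x t \<omega>) \<in> borel_measurable (restrict_space borel D \<Otimes>\<^sub>M M)" if "t \<in> {0..T}" for t
    using assms(11) that by (simp add: mild_solution_def)
  have p0: "p > 0" using assms(10) by simp
  have uL: "AE \<omega> in M. Lp_continuous p T (\<lambda>x t. u x t \<omega>)"
    using assms(11) by (simp add: mild_solution_def)
  have mild: "mild_equation M H T W \<sigma> f u0 u" using assms(11) by (simp add: mild_solution_def)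
  show ?thesis
  proof (rule stochastic_convolution_version)
  fix V
  assume Vc: "AE \<omega> in M. continuous_on (D \<times> {0..T}) (\<lambda>(x, t). V x t \<omega>)"
    and VZ: "\<And>x t Z. x \<in> D \<Longrightarrow> t \<in> {0..T} \<Longrightarrow>
      has_wiener_integral M H T W (\<lambda>(y, s). indicator {0..t} s * green x y (t - s)) Z \<Longrightarrow> AE \<omega> in M. Z \<omega> = V x t \<omega>"
  define v where "v x t \<omega> = initial_term u0 x t + drift_term f (\<lambda>y s. u y s \<omega>) x t + \<sigma> * V x t \<omega>" for x t \<omega>
  have vu: "AE \<omega> in M. v x t \<omega> = u x t \<omega>" if x: "x \<in> D" and t: "t \<in> {0..T}" for x t
  proof -
    obtain Z where Z: "has_wiener_integral M H T W (\<lambda>(y, s). indicator {0..t} s * green x y (t - s)) Z"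
      "AE \<omega> in M. u x t \<omega> = initial_term u0 x t + drift_term f (\<lambda>y s. u y s \<omega>) x t + \<sigma> * Z \<omega>"
      using mild x t unfolding mild_equation_def by blast
    from VZ[OF x t Z(1)] Z(2) show ?thesis by eventually_elim (simp add: v_def)
  qed
  have vc: "AE \<omega> in M. continuous_on (D \<times> {0..T}) (\<lambda>(x, t). v x t \<omega>)"
    using Vc uL
  proof eventually_elim
    case (elim \<omega>)
    have "degree f \<le> 3" using assms by simp
    have "continuous_on (D \<times> {0..T}) (\<lambda>z. (case z of (x, t) \<Rightarrow> initial_term u0 x t)
        + (case z of (x, t) \<Rightarrow> drift_term f (\<lambda>y s. u y s \<omega>) x t) + \<sigma> * (case z of (x, t) \<Rightarrow> V x t \<omega>))"
      by (intro continuous_on_add continuous_on_mult continuous_on_const elim(1)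
          continuous_on_initial_term[OF assms(3,8)] continuous_on_drift_term[OF _ elim(2) \<open>degree f \<le> 3\<close> assms(10)])
         (use assms(3) in simp)
    thus ?case by (simp add: v_def case_prod_beta')
  qed
  have fixed: "AE \<omega> in M. AE y in lborel. y \<in> D \<longrightarrow> v y t \<omega> = u y t \<omega>" if t: "t \<in> {0..T}" for t
  proof (rule fixed_time_version[OF um[OF t] _ vu[OF _ t]])
    show "AE \<omega> in M. continuous_on D (\<lambda>x. v x t \<omega>)"
      using vc
    proof eventually_elim
      case (elim \<omega>)
      have "continuous_on D (\<lambda>x. (\<lambda>(x, t). v x t \<omega>) (x, t))"
        by (rule continuous_on_compose2[OF elim]) (use t in \<open>auto intro!: continuous_intros\<close>)
      thus ?case by simp
    qed
  qed
  \<comment> \<open>All dyadic times form one countable set, so a single null event serves them all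
    before the passage to every t.\<close>
  define C where "C = (\<lambda>(n, j). T * real j / 2 ^ n) ` (UNIV :: (nat \<times> nat) set) \<inter> {0..T}"
  have C: "countable C" unfolding C_def by (intro countable_Int1 countable_image) auto
  have "AE \<omega> in M. \<forall>t\<in>C. AE y in lborel. y \<in> D \<longrightarrow> v y t \<omega> = u y t \<omega>"
    using C fixed by (subst AE_ball_countable) (auto simp: C_def)
  with vc uL have "AE \<omega> in M. \<forall>t\<in>{0..T}. AE y in lborel. y \<in> D \<longrightarrow> v y t \<omega> = u y t \<omega>"
  proof eventually_elim
    case (elim \<omega>)
    show ?case
    proof
      fix t assume t: "t \<in> {0..T}"
      have dC: "dyadic T n t \<in> C" for n
        using dyadic_bounds(1)[OF assms(3) t, of n] by (auto simp: C_def dyadic_def)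
      have eq: "AE y in lborel. y \<in> D \<longrightarrow> v y (dyadic T n t) \<omega> = u y (dyadic T n t) \<omega>" for n
        by (rule bspec[OF elim(3) dC])
      show "AE y in lborel. y \<in> D \<longrightarrow> v y t \<omega> = u y t \<omega>"
        using all_times_version[where v = "\<lambda>x t. v x t \<omega>" and u = "\<lambda>x t. u x t \<omega>", OF assms(3) p0 elim(2,1) eq t] .
    qed
  qed
  moreover have "\<forall>x\<in>D. \<forall>t\<in>{0..T}. AE \<omega> in M. v x t \<omega> = u x t \<omega>"
  proof (rule ballI, rule ballI)
    fix x t assume "x \<in> D" "t \<in> {0..T}"
    thus "AE \<omega> in M. v x t \<omega> = u x t \<omega>" by (rule vu)
  qed
  ultimately have "version_of M T u v" unfolding version_of_def by (simp only: simp_thms)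
  moreover have "as_continuous M T v" unfolding as_continuous_def by (rule vc)
  ultimately have "version_of M T u v \<and> as_continuous M T v" by (rule conjI)
  thus ?thesis by (intro exI)
  qed
qed

end
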